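(* Let $U$ be a Galois $\Gamma$-ring in $\mathcal K=\mathcal L^G$, $\mathcal L=L*\mathcal M$, where $\mathcal M$ is a nontrivial group. (i) The skew group ring $\mathcal L=L*\mathcal M$ is simple. (ii) If $G$ acts on $\mathcal L$ by outer automorphisms and $|G|^{-1}\in L$, then $\mathcal K$ is simple. (iii) If $G$ acts on $\mathcal L$ by X-outer automorphisms and $\mathcal M$ is polycyclic-by-finite, then $\mathcal K$ is a prime Noetherian ring. Consequently, $U$ is a prime right Goldie ring.
   Context: Setting: $\Lambda$ is an integrally closed (commutative) domain, $\operatorname{Aut}(\Lambda)$ is its group of ring automorphisms (algebra automorphisms, if a base ring is fixed), $G$ is a finite subgroup of $\operatorname{Aut}(\Lambda)$ and $\mathcal M$ is a submonoid of $\operatorname{Aut}(\Lambda)$ such that (1) $\mathcal M\mathcal M^{-1}\cap G=\{e\}$; (2) $G$ acts on $\mathcal M$ by conjugation, $g\cdot\mu=g\mu g^{-1}\in\mathcal M$; (3) $\Lambda$ is a Noetherian $\Lambda^G$-module. The monoid $\mathcal M$ is assumed finitely generated. Put $L=\operatorname{Frac}\Lambda$, $\Gamma=\Lambda^G$, $K=\operatorname{Frac}\Gamma=L^G$. The skew monoid ring $\mathcal L=L*\mathcal M$ is the free left $L$-module on $\mathcal M$ with multiplication $(a\mu)(b\nu)=a\,\mu(b)\,\mu\nu$. The group $G$ acts on $\mathcal L$ by ring automorphisms via $a\mu\mapsto g(a)\,(g\cdot\mu)$, and $\mathcal K=\mathcal L^G$ is the fixed ring. A Galois $\Gamma$-ring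 in $\mathcal K$ is a subring $U\subseteq\mathcal K$ containing $\Gamma$ and finitely generated as a ring over $\Gamma$ such that $KU=UK=\mathcal K$. "$G$ acts by outer (resp. X-outer) automorphisms" means every nontrivial element of $G$ acts as an outer, i.e. non-inner (resp. X-outer) automorphism. An automorphism $\phi$ of a prime right Goldie ring $R$, with classical right quotient ring $Q(R)$, is X-outer if there is no nonzero $x\in Q(R)$ with $x\,\phi(r)=r\,x$ for all $r\in R$. A group is polycyclic-by-finite if it has a finite subnormal series from $\{1\}$ to the whole group, each successive quotient of which is finite or infinite cyclic. A ring is right Goldie if it has finite right uniform dimension and satisfies the ascending chain condition on right annihilators. "Noetherian" means left and right Noetherian. *)

theory Defs
  imports
    "HOL-Computational_Algebra.Fraction_Field"
    "HOL-Computational_Algebra.Polynomial"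
    "HOL-Algebra.Coset"
    "HOL-Algebra.Subrings"
    "HOL-Algebra.Ideal_Product"
    "HOL-Algebra.Generated_Rings"
    "HOL-Algebra.Elementary_Groups"
begin

text \<open>
  The commutative domain \<open>\<Lambda>\<close> is a type of class \<^class>\<open>idom\<close> and \<open>L = Frac \<Lambda>\<close> is the library type
  of fractions over it.  The noncommutative rings are records in the style of HOL-Algebra, because
  their carriers depend on the monoid \<open>M\<close>.
\<close>

section \<open>Notions for arbitrary rings and groups\<close>

definition acc :: "('a set \<Rightarrow> bool) \<Rightarrow> bool" where
  "acc P \<longleftrightarrow>
     (\<forall>C :: nat \<Rightarrow> 'a set. (\<forall>n. P (C n) \<and> C n \<subseteq> C (Suc n)) \<longrightarrow> (\<exists>n. \<forall>m\<ge>n. C m = C n))"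

definition right_ideal :: "'a set \<Rightarrow> ('a, 'm) ring_scheme \<Rightarrow> bool" where
  "right_ideal I R \<longleftrightarrow>
     subgroup I (add_monoid R) \<and> (\<forall>x\<in>I. \<forall>r\<in>carrier R. x \<otimes>\<^bsub>R\<^esub> r \<in> I)"

definition left_ideal :: "'a set \<Rightarrow> ('a, 'm) ring_scheme \<Rightarrow> bool" where
  "left_ideal I R \<longleftrightarrow>
     subgroup I (add_monoid R) \<and> (\<forall>x\<in>I. \<forall>r\<in>carrier R. r \<otimes>\<^bsub>R\<^esub> x \<in> I)"

text \<open>The library's \<open>noetherian_ring\<close> only concerns two-sided ideals.\<close>

definition lr_noetherian :: "('a, 'm) ring_scheme \<Rightarrow> bool" where
  "lr_noetherian R \<longleftrightarrow>
     ring R \<and> acc (\<lambda>I. left_ideal I R) \<and> acc (\<lambda>I. right_ideal I R)"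

definition simple_ring :: "('a, 'm) ring_scheme \<Rightarrow> bool" where
  "simple_ring R \<longleftrightarrow>
     ring R \<and> carrier R \<noteq> {\<zero>\<^bsub>R\<^esub>} \<and> (\<forall>I. ideal I R \<longrightarrow> I = {\<zero>\<^bsub>R\<^esub>} \<or> I = carrier R)"

definition prime_ring :: "('a, 'm) ring_scheme \<Rightarrow> bool" where
  "prime_ring R \<longleftrightarrow>
     ring R \<and> carrier R \<noteq> {\<zero>\<^bsub>R\<^esub>} \<and>
     (\<forall>I J. ideal I R \<and> ideal J R \<and> I \<cdot>\<^bsub>R\<^esub> J = {\<zero>\<^bsub>R\<^esub>} \<longrightarrow> I = {\<zero>\<^bsub>R\<^esub>} \<or> J = {\<zero>\<^bsub>R\<^esub>})"

definition right_annihilator :: "('a, 'm) ring_scheme \<Rightarrow> 'a set \<Rightarrow> 'a set" where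
  "right_annihilator R S = {r \<in> carrier R. \<forall>s\<in>S. s \<otimes>\<^bsub>R\<^esub> r = \<zero>\<^bsub>R\<^esub>}"

text \<open>Finite right uniform dimension: there is no infinite direct sum of nonzero right ideals.\<close>

definition finite_right_udim :: "('a, 'm) ring_scheme \<Rightarrow> bool" where
  "finite_right_udim R \<longleftrightarrow>
     \<not> (\<exists>I :: nat \<Rightarrow> 'a set.
          (\<forall>n. right_ideal (I n) R \<and> I n \<noteq> {\<zero>\<^bsub>R\<^esub>}) \<and>
          (\<forall>n x. (\<forall>i<n. x i \<in> I i) \<and> (\<Oplus>\<^bsub>R\<^esub>i\<in>{..<n}. x i) = \<zero>\<^bsub>R\<^esub> \<longrightarrow> (\<forall>i<n. x i = \<zero>\<^bsub>R\<^esub>)))"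

definition right_goldie :: "('a, 'm) ring_scheme \<Rightarrow> bool" where
  "right_goldie R \<longleftrightarrow>
     ring R \<and> finite_right_udim R \<and>
     acc (\<lambda>A. \<exists>S \<subseteq> carrier R. A = right_annihilator R S)"

definition outer_automorphism :: "('a, 'm) ring_scheme \<Rightarrow> ('a \<Rightarrow> 'a) \<Rightarrow> bool" where
  "outer_automorphism R \<phi> \<longleftrightarrow>
     \<not> (\<exists>u\<in>Units R. \<forall>x\<in>carrier R. \<phi> x = u \<otimes>\<^bsub>R\<^esub> x \<otimes>\<^bsub>R\<^esub> inv\<^bsub>R\<^esub> u)"

definition regular_elements :: "('a, 'm) ring_scheme \<Rightarrow> 'a set" where
  "regular_elements R =
     {s \<in> carrier R. \<forall>r\<in>carrier R. (s \<otimes>\<^bsub>R\<^esub> r = \<zero>\<^bsub>R\<^esub> \<or> r \<otimes>\<^bsub>R\<^esub> s = \<zero>\<^bsub>R\<^esub>) \<longrightarrow> r = \<zero>\<^bsub>R\<^esub>}"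

definition classical_right_quotient_ring ::
    "('a, 'm) ring_scheme \<Rightarrow> ('b, 'n) ring_scheme \<Rightarrow> ('a \<Rightarrow> 'b) \<Rightarrow> bool" where
  "classical_right_quotient_ring R Q \<iota> \<longleftrightarrow>
     ring R \<and> ring Q \<and> \<iota> \<in> ring_hom R Q \<and> inj_on \<iota> (carrier R) \<and>
     \<iota> ` regular_elements R \<subseteq> Units Q \<and>
     (\<forall>q\<in>carrier Q. \<exists>a\<in>carrier R. \<exists>s\<in>regular_elements R. q = \<iota> a \<otimes>\<^bsub>Q\<^esub> inv\<^bsub>Q\<^esub> (\<iota> s))"

text \<open>
  \<open>Q(R)\<close> is unique up to isomorphism over \<open>R\<close>, and by Goldie's theorem it exists for every prime
  right Goldie ring \<open>R\<close>.  Its elements are fractions \<open>a s\<^sup>-\<^sup>1\<close>, that is, equivalence classes of pairs,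
  so it can always be realised on the type \<open>('a \<times> 'a) set\<close>.
\<close>

definition x_outer_automorphism :: "('a, 'm) ring_scheme \<Rightarrow> ('a \<Rightarrow> 'a) \<Rightarrow> bool" where
  "x_outer_automorphism R \<phi> \<longleftrightarrow>
     (\<exists>(Q :: ('a \<times> 'a) set ring) \<iota>. classical_right_quotient_ring R Q \<iota> \<and>
        \<not> (\<exists>x\<in>carrier Q. x \<noteq> \<zero>\<^bsub>Q\<^esub> \<and>
             (\<forall>r\<in>carrier R. x \<otimes>\<^bsub>Q\<^esub> \<iota> (\<phi> r) = \<iota> r \<otimes>\<^bsub>Q\<^esub> x)))"

definition polycyclic_by_finite :: "('a, 'm) monoid_scheme \<Rightarrow> bool" where
  "polycyclic_by_finite H \<longleftrightarrow>
     group H \<and>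
     (\<exists>(n :: nat) N. N 0 = {\<one>\<^bsub>H\<^esub>} \<and> N n = carrier H \<and>
        (\<forall>i<n. N i \<lhd> H\<lparr>carrier := N (Suc i)\<rparr> \<and>
           (let F = H\<lparr>carrier := N (Suc i)\<rparr> Mod N i
            in finite (carrier F) \<or> (infinite (carrier F) \<and> cyclic_group F))))"


section \<open>The domain, its automorphisms, and fractions\<close>

abbreviation of_dom :: "'a::idom \<Rightarrow> 'a fract" where
  "of_dom a \<equiv> Fraction_Field.Fract a 1"

definition integrally_closed :: "'a::idom itself \<Rightarrow> bool" where
  "integrally_closed _ \<longleftrightarrow>
     (\<forall>x :: 'a fract.
        (\<exists>p :: 'a poly. lead_coeff p = 1 \<and> poly (map_poly of_dom p) x = 0) \<longrightarrow> x \<in> range of_dom)"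

definition ring_aut_group :: "('a::comm_ring_1 \<Rightarrow> 'a) monoid" where
  "ring_aut_group =
     \<lparr>carrier = {f. bij f \<and> f 1 = 1 \<and> (\<forall>a b. f (a + b) = f a + f b) \<and> (\<forall>a b. f (a * b) = f a * f b)},
      mult = (\<circ>), one = id\<rparr>"

definition fixed_points :: "('a \<Rightarrow> 'a) set \<Rightarrow> 'a set" where
  "fixed_points G = {a. \<forall>g\<in>G. g a = a}"

definition subring_fractions :: "'a::idom set \<Rightarrow> 'a fract set" where
  "subring_fractions S = {of_dom a / of_dom b |a b. a \<in> S \<and> b \<in> S \<and> b \<noteq> 0}"

text \<open>The ring \<open>'a\<close> as a module over its subring \<open>S\<close>.\<close>

definition noetherian_over_subring :: "'a::comm_ring_1 set \<Rightarrow> bool" where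
  "noetherian_over_subring S \<longleftrightarrow>
     acc (\<lambda>N :: 'a set. 0 \<in> N \<and> (\<forall>x\<in>N. \<forall>y\<in>N. x + y \<in> N) \<and> (\<forall>s\<in>S. \<forall>x\<in>N. s * x \<in> N))"

text \<open>
  The extension of an automorphism of the domain to its field of fractions; the lemma below
  shows that the choice of numerator and denominator does not matter.
\<close>

definition frac_ext :: "('a::idom \<Rightarrow> 'a) \<Rightarrow> 'a fract \<Rightarrow> 'a fract" where
  "frac_ext f q =
     (let (a, b) = (SOME (a, b). b \<noteq> 0 \<and> q = Fraction_Field.Fract a b)
      in Fraction_Field.Fract (f a) (f b))"

lemma ring_aut_zero: "f 0 = 0" if "f \<in> carrier ring_aut_group"
proof -
  have "f (0 + 0) = f 0 + f 0"
    using that by (simp add: ring_aut_group_def del: add_0_left add_0_right)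
  then show ?thesis by (metis add_cancel_right_right)
qed

lemma ring_aut_eq_zero_iff: "f a = 0 \<longleftrightarrow> a = 0" if "f \<in> carrier ring_aut_group"
proof -
  have "inj f" using that by (auto simp: ring_aut_group_def bij_def)
  then show ?thesis using ring_aut_zero[OF that] by (metis injD)
qed

lemma frac_ext_Fract:
  fixes f :: "'a::idom \<Rightarrow> 'a"
  assumes f: "f \<in> carrier ring_aut_group" and "b \<noteq> 0"
  shows "frac_ext f (Fraction_Field.Fract a b) = Fraction_Field.Fract (f a) (f b)"
proof -
  define P where
    "P = (\<lambda>(c, d). d \<noteq> 0 \<and> Fraction_Field.Fract a b = Fraction_Field.Fract c d)"
  obtain c d where cd: "(SOME z. P z) = (c, d)" by fastforce
  have "P (a, b)" using assms by (simp add: P_def)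
  then have "P (c, d)" using cd by (metis someI)
  then have d: "d \<noteq> 0" and eq: "a * d = c * b"
    using assms by (auto simp: P_def eq_fract)
  have "f a * f d = f c * f b"
    using f arg_cong[OF eq, of f] unfolding ring_aut_group_def by simp
  moreover have "f b \<noteq> 0" "f d \<noteq> 0"
    using assms d by (auto simp: ring_aut_eq_zero_iff)
  moreover have "frac_ext f (Fraction_Field.Fract a b) = Fraction_Field.Fract (f c) (f d)"
    using cd by (simp add: frac_ext_def P_def)
  ultimately show ?thesis by (simp add: eq_fract)
qed


section \<open>The skew monoid ring and its fixed ring\<close>

text \<open>
  The formal sum \<open>\<Sum>\<^sub>\<mu> a\<^sub>\<mu> \<mu>\<close> is the finitely supported function \<open>\<mu> \<mapsto> a\<^sub>\<mu>\<close>, vanishing outside \<open>M\<close>.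
\<close>

type_synonym 'a skew = "('a \<Rightarrow> 'a) \<Rightarrow> 'a fract"

definition monomial :: "'a::idom fract \<Rightarrow> ('a \<Rightarrow> 'a) \<Rightarrow> 'a skew" where
  "monomial a \<mu> = (\<lambda>\<nu>. if \<nu> = \<mu> then a else 0)"

definition skew_monoid_ring :: "('a::idom \<Rightarrow> 'a) set \<Rightarrow> 'a skew ring" where
  "skew_monoid_ring M =
     \<lparr>carrier = {f. finite {\<mu>. f \<mu> \<noteq> 0} \<and> {\<mu>. f \<mu> \<noteq> 0} \<subseteq> M},
      mult = (\<lambda>f h \<rho>. \<Sum>\<mu> | f \<mu> \<noteq> 0. \<Sum>\<nu> | h \<nu> \<noteq> 0.
                 if \<mu> \<circ> \<nu> = \<rho> then f \<mu> * frac_ext \<mu> (h \<nu>) else 0),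
      one = monomial 1 id,
      zero = (\<lambda>_. 0),
      add = (\<lambda>f h \<mu>. f \<mu> + h \<mu>)\<rparr>"

text \<open>
  The action \<open>a \<mu> \<mapsto> g(a) (g \<mu> g\<^sup>-\<^sup>1)\<close>: the coefficient of the image at \<open>\<nu>\<close> comes from the coefficient
  at \<open>g\<^sup>-\<^sup>1 \<nu> g\<close>.
\<close>

definition skew_act :: "('a::idom \<Rightarrow> 'a) \<Rightarrow> 'a skew \<Rightarrow> 'a skew" where
  "skew_act g f = (\<lambda>\<nu>. frac_ext g (f (inv_into UNIV g \<circ> \<nu> \<circ> g)))"

lemma frac_ext_zero: "frac_ext f 0 = 0" if "f \<in> carrier ring_aut_group"
  using frac_ext_Fract[OF that, of 1 0] that
  by (simp add: Zero_fract_def [symmetric] ring_aut_zero fract_collapse)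

lemma monomial_mult:
  assumes "\<mu> \<in> carrier ring_aut_group"
  shows "monomial a \<mu> \<otimes>\<^bsub>skew_monoid_ring M\<^esub> monomial b \<nu> = monomial (a * frac_ext \<mu> b) (\<mu> \<circ> \<nu>)"
proof (cases "a = 0 \<or> b = 0")
  case True
  then show ?thesis
    using assms
    by (auto simp: skew_monoid_ring_def monomial_def frac_ext_zero intro!: ext sum.neutral)
next
  case False
  then have "{\<kappa>. monomial a \<mu> \<kappa> \<noteq> 0} = {\<mu>}" "{\<kappa>. monomial b \<nu> \<kappa> \<noteq> 0} = {\<nu>}"
    by (auto simp: monomial_def)
  then have "(monomial a \<mu> \<otimes>\<^bsub>skew_monoid_ring M\<^esub> monomial b \<nu>) \<rho> =
      (if \<mu> \<circ> \<nu> = \<rho> then monomial a \<mu> \<mu> * frac_ext \<mu> (monomial b \<nu> \<nu>) else 0)" for \<rho>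
    by (simp add: skew_monoid_ring_def)
  then show ?thesis
    by (simp add: monomial_def fun_eq_iff)
qed

lemma skew_act_monomial:
  assumes "g \<in> carrier ring_aut_group"
  shows "skew_act g (monomial a \<mu>) = monomial (frac_ext g a) (g \<circ> \<mu> \<circ> inv_into UNIV g)"
proof -
  have bij: "bij g" using assms by (simp add: ring_aut_group_def)
  then have "inv_into UNIV g \<circ> \<nu> \<circ> g = \<mu> \<longleftrightarrow> \<nu> = g \<circ> \<mu> \<circ> inv_into UNIV g" for \<nu>
    by (auto simp: fun_eq_iff bij_is_inj bij_is_surj surj_f_inv_f inv_f_f)
      (metis bij_inv_eq_iff)+
  then show ?thesis
    using assms by (auto simp: skew_act_def monomial_def frac_ext_zero)
qed

definition skew_fixed_ring :: "('a::idom \<Rightarrow> 'a) set \<Rightarrow> ('a \<Rightarrow> 'a) set \<Rightarrow> 'a skew ring" where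
  "skew_fixed_ring G M =
     (skew_monoid_ring M)\<lparr>carrier := {f \<in> carrier (skew_monoid_ring M). \<forall>g\<in>G. skew_act g f = f}\<rparr>"


section \<open>Galois rings\<close>

definition galois_setting :: "('a::idom \<Rightarrow> 'a) set \<Rightarrow> ('a \<Rightarrow> 'a) set \<Rightarrow> bool" where
  "galois_setting G M \<longleftrightarrow>
     integrally_closed TYPE('a) \<and>
     subgroup G ring_aut_group \<and> finite G \<and>
     submonoid M ring_aut_group \<and>
     (M <#>\<^bsub>ring_aut_group\<^esub> set_inv\<^bsub>ring_aut_group\<^esub> M) \<inter> G = {\<one>\<^bsub>ring_aut_group\<^esub>} \<and>
     (\<forall>g\<in>G. \<forall>\<mu>\<in>M. g \<otimes>\<^bsub>ring_aut_group\<^esub> \<mu> \<otimes>\<^bsub>ring_aut_group\<^esub> inv\<^bsub>ring_aut_group\<^esub> g \<in> M) \<and>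
     noetherian_over_subring (fixed_points G) \<and>
     (\<exists>S. finite S \<and> S \<subseteq> M \<and> M = \<Inter>{N. submonoid N ring_aut_group \<and> S \<subseteq> N})"

text \<open>
  \<open>\<Gamma> = \<Lambda>\<^sup>G\<close> and \<open>K = Frac \<Gamma>\<close> sit inside \<open>L * M\<close> as multiples of the identity of \<open>M\<close>.  The products
  \<open>KU\<close> and \<open>UK\<close> consist of all finite sums of products, which is what the library's \<^const>\<open>ideal_prod\<close>
  forms for arbitrary sets.
\<close>

definition galois_ring ::
    "('a::idom \<Rightarrow> 'a) set \<Rightarrow> ('a \<Rightarrow> 'a) set \<Rightarrow> 'a skew set \<Rightarrow> bool" where
  "galois_ring G M U \<longleftrightarrow>
     (let R = skew_fixed_ring G M;
          \<Gamma> = (\<lambda>a. monomial (of_dom a) id) ` fixed_points G;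
          K = (\<lambda>a. monomial a id) ` subring_fractions (fixed_points G)
      in subring U R \<and> \<Gamma> \<subseteq> U \<and>
         (\<exists>S. finite S \<and> S \<subseteq> U \<and> U = generate_ring R (\<Gamma> \<union> S)) \<and>
         K \<cdot>\<^bsub>R\<^esub> U = carrier R \<and> U \<cdot>\<^bsub>R\<^esub> K = carrier R)"

end

theory Submission
  imports Defs
begin

text \<open>
  Everything happens inside the skew group ring \<open>L * Aut(\<Lambda>)\<close>. For a group \<open>H\<close> of automorphisms, \<open>H\<close> acts
  faithfully on the field \<open>L\<close>, so \<open>L * H\<close> is simple. This applies to \<open>M\<close>, and also to the semidirect product
  \<open>MG\<close>, because \<open>M \<inter> G = {e}\<close>. Put \<open>t = \<Sum>\<^sub>g g\<close> in \<open>L * MG\<close>. Then \<open>t y t = tr(y) t\<close> for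
  \<open>y \<in> L * M\<close>, and \<open>tr(c) = 1\<close> for some \<open>c \<in> L\<close> whatever the characteristic, so \<open>t c\<close> is an idempotent whose
  corner in \<open>L * MG\<close> is the fixed ring \<open>\<K>\<close>. Hence \<open>\<K>\<close> is simple.

  If \<open>M\<close> is polycyclic-by-finite, then \<open>L * M\<close> is Noetherian by Hilbert's basis argument along the series of
  \<open>M\<close>, and \<open>\<K>\<close> inherits this through the \<open>\<K>\<close>-bilinear retraction \<open>y \<mapsto> tr(c y)\<close>. Every element of \<open>\<K>\<close> is
  \<open>u s\<^sup>-\<^sup>1\<close> with \<open>u \<in> U\<close> and \<open>0 \<noteq> s \<in> \<Gamma>\<close>. Extending right ideals of \<open>U\<close> to \<open>\<K>\<close> transfers the chain
  conditions, and the extension of a nonzero ideal of \<open>U\<close> is all of \<open>\<K>\<close>.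
\<close>

section \<open>The skew group ring of all automorphisms\<close>

text \<open>The elements of \<open>MG\<close> are honest maps of \<open>\<Lambda>\<close>, so
  distinct ones act differently on \<open>L\<close>; this is all that the simplicity of
  \<open>L * MG\<close> asks for. Inside \<open>L * MG\<close> the action of \<open>G\<close> is
  conjugation by units, so invariants become commutants and averaging over \<open>G\<close> becomes
  multiplication by \<open>t\<close>. The element \<open>t c\<close> is idempotent because
  \<open>t c t = tr(c) t = t\<close>; it plays the part of the usual averaging idempotent. Trivial
  intersection of \<open>M\<close> and \<open>G\<close> enters through the injectivity of
  \<open>y \<mapsto> y t\<close> on \<open>L * M\<close>: it lets identities multiplied by
  \<open>t\<close> be read back in the fixed ring.

  The obstacle in passing from \<open>\<K>\<close> to \<open>U\<close> is that
  \<open>\<Gamma>\<close> need not be central, because \<open>M\<close> moves it. Denominators are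
  therefore cleared on one side only. A right ideal of \<open>U\<close> extends to a right ideal of
  \<open>\<K>\<close> with common denominators alone, but for a two-sided ideal the closure of the
  extension under left multiplication has to be bought with the ascending chain condition on right
  ideals of \<open>\<K>\<close>.\<close>

abbreviation Aut :: "('a::comm_ring_1 \<Rightarrow> 'a) set" where
  "Aut \<equiv> carrier ring_aut_group"

abbreviation ainv :: "('a \<Rightarrow> 'a) \<Rightarrow> 'a \<Rightarrow> 'a" where
  "ainv \<equiv> inv_into UNIV"

section \<open>Automorphisms of the domain under composition\<close>

lemma Aut_bij: "\<mu> \<in> Aut \<Longrightarrow> bij \<mu>"
  by (simp add: ring_aut_group_def)

lemma Aut_one: "\<mu> \<in> Aut \<Longrightarrow> \<mu> 1 = 1"
  and Aut_add: "\<mu> \<in> Aut \<Longrightarrow> \<mu> (a + b) = \<mu> a + \<mu> b"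
  and Aut_mult: "\<mu> \<in> Aut \<Longrightarrow> \<mu> (a * b) = \<mu> a * \<mu> b"
  by (simp_all add: ring_aut_group_def)

lemma Aut_id [simp]: "id \<in> Aut"
  by (simp add: ring_aut_group_def)

lemma Aut_comp [simp]: "\<mu> \<in> Aut \<Longrightarrow> \<nu> \<in> Aut \<Longrightarrow> \<mu> \<circ> \<nu> \<in> Aut"
  by (simp add: ring_aut_group_def bij_comp)

lemma Aut_inv [simp]:
  assumes "\<mu> \<in> Aut" shows "ainv \<mu> \<in> Aut"
proof -
  note b = Aut_bij[OF assms] and m = Aut_one[OF assms] Aut_add[OF assms] Aut_mult[OF assms]
  have r: "\<mu> (ainv \<mu> x) = x" and l: "ainv \<mu> (\<mu> x) = x" for x
    using b by (simp_all add: bij_is_surj surj_f_inv_f bij_is_inj)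
  have "ainv \<mu> 1 = 1" "ainv \<mu> (a + b) = ainv \<mu> a + ainv \<mu> b" "ainv \<mu> (a * b) = ainv \<mu> a * ainv \<mu> b" for a b
    using l[of 1] l[of "ainv \<mu> a + ainv \<mu> b"] l[of "ainv \<mu> a * ainv \<mu> b"] by (simp_all add: m r)
  with b show ?thesis by (simp add: ring_aut_group_def bij_imp_bij_inv)
qed

lemma Aut_comp_inv [simp]: "\<mu> \<in> Aut \<Longrightarrow> \<mu> \<circ> ainv \<mu> = id"
  and Aut_inv_comp [simp]: "\<mu> \<in> Aut \<Longrightarrow> ainv \<mu> \<circ> \<mu> = id"
  by (auto dest!: Aut_bij simp: fun_eq_iff bij_is_surj surj_f_inv_f bij_is_inj)

lemma Aut_inv_inv [simp]: "\<mu> \<in> Aut \<Longrightarrow> ainv (ainv \<mu>) = \<mu>"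
  by (simp add: Aut_bij inv_inv_eq)

lemma Aut_inv_comp_distrib: "\<mu> \<in> Aut \<Longrightarrow> \<nu> \<in> Aut \<Longrightarrow> ainv (\<mu> \<circ> \<nu>) = ainv \<nu> \<circ> ainv \<mu>"
  by (simp add: Aut_bij o_inv_distrib)

lemma group_ring_aut_group: "group ring_aut_group"
proof (rule groupI)
  show "\<exists>y\<in>Aut. y \<otimes>\<^bsub>ring_aut_group\<^esub> x = \<one>\<^bsub>ring_aut_group\<^esub>" if "x \<in> Aut" for x :: "'a \<Rightarrow> 'a"
    using Aut_inv_comp[OF that] Aut_inv[OF that] by (auto simp: ring_aut_group_def intro!: bexI[of _ "ainv x"])
qed (use Aut_comp Aut_id in \<open>auto simp: ring_aut_group_def comp_assoc\<close>)

lemma ring_aut_group_simps [simp]: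
  "\<mu> \<otimes>\<^bsub>ring_aut_group\<^esub> \<nu> = \<mu> \<circ> \<nu>" "\<one>\<^bsub>ring_aut_group\<^esub> = id"
  by (simp_all add: ring_aut_group_def)

lemma inv_ring_aut_group [simp]:
  "\<mu> \<in> Aut \<Longrightarrow> inv\<^bsub>ring_aut_group\<^esub> \<mu> = ainv \<mu>"
  using group.inv_equality[OF group_ring_aut_group, of "ainv \<mu>" \<mu>] by simp

lemma subgroup_Aut_iff:
  "subgroup N ring_aut_group \<longleftrightarrow>
     N \<subseteq> Aut \<and> id \<in> N \<and> (\<forall>\<mu>\<in>N. \<forall>\<nu>\<in>N. \<mu> \<circ> \<nu> \<in> N) \<and> (\<forall>\<mu>\<in>N. ainv \<mu> \<in> N)"
  by (auto simp: subgroup_def) (metis inv_ring_aut_group subsetD)+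

lemma
  assumes "subgroup N ring_aut_group"
  shows subgroup_Aut: "\<mu> \<in> N \<Longrightarrow> \<mu> \<in> Aut" and subgroup_id: "id \<in> N"
    and subgroup_comp: "\<mu> \<in> N \<Longrightarrow> \<nu> \<in> N \<Longrightarrow> \<mu> \<circ> \<nu> \<in> N"
    and subgroup_inv: "\<mu> \<in> N \<Longrightarrow> ainv \<mu> \<in> N"
  using assms unfolding subgroup_Aut_iff by blast+

section \<open>The action on the field of fractions\<close>

lemma frac_ext_add:
  assumes "f \<in> Aut" shows "frac_ext f (x + y) = frac_ext f x + frac_ext f y"
proof -
  obtain a b c d where "x = Fraction_Field.Fract a b" "b \<noteq> 0" "y = Fraction_Field.Fract c d" "d \<noteq> 0"
    by (metis Fract_cases)
  then show ?thesis using assms by (simp add: frac_ext_Fract Aut_add Aut_mult ring_aut_eq_zero_iff)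
qed

lemma frac_ext_mult:
  assumes "f \<in> Aut" shows "frac_ext f (x * y) = frac_ext f x * frac_ext f y"
proof -
  obtain a b c d where "x = Fraction_Field.Fract a b" "b \<noteq> 0" "y = Fraction_Field.Fract c d" "d \<noteq> 0"
    by (metis Fract_cases)
  then show ?thesis using assms by (simp add: frac_ext_Fract Aut_add Aut_mult ring_aut_eq_zero_iff)
qed

lemma frac_ext_of_dom: "f \<in> Aut \<Longrightarrow> frac_ext f (of_dom a) = of_dom (f a)"
  by (subst frac_ext_Fract) (auto simp: ring_aut_group_def)

lemma frac_ext_one: "f \<in> Aut \<Longrightarrow> frac_ext f 1 = 1"
  using frac_ext_of_dom[of f 1] by (simp add: One_fract_def [symmetric] ring_aut_group_def)

lemma frac_ext_id [simp]: "frac_ext id x = x"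
  by (cases x rule: Fract_cases) (simp add: frac_ext_Fract)

lemma frac_ext_comp:
  assumes "f \<in> Aut" "g \<in> Aut" shows "frac_ext (f \<circ> g) x = frac_ext f (frac_ext g x)"
  by (cases x rule: Fract_cases) (use assms Aut_comp[OF assms] in \<open>simp add: frac_ext_Fract ring_aut_eq_zero_iff\<close>)

text \<open>The action on \<open>L\<close> is faithful because \<open>\<Lambda>\<close> embeds in
  \<open>L\<close>. The simplicity of the skew group rings rests on this.\<close>

lemma frac_ext_eq_id:
  assumes "f \<in> Aut" "\<And>x. frac_ext f x = x" shows "f = id"
proof
  fix a show "f a = id a"
    using assms(2)[of "of_dom a"] assms(1) by (simp add: frac_ext_of_dom eq_fract)
qed

text \<open>The rings \<open>L * N\<close> are subsets of this one type, so they share a type-class multiplication.\<close>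

typedef (overloaded) 'a sgr = "carrier (skew_monoid_ring Aut) :: 'a::idom skew set"
  morphisms cf Abs_sgr
  by (rule exI[of _ "\<lambda>_. 0"]) (simp add: skew_monoid_ring_def)

lemma finite_supp [simp]: "finite {\<mu>. cf x \<mu> \<noteq> 0}"
  and supp_Aut: "cf x \<mu> \<noteq> 0 \<Longrightarrow> \<mu> \<in> Aut"
  using cf[of x] by (auto simp: skew_monoid_ring_def)

lemma cf_eqI: "(\<And>\<mu>. cf x \<mu> = cf y \<mu>) \<Longrightarrow> x = y"
  by (metis cf_inject ext)

text \<open>The product is defined by sums over the exact supports, which vary with the factors.
  Over common finite supersets the sums for two elements and for their sum become comparable, which
  yields distributivity. The left indices must be automorphisms, since \<open>frac_ext\<close> is
  known to send 0 to 0 only for those.\<close>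

lemma skew_mult_conv:
  fixes f h :: "'a::idom skew"
  assumes "{\<mu>. f \<mu> \<noteq> 0} \<subseteq> A" "{\<mu>. h \<mu> \<noteq> 0} \<subseteq> B" "finite A" "finite B" "A \<subseteq> Aut"
  shows "(f \<otimes>\<^bsub>skew_monoid_ring M\<^esub> h) \<rho> =
    (\<Sum>\<mu>\<in>A. \<Sum>\<nu>\<in>B. if \<mu> \<circ> \<nu> = \<rho> then f \<mu> * frac_ext \<mu> (h \<nu>) else 0)"
proof -
  have "(\<Sum>\<nu> | h \<nu> \<noteq> 0. if \<mu> \<circ> \<nu> = \<rho> then f \<mu> * frac_ext \<mu> (h \<nu>) else 0) =
      (\<Sum>\<nu>\<in>B. if \<mu> \<circ> \<nu> = \<rho> then f \<mu> * frac_ext \<mu> (h \<nu>) else 0)" if "\<mu> \<in> Aut" for \<mu>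
    using assms that by (intro sum.mono_neutral_left) (auto simp: frac_ext_zero)
  then have "(f \<otimes>\<^bsub>skew_monoid_ring M\<^esub> h) \<rho> =
      (\<Sum>\<mu> | f \<mu> \<noteq> 0. \<Sum>\<nu>\<in>B. if \<mu> \<circ> \<nu> = \<rho> then f \<mu> * frac_ext \<mu> (h \<nu>) else 0)"
    using assms by (simp add: skew_monoid_ring_def subset_eq)
  also have "\<dots> = (\<Sum>\<mu>\<in>A. \<Sum>\<nu>\<in>B. if \<mu> \<circ> \<nu> = \<rho> then f \<mu> * frac_ext \<mu> (h \<nu>) else 0)"
    using assms by (intro sum.mono_neutral_left) (auto cong: if_cong)
  finally show ?thesis .
qed

lemma skew_mult_supp:
  fixes f h :: "'a::idom skew"
  shows "{\<rho>. (f \<otimes>\<^bsub>skew_monoid_ring M\<^esub> h) \<rho> \<noteq> 0} \<subseteq> (\<lambda>(\<mu>, \<nu>). \<mu> \<circ> \<nu>) ` ({\<mu>. f \<mu> \<noteq> 0} \<times> {\<mu>. h \<mu> \<noteq> 0})"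
proof
  fix \<rho> assume \<rho>: "\<rho> \<in> {\<rho>. (f \<otimes>\<^bsub>skew_monoid_ring M\<^esub> h) \<rho> \<noteq> 0}"
  show "\<rho> \<in> (\<lambda>(\<mu>, \<nu>). \<mu> \<circ> \<nu>) ` ({\<mu>. f \<mu> \<noteq> 0} \<times> {\<mu>. h \<mu> \<noteq> 0})"
  proof (rule ccontr)
    assume "\<not> ?thesis"
    then have ne: "\<mu> \<circ> \<nu> \<noteq> \<rho>" if "f \<mu> \<noteq> 0" "h \<nu> \<noteq> 0" for \<mu> \<nu>
      using that by force
    have "(f \<otimes>\<^bsub>skew_monoid_ring M\<^esub> h) \<rho> = 0"
      by (simp add: skew_monoid_ring_def) (intro sum.neutral ballI, auto simp: ne)
    with \<rho> show False by simp
  qed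
qed

definition mon :: "'a::idom fract \<Rightarrow> ('a \<Rightarrow> 'a) \<Rightarrow> 'a sgr" where
  "mon a \<mu> = Abs_sgr (monomial a \<mu>)"

lemma monomial_app: "monomial a \<mu> \<nu> = (if \<nu> = \<mu> then a else 0)"
  by (simp add: monomial_def)

lemma cf_mon: "\<mu> \<in> Aut \<Longrightarrow> cf (mon a \<mu>) = monomial a \<mu>"
proof -
  assume "\<mu> \<in> Aut"
  moreover have "finite {\<nu>. monomial a \<mu> \<nu> \<noteq> 0}"
    by (rule finite_subset[of _ "{\<mu>}"]) (auto simp: monomial_def)
  ultimately show ?thesis
    unfolding mon_def by (intro Abs_sgr_inverse) (auto simp: skew_monoid_ring_def monomial_def split: if_splits)
qed

instantiation sgr :: (idom) ab_group_add
begin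

definition zero_sgr :: "'a sgr" where "0 = Abs_sgr (\<lambda>_. 0)"
definition plus_sgr :: "'a sgr \<Rightarrow> 'a sgr \<Rightarrow> 'a sgr" where "x + y = Abs_sgr (\<lambda>\<mu>. cf x \<mu> + cf y \<mu>)"
definition uminus_sgr :: "'a sgr \<Rightarrow> 'a sgr" where "- x = Abs_sgr (\<lambda>\<mu>. - cf x \<mu>)"
definition minus_sgr :: "'a sgr \<Rightarrow> 'a sgr \<Rightarrow> 'a sgr" where "x - y = x + - (y :: 'a sgr)"

lemma cf_zero: "cf 0 = (\<lambda>_. 0)"
  unfolding zero_sgr_def by (intro Abs_sgr_inverse) (simp add: skew_monoid_ring_def)

lemma cf_plus: "cf (x + y) = (\<lambda>\<mu>. cf x \<mu> + cf y \<mu>)"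
proof -
  have s: "{\<mu>. cf x \<mu> + cf y \<mu> \<noteq> 0} \<subseteq> {\<mu>. cf x \<mu> \<noteq> 0} \<union> {\<mu>. cf y \<mu> \<noteq> 0}" by auto
  then have "finite {\<mu>. cf x \<mu> + cf y \<mu> \<noteq> 0}" by (rule finite_subset) simp
  moreover have "{\<mu>. cf x \<mu> + cf y \<mu> \<noteq> 0} \<subseteq> Aut"
    using s by (auto dest: supp_Aut)
  ultimately show ?thesis
    unfolding plus_sgr_def by (intro Abs_sgr_inverse) (simp add: skew_monoid_ring_def)
qed

lemma cf_uminus: "cf (- x) = (\<lambda>\<mu>. - cf x \<mu>)"
  unfolding uminus_sgr_def by (intro Abs_sgr_inverse) (auto simp: skew_monoid_ring_def dest: supp_Aut)

instance
proof
  fix x y z :: "'a sgr"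
  show "x + y + z = x + (y + z)" by (rule cf_eqI) (simp add: cf_plus)
  show "x + y = y + x" by (rule cf_eqI) (simp add: cf_plus)
  show "0 + x = x" by (rule cf_eqI) (simp add: cf_plus cf_zero)
  show "- x + x = 0" by (rule cf_eqI) (simp add: cf_plus cf_zero cf_uminus)
  show "x - y = x + - y" by (rule minus_sgr_def)
qed

end

lemma cf_minus: "cf (x - y) = (\<lambda>\<mu>. cf x \<mu> - cf y \<mu>)"
  using cf_plus[of x "- y"] by (simp add: cf_uminus)

lemma cf_sum: "cf (sum f F) \<mu> = (\<Sum>i\<in>F. cf (f i) \<mu>)"
  by (induction F rule: infinite_finite_induct) (auto simp: cf_zero cf_plus)

definition supported :: "('a::idom \<Rightarrow> 'a) set \<Rightarrow> 'a sgr set" where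
  "supported N = {x. \<forall>\<mu>. cf x \<mu> \<noteq> 0 \<longrightarrow> \<mu> \<in> N}"

lemma supported_zero [simp]: "0 \<in> supported N"
  and supported_add: "x \<in> supported N \<Longrightarrow> y \<in> supported N \<Longrightarrow> x + y \<in> supported N"
  and supported_uminus: "x \<in> supported N \<Longrightarrow> - x \<in> supported N"
  and supported_mon: "\<mu> \<in> N \<Longrightarrow> \<mu> \<in> Aut \<Longrightarrow> mon a \<mu> \<in> supported N"
  by (auto simp: supported_def cf_zero cf_plus cf_uminus cf_minus cf_mon monomial_def)
    (metis add.right_neutral)

lemma supported_Aut [simp]: "x \<in> supported Aut"
  by (auto simp: supported_def dest: supp_Aut)

lemma sgr_decomp: "x = (\<Sum>\<mu> | cf x \<mu> \<noteq> 0. mon (cf x \<mu>) \<mu>)"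
proof (rule cf_eqI)
  fix \<nu>
  have "cf (\<Sum>\<mu> | cf x \<mu> \<noteq> 0. mon (cf x \<mu>) \<mu>) \<nu> = (\<Sum>\<mu> | cf x \<mu> \<noteq> 0. if \<nu> = \<mu> then cf x \<mu> else 0)"
    unfolding cf_sum by (intro sum.cong) (auto simp: cf_mon supp_Aut monomial_def)
  also have "\<dots> = cf x \<nu>" by simp
  finally show "cf x \<nu> = cf (\<Sum>\<mu> | cf x \<mu> \<noteq> 0. mon (cf x \<mu>) \<mu>) \<nu>" by simp
qed

lemma supported_induct [consumes 1, case_names zero add mon]:
  assumes x: "x \<in> supported N" and "P 0"
    and add: "\<And>x y. x \<in> supported N \<Longrightarrow> y \<in> supported N \<Longrightarrow> P x \<Longrightarrow> P y \<Longrightarrow> P (x + y)"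
    and m: "\<And>a \<mu>. \<mu> \<in> N \<Longrightarrow> \<mu> \<in> Aut \<Longrightarrow> P (mon a \<mu>)"
  shows "P x"
proof -
  have "sum (\<lambda>\<mu>. mon (cf x \<mu>) \<mu>) F \<in> supported N \<and> P (sum (\<lambda>\<mu>. mon (cf x \<mu>) \<mu>) F)"
    if "F \<subseteq> {\<mu>. cf x \<mu> \<noteq> 0}" for F
    using finite_subset[OF that finite_supp] that
  proof (induction F rule: finite_induct)
    case (insert \<mu> F)
    then have "\<mu> \<in> N" "\<mu> \<in> Aut" using x by (auto simp: supported_def dest: supp_Aut)
    with insert m add supported_mon[of \<mu> N] show ?case
      by (simp add: supported_add)
  qed (use assms in simp)
  from this[OF order_refl] show ?thesis using sgr_decomp[of x] by simp
qed

lemmas sgr_induct = supported_induct[OF supported_Aut, case_names zero add mon]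

instantiation sgr :: (idom) ring_1
begin

definition one_sgr :: "'a sgr" where "1 = mon 1 id"
definition times_sgr :: "'a sgr \<Rightarrow> 'a sgr \<Rightarrow> 'a sgr" where
  "x * y = Abs_sgr (cf x \<otimes>\<^bsub>skew_monoid_ring Aut\<^esub> cf y)"

text \<open>The multiplication of the record does not depend on \<open>M\<close>, which only cuts
  out the carrier. Leaving \<open>M\<close> free lets one type-class product serve every
  \<open>skew_monoid_ring M\<close>.\<close>

lemma cf_times: "cf (x * y) = cf x \<otimes>\<^bsub>skew_monoid_ring M\<^esub> cf y"
proof -
  have *: "cf x \<otimes>\<^bsub>skew_monoid_ring M\<^esub> cf y = cf x \<otimes>\<^bsub>skew_monoid_ring Aut\<^esub> cf y"
    by (simp add: skew_monoid_ring_def)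
  have "finite {\<rho>. (cf x \<otimes>\<^bsub>skew_monoid_ring Aut\<^esub> cf y) \<rho> \<noteq> 0}"
    by (rule finite_subset[OF skew_mult_supp]) auto
  moreover have "{\<rho>. (cf x \<otimes>\<^bsub>skew_monoid_ring Aut\<^esub> cf y) \<rho> \<noteq> 0} \<subseteq> Aut"
  proof (rule order_trans[OF skew_mult_supp])
    show "(\<lambda>(\<mu>, \<nu>). \<mu> \<circ> \<nu>) ` ({\<mu>. cf x \<mu> \<noteq> 0} \<times> {\<mu>. cf y \<mu> \<noteq> 0}) \<subseteq> Aut"
      using supp_Aut Aut_comp by fast
  qed
  ultimately show ?thesis unfolding * times_sgr_def
    by (intro Abs_sgr_inverse) (simp add: skew_monoid_ring_def)
qed

lemma cf_times_conv:
  assumes "{\<mu>. cf x \<mu> \<noteq> 0} \<subseteq> A" "{\<mu>. cf y \<mu> \<noteq> 0} \<subseteq> B" "finite A" "finite B" "A \<subseteq> Aut"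
  shows "cf (x * y) \<rho> = (\<Sum>\<mu>\<in>A. \<Sum>\<nu>\<in>B. if \<mu> \<circ> \<nu> = \<rho> then cf x \<mu> * frac_ext \<mu> (cf y \<nu>) else 0)"
  using skew_mult_conv[OF assms] cf_times[of x y] by simp

lemma mon_mult:
  "\<mu> \<in> Aut \<Longrightarrow> \<nu> \<in> Aut \<Longrightarrow> mon a \<mu> * mon b \<nu> = mon (a * frac_ext \<mu> b) (\<mu> \<circ> \<nu>)"
  by (intro cf_eqI) (simp add: cf_times[where M = Aut] cf_mon monomial_mult)

lemma sgr_distrib_right:
  fixes x y z :: "'a sgr" shows "(x + y) * z = x * z + y * z"
proof (rule cf_eqI)
  fix \<rho>
  let ?A = "{\<mu>. cf x \<mu> \<noteq> 0} \<union> {\<mu>. cf y \<mu> \<noteq> 0}" and ?B = "{\<mu>. cf z \<mu> \<noteq> 0}"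
  have c: "cf (w * z) \<rho> = (\<Sum>\<mu>\<in>?A. \<Sum>\<nu>\<in>?B. if \<mu> \<circ> \<nu> = \<rho> then cf w \<mu> * frac_ext \<mu> (cf z \<nu>) else 0)"
    if "{\<mu>. cf w \<mu> \<noteq> 0} \<subseteq> ?A" for w
    using that by (intro cf_times_conv) (auto dest: supp_Aut)
  have s: "{\<mu>. cf (x + y) \<mu> \<noteq> 0} \<subseteq> ?A" by (auto simp: cf_plus)
  show "cf ((x + y) * z) \<rho> = cf (x * z + y * z) \<rho>"
    unfolding cf_plus[of "x * z"] c[OF s] c[OF Un_upper1] c[OF Un_upper2] sum.distrib [symmetric]
    by (intro sum.cong refl) (simp add: cf_plus distrib_right)
qed

lemma sgr_distrib_left:
  fixes x y z :: "'a sgr" shows "x * (y + z) = x * y + x * z"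
proof (rule cf_eqI)
  fix \<rho>
  let ?A = "{\<mu>. cf x \<mu> \<noteq> 0}" and ?B = "{\<mu>. cf y \<mu> \<noteq> 0} \<union> {\<mu>. cf z \<mu> \<noteq> 0}"
  have c: "cf (x * w) \<rho> = (\<Sum>\<mu>\<in>?A. \<Sum>\<nu>\<in>?B. if \<mu> \<circ> \<nu> = \<rho> then cf x \<mu> * frac_ext \<mu> (cf w \<nu>) else 0)"
    if "{\<mu>. cf w \<mu> \<noteq> 0} \<subseteq> ?B" for w
    using that by (intro cf_times_conv) (auto dest: supp_Aut)
  have s: "{\<mu>. cf (y + z) \<mu> \<noteq> 0} \<subseteq> ?B" by (auto simp: cf_plus)
  show "cf (x * (y + z)) \<rho> = cf (x * y + x * z) \<rho>"
    unfolding cf_plus[of "x * y"] c[OF s] c[OF Un_upper1] c[OF Un_upper2] sum.distrib [symmetric]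
    by (intro sum.cong refl) (auto simp: cf_plus distrib_left frac_ext_add supp_Aut)
qed

lemma sgr_mult_zero: "0 * x = 0" "x * 0 = 0" for x :: "'a sgr"
  using sgr_distrib_right[of 0 0 x] sgr_distrib_left[of x 0 0] by simp_all

text \<open>Both sides are additive in each argument. On monomials the claim is that \<open>frac_ext
  \<mu> (b * frac_ext \<nu> c) = frac_ext \<mu> b * frac_ext (\<mu> \<circ> \<nu>)
  c\<close>.\<close>

lemma sgr_mult_assoc:
  fixes x y z :: "'a sgr" shows "x * y * z = x * (y * z)"
proof (induction x rule: sgr_induct)
  case (mon a \<mu>)
  note x = this
  show ?case
  proof (induction y rule: sgr_induct)
    case (mon b \<nu>)
    note y = this
    show ?case
    proof (induction z rule: sgr_induct)
      case (mon c \<rho>)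
      with x y show ?case
        by (simp add: mon_mult frac_ext_mult frac_ext_comp mult.assoc comp_assoc)
    qed (simp_all add: sgr_mult_zero sgr_distrib_left)
  qed (simp_all add: sgr_mult_zero sgr_distrib_left sgr_distrib_right)
qed (simp_all add: sgr_mult_zero sgr_distrib_right)

lemma sgr_mult_one: "1 * x = x" "x * 1 = x" for x :: "'a sgr"
proof -
  show "1 * x = x"
    by (induction x rule: sgr_induct) (simp_all add: sgr_distrib_left sgr_mult_zero one_sgr_def mon_mult)
  show "x * 1 = x"
    by (induction x rule: sgr_induct)
      (simp_all add: sgr_distrib_right sgr_mult_zero one_sgr_def mon_mult frac_ext_one)
qed

instance
proof
  fix x y z :: "'a sgr"
  show "x * y * z = x * (y * z)" by (rule sgr_mult_assoc)
  show "1 * x = x" "x * 1 = x" by (rule sgr_mult_one)+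
  show "(x + y) * z = x * z + y * z" by (rule sgr_distrib_right)
  show "x * (y + z) = x * y + x * z" by (rule sgr_distrib_left)
  have "cf 0 id \<noteq> cf (1 :: 'a sgr) id"
    by (simp add: cf_zero one_sgr_def cf_mon monomial_def)
  then show "0 \<noteq> (1 :: 'a sgr)" by auto
qed

end

section \<open>Chain conditions for ring extensions\<close>

lemma accD:
  assumes "acc P" "\<And>n :: nat. P (C n)" "\<And>n. C n \<subseteq> C (Suc n)"
  shows "\<exists>N. \<forall>m\<ge>N. C m = C N"
  using assms unfolding acc_def by blast

text \<open>A chain satisfying \<open>P\<close> is mapped to a chain satisfying \<open>Q\<close>,
  and once the image is constant the chain is too. Strictness is asked only between comparable
  members, the only pairs that occur in a chain.\<close>

lemma acc_transfer:
  fixes P :: "'a set \<Rightarrow> bool" and Q :: "'b set \<Rightarrow> bool"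
  assumes "acc Q" and Q: "\<And>I. P I \<Longrightarrow> Q (F I)"
    and mon: "\<And>I J. P I \<Longrightarrow> P J \<Longrightarrow> I \<subseteq> J \<Longrightarrow> F I \<subseteq> F J"
    and inj: "\<And>I J. P I \<Longrightarrow> P J \<Longrightarrow> I \<subseteq> J \<Longrightarrow> F I = F J \<Longrightarrow> I = J"
  shows "acc P"
  unfolding acc_def
proof (intro allI impI)
  fix C :: "nat \<Rightarrow> 'a set" assume C: "\<forall>n. P (C n) \<and> C n \<subseteq> C (Suc n)"
  obtain N where N: "\<And>m. m \<ge> N \<Longrightarrow> F (C m) = F (C N)"
    using accD[OF assms(1), of "\<lambda>n. F (C n)"] C Q mon by blast
  have "C N \<subseteq> C m" if "m \<ge> N" for m using C lift_Suc_mono_le[where f = C] that by blast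
  then have "C m = C N" if "m \<ge> N" for m
    using inj[of "C N" "C m"] N[OF that] C that by simp
  then show "\<exists>n. \<forall>m\<ge>n. C m = C n" by blast
qed

section \<open>Subrings, modules and one-sided ideals as subsets of one type\<close>

definition is_subring :: "'b::ring_1 set \<Rightarrow> bool" where
  "is_subring S \<longleftrightarrow> 0 \<in> S \<and> 1 \<in> S \<and> (\<forall>x\<in>S. - x \<in> S) \<and> (\<forall>x\<in>S. \<forall>y\<in>S. x + y \<in> S) \<and> (\<forall>x\<in>S. \<forall>y\<in>S. x * y \<in> S)"

definition lmod :: "'b::ring_1 set \<Rightarrow> 'b set \<Rightarrow> bool" where
  "lmod S I \<longleftrightarrow> 0 \<in> I \<and> (\<forall>x\<in>I. \<forall>y\<in>I. x + y \<in> I) \<and> (\<forall>r\<in>S. \<forall>x\<in>I. r * x \<in> I)"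

definition rmod :: "'b::ring_1 set \<Rightarrow> 'b set \<Rightarrow> bool" where
  "rmod S I \<longleftrightarrow> 0 \<in> I \<and> (\<forall>x\<in>I. \<forall>y\<in>I. x + y \<in> I) \<and> (\<forall>r\<in>S. \<forall>x\<in>I. x * r \<in> I)"

definition lideal :: "'b::ring_1 set \<Rightarrow> 'b set \<Rightarrow> bool" where "lideal S I \<longleftrightarrow> I \<subseteq> S \<and> lmod S I"
definition rideal :: "'b::ring_1 set \<Rightarrow> 'b set \<Rightarrow> bool" where "rideal S I \<longleftrightarrow> I \<subseteq> S \<and> rmod S I"

lemma is_subringD:
  assumes "is_subring S"
  shows is_subring_0: "0 \<in> S" and is_subring_1: "1 \<in> S" and is_subring_uminus: "x \<in> S \<Longrightarrow> - x \<in> S"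
    and is_subring_add: "x \<in> S \<Longrightarrow> y \<in> S \<Longrightarrow> x + y \<in> S" and is_subring_mult: "x \<in> S \<Longrightarrow> y \<in> S \<Longrightarrow> x * y \<in> S"
    and is_subring_diff: "x \<in> S \<Longrightarrow> y \<in> S \<Longrightarrow> x - y \<in> S"
  using assms unfolding is_subring_def by (auto simp del: add_uminus_conv_diff simp add: diff_conv_add_uminus)

lemma lmodD:
  assumes "lmod S I"
  shows lmod_0: "0 \<in> I" and lmod_add: "x \<in> I \<Longrightarrow> y \<in> I \<Longrightarrow> x + y \<in> I"
    and lmod_mult: "r \<in> S \<Longrightarrow> x \<in> I \<Longrightarrow> r * x \<in> I"
  using assms unfolding lmod_def by auto

lemma rmodD:
  assumes "rmod S I"
  shows rmod_0: "0 \<in> I" and rmod_add: "x \<in> I \<Longrightarrow> y \<in> I \<Longrightarrow> x + y \<in> I"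
    and rmod_mult: "r \<in> S \<Longrightarrow> x \<in> I \<Longrightarrow> x * r \<in> I"
  using assms unfolding rmod_def by auto

lemma lmod_uminus: "is_subring S \<Longrightarrow> lmod S I \<Longrightarrow> x \<in> I \<Longrightarrow> - x \<in> I"
  using lmod_mult[of S I "- 1" x] is_subring_uminus[of S 1] is_subring_1[of S] by simp

lemma rmod_uminus: "is_subring S \<Longrightarrow> rmod S I \<Longrightarrow> x \<in> I \<Longrightarrow> - x \<in> I"
  using rmod_mult[of S I "- 1" x] is_subring_uminus[of S 1] is_subring_1[of S] by simp

lemma lmod_diff: "is_subring S \<Longrightarrow> lmod S I \<Longrightarrow> x \<in> I \<Longrightarrow> y \<in> I \<Longrightarrow> x - y \<in> I"
  using lmod_add[of S I x "- y"] lmod_uminus[of S I y] by simp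

text \<open>Polynomials in the \<open>h j\<close> of degree strictly below \<open>k\<close>, with
  coefficients on the right.\<close>

primrec pspan :: "'b::ring_1 set \<Rightarrow> (nat \<Rightarrow> 'b) \<Rightarrow> nat \<Rightarrow> 'b set" where
  "pspan S h 0 = {0}"
| "pspan S h (Suc k) = {p + h k * s |p s. p \<in> pspan S h k \<and> s \<in> S}"

text \<open>The leading coefficients of the members of \<open>I\<close> of degree \<open>k\<close>, written on the right so that they form a
  left ideal. The sum of the \<open>h\<^sub>j S\<close> need not be direct.\<close>

definition lead :: "'b::ring_1 set \<Rightarrow> (nat \<Rightarrow> 'b) \<Rightarrow> nat \<Rightarrow> 'b set \<Rightarrow> 'b set" where
  "lead S h k I = {s \<in> S. \<exists>p \<in> pspan S h k. p + h k * s \<in> I}"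

lemma lead_mono: "I \<subseteq> J \<Longrightarrow> lead S h k I \<subseteq> lead S h k J"
  unfolding lead_def by blast

text \<open>The model is \<open>S = L * N\<close> with \<open>h k\<close> the units of coset
  representatives of a normal subgroup \<open>N\<close>. The first exchange rule makes
  \<open>pspan\<close> a left \<open>S\<close>-module, the second makes the leading coefficients a
  left ideal.\<close>

locale normalizing =
  fixes S :: "'b::ring_1 set" and h :: "nat \<Rightarrow> 'b"
  assumes S: "is_subring S"
    and norm_left: "\<And>k r. r \<in> S \<Longrightarrow> \<exists>r'\<in>S. r * h k = h k * r'"
    and norm_right: "\<And>k r. r \<in> S \<Longrightarrow> \<exists>r'\<in>S. h k * r = r' * h k"
begin

lemma pspan_lmod: "lmod S (pspan S h k)"
proof (induction k)
  case (Suc k)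
  note IH = lmodD[OF Suc]
  show ?case unfolding lmod_def
  proof (intro conjI ballI)
    show "0 \<in> pspan S h (Suc k)" using IH(1) is_subring_0[OF S] by force
    fix x y assume "x \<in> pspan S h (Suc k)" "y \<in> pspan S h (Suc k)"
    then obtain p s q t where "x = p + h k * s" "y = q + h k * t" "p \<in> pspan S h k" "q \<in> pspan S h k" "s \<in> S" "t \<in> S"
      by auto
    moreover then have "x + y = (p + q) + h k * (s + t)" by (simp add: algebra_simps)
    ultimately show "x + y \<in> pspan S h (Suc k)"
      unfolding pspan.simps using IH(2)[of p q] is_subring_add[OF S, of s t] by blast
  next
    fix r x assume r: "r \<in> S" and "x \<in> pspan S h (Suc k)"
    then obtain p s where x: "x = p + h k * s" "p \<in> pspan S h k" "s \<in> S" by auto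
    obtain r' where r': "r' \<in> S" "r * h k = h k * r'" using norm_left[OF r] by auto
    have "r * x = r * p + h k * (r' * s)"
      using x r' by (simp add: algebra_simps) (simp add: mult.assoc [symmetric])
    then show "r * x \<in> pspan S h (Suc k)" using IH(3)[OF r x(2)] is_subring_mult[OF S r'(1) x(3)] by auto
  qed
qed (simp add: lmod_def)

lemma pspan_Suc: "pspan S h k \<subseteq> pspan S h (Suc k)"
  using is_subring_0[OF S] by force

lemma pspan_incl: "j \<le> k \<Longrightarrow> pspan S h j \<subseteq> pspan S h k"
  by (rule lift_Suc_mono_le[where f = "pspan S h"]) (use pspan_Suc in auto)

lemma pspan_gen: "k < n \<Longrightarrow> s \<in> S \<Longrightarrow> h k * s \<in> pspan S h n"
  using pspan_incl[of "Suc k" n] lmod_0[OF pspan_lmod[of k]] by force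

text \<open>To multiply a leading coefficient by \<open>r\<close> from the left, the exchanged
  \<open>r'\<close> with \<open>h k * r = r' * h k\<close> acts on the whole member of
  \<open>I\<close>.\<close>

lemma lead_lideal: assumes I: "lmod S I" shows "lideal S (lead S h k I)"
  unfolding lideal_def lmod_def
proof (intro conjI ballI)
  show "lead S h k I \<subseteq> S" by (auto simp: lead_def)
  show "0 \<in> lead S h k I"
    using is_subring_0[OF S] lmod_0[OF pspan_lmod] lmod_0[OF I] by (force simp: lead_def)
next
  fix x y assume "x \<in> lead S h k I" "y \<in> lead S h k I"
  then obtain p q where p: "x \<in> S" "y \<in> S" "p \<in> pspan S h k" "q \<in> pspan S h k"
    "p + h k * x \<in> I" "q + h k * y \<in> I"
    by (auto simp: lead_def)
  then have "(p + q) + h k * (x + y) \<in> I"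
    using lmod_add[OF I, of "p + h k * x" "q + h k * y"] by (simp add: algebra_simps)
  then show "x + y \<in> lead S h k I"
    using p lmod_add[OF pspan_lmod] is_subring_add[OF S] by (auto simp: lead_def)
next
  fix r x assume r: "r \<in> S" and "x \<in> lead S h k I"
  then obtain p where p: "x \<in> S" "p \<in> pspan S h k" "p + h k * x \<in> I" by (auto simp: lead_def)
  obtain r' where r': "r' \<in> S" "h k * r = r' * h k" using norm_right[OF r] by auto
  have "r' * p + h k * (r * x) = r' * (p + h k * x)"
    using r' by (simp add: algebra_simps) (simp add: mult.assoc [symmetric])
  then have "r' * p + h k * (r * x) \<in> I" using lmod_mult[OF I r'(1) p(3)] by simp
  then show "r * x \<in> lead S h k I"
    using lmod_mult[OF pspan_lmod r'(1) p(2)] is_subring_mult[OF S r p(1)] by (auto simp: lead_def)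
qed

text \<open>Hilbert's descent: a member of \<open>J\<close> and a member of \<open>I\<close> with
  the same leading coefficient differ by a member of \<open>J\<close> of smaller degree.
  Representations in \<open>pspan\<close> may be ambiguous, but one choice of lower terms is
  enough.\<close>

lemma lead_determines:
  assumes "lmod S I" "lmod S J" "I \<subseteq> J" "\<And>k. k < n \<Longrightarrow> lead S h k J \<subseteq> lead S h k I"
  shows "J \<inter> pspan S h n \<subseteq> I"
  using assms(4)
proof (induction n)
  case 0 then show ?case using lmod_0[OF assms(1)] by auto
next
  case (Suc n)
  show ?case
  proof
    fix f assume "f \<in> J \<inter> pspan S h (Suc n)"
    then obtain p s where f: "f \<in> J" "f = p + h n * s" "p \<in> pspan S h n" "s \<in> S" by auto
    then have "s \<in> lead S h n J" by (auto simp: lead_def)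
    then have "s \<in> lead S h n I" using Suc.prems by blast
    then obtain q where q: "q \<in> pspan S h n" "q + h n * s \<in> I" by (auto simp: lead_def)
    have "f - (q + h n * s) \<in> J" using f q assms(3) lmod_diff[OF S assms(2)] by blast
    moreover have eq: "f - (q + h n * s) = p - q" using f by simp
    ultimately have "f - (q + h n * s) \<in> J \<inter> pspan S h n"
      using lmod_diff[OF S pspan_lmod f(3) q(1)] by (simp only: eq Int_iff)
    then have "f - (q + h n * s) \<in> I" using Suc by auto
    then show "f \<in> I" using lmod_add[OF assms(1) _ q(2)] by fastforce
  qed
qed

text \<open>Each degree becomes stationary at its own index, and for finitely many degrees the
  maximum of these indices serves all.\<close>

lemma lead_stable:
  assumes "acc (lideal S)" "\<And>n. lmod S (C n)" "\<And>n :: nat. C n \<subseteq> C (Suc n)"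
  shows "\<exists>N. \<forall>k<j. \<forall>m\<ge>N. lead S h k (C m) = lead S h k (C N)"
proof (induction j)
  case (Suc j)
  then obtain N where N: "\<And>k m. k < j \<Longrightarrow> m \<ge> N \<Longrightarrow> lead S h k (C m) = lead S h k (C N)" by blast
  obtain N' where N': "\<And>m. m \<ge> N' \<Longrightarrow> lead S h j (C m) = lead S h j (C N')"
    using accD[OF assms(1), of "\<lambda>n. lead S h j (C n)", OF lead_lideal[OF assms(2)] lead_mono[OF assms(3)]]
    by blast
  show ?case
  proof (intro exI[of _ "max N N'"] allI impI)
    fix k m assume "k < Suc j" "max N N' \<le> m"
    then show "lead S h k (C m) = lead S h k (C (max N N'))"
      using N[of k m] N[of k "max N N'"] N'[of m] N'[of "max N N'"] by (cases "k = j") auto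
  qed
qed simp

text \<open>Only degrees below \<open>n\<close> occur in \<open>S'\<close>, so finitely many chains
  of leading ideals decide when a chain in \<open>S'\<close> is stationary.\<close>

lemma acc_finite_extension:
  assumes acc: "acc (lideal S)" and "S \<subseteq> S'" "S' \<subseteq> pspan S h n"
  shows "acc (lideal S')"
  unfolding acc_def
proof (intro allI impI)
  fix C :: "nat \<Rightarrow> 'b set" assume C: "\<forall>n. lideal S' (C n) \<and> C n \<subseteq> C (Suc n)"
  then have l: "lmod S (C i)" and sub: "C i \<subseteq> S'" for i
    using assms(2) unfolding lideal_def lmod_def by blast+
  obtain N where N: "\<And>k m. k < n \<Longrightarrow> m \<ge> N \<Longrightarrow> lead S h k (C m) = lead S h k (C N)"
    using lead_stable[where C = C and j = n, OF acc l] C by blast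
  have "C m = C N" if "m \<ge> N" for m
  proof
    show inc: "C N \<subseteq> C m" using C lift_Suc_mono_le[where f = C] that by blast
    show "C m \<subseteq> C N" using lead_determines[OF l l inc, of n] N that sub assms(3) by blast
  qed
  then show "\<exists>n. \<forall>m\<ge>n. C m = C n" by blast
qed

end

lemma pspan_power_shift:
  fixes x :: "'b::ring_1"
  assumes "normalizing S (\<lambda>k. x ^ k)" and "p \<in> pspan S (\<lambda>k. x ^ k) k"
  shows "x * p \<in> pspan S (\<lambda>k. x ^ k) (Suc k)"
  using assms(2)
proof (induction k arbitrary: p)
  case 0
  interpret normalizing S "\<lambda>k. x ^ k" by fact
  show ?case using 0 lmod_0[OF pspan_lmod[of "Suc 0"]] by simp
next
  case (Suc k)
  then obtain q s where "p = q + x ^ k * s" "q \<in> pspan S (\<lambda>k. x ^ k) k" "s \<in> S" by auto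
  then have "x * p = x * q + x ^ Suc k * s" "x * q \<in> pspan S (\<lambda>k. x ^ k) (Suc k)" "s \<in> S"
    using Suc.IH by (auto simp: algebra_simps)
  then show ?case unfolding pspan.simps(2)[of _ _ "Suc k"] by blast
qed

text \<open>The Laurent polynomial version. Degrees are unbounded, but \<open>x\<close> lies in
  \<open>S'\<close>, so the leading ideals grow with the degree as well as along the chain. A power
  of \<open>x\<close> turns any element into a polynomial, and the left inverse \<open>xi\<close>
  removes that power again.\<close>

lemma acc_cyclic_extension:
  fixes x xi :: "'b::ring_1"
  assumes "normalizing S (\<lambda>k. x ^ k)"
    and acc: "acc (lideal S)" and "S \<subseteq> S'" "is_subring S'" and x: "x \<in> S'" "xi \<in> S'" "xi * x = 1"
    and ex: "\<And>f. f \<in> S' \<Longrightarrow> \<exists>m n. x ^ m * f \<in> pspan S (\<lambda>k. x ^ k) n"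
  shows "acc (lideal S')"
  unfolding acc_def
proof (intro allI impI)
  interpret normalizing S "\<lambda>k. x ^ k" by fact
  let ?L = "lead S (\<lambda>k. x ^ k)" and ?P = "pspan S (\<lambda>k. x ^ k)"
  fix C :: "nat \<Rightarrow> 'b set" assume C: "\<forall>n. lideal S' (C n) \<and> C n \<subseteq> C (Suc n)"
  then have l: "lmod S (C i)" and l': "lmod S' (C i)" and sub: "C i \<subseteq> S'" for i
    using assms(3) unfolding lideal_def lmod_def by blast+
  have C_mono: "C i \<subseteq> C j" if "i \<le> j" for i j using C lift_Suc_mono_le[where f = C] that by blast
  note xP = pspan_power_shift[OF assms(1)]
  have L_Suc: "?L k (C i) \<subseteq> ?L (Suc k) (C i)" for k i
  proof
    fix s assume "s \<in> ?L k (C i)"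
    then obtain p where p: "s \<in> S" "p \<in> ?P k" "p + x ^ k * s \<in> C i" by (auto simp: lead_def)
    then have "x * p + x ^ Suc k * s \<in> C i"
      using lmod_mult[OF l' x(1), of "p + x ^ k * s"] by (simp add: algebra_simps)
    with p xP[OF p(2)] show "s \<in> ?L (Suc k) (C i)" unfolding lead_def by blast
  qed
  have L_mono: "?L k (C i) \<subseteq> ?L k' (C i')" if "k \<le> k'" "i \<le> i'" for k k' i i'
    using lift_Suc_mono_le[where f = "\<lambda>k. ?L k (C i)", OF L_Suc that(1)] lead_mono[OF C_mono[OF that(2)]] by blast
  \<comment> \<open>The diagonal is an ascending chain of left ideals of \<open>S\<close>; its limit
    controls all degrees from \<open>M\<close> on.\<close>
  obtain M where M: "\<And>m. m \<ge> M \<Longrightarrow> ?L m (C m) = ?L M (C M)"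
    using accD[where C = "\<lambda>n. ?L n (C n)", OF acc lead_lideal[OF l] L_mono[OF le_SucI le_SucI]] by blast
  obtain N' where N': "\<And>k m. k < M \<Longrightarrow> m \<ge> N' \<Longrightarrow> ?L k (C m) = ?L k (C N')"
    using lead_stable[where C = C and j = M, OF acc l] C by blast
  define N where "N = max M N'"
  have eq: "?L k (C m) = ?L k (C N)" if "m \<ge> N" for k m
  proof (cases "k < M")
    case True then show ?thesis using N'[of k m] N'[of k N] that by (simp add: N_def)
  next
    case False
    \<comment> \<open>Squeezed between diagonal members: \<open>?L M (C M)\<close> from below and
      \<open>?L m (C m)\<close> with \<open>m = max k n\<close> from above.\<close>
    have "?L k (C n) = ?L M (C M)" if "n \<ge> M" for n
      using L_mono[of M k M n] L_mono[of k "max k n" n "max k n"] M[of "max k n"] False that by auto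
    then show ?thesis using that by (simp add: N_def)
  qed
  have "C m = C N" if m: "m \<ge> N" for m
  proof
    show inc: "C N \<subseteq> C m" using C_mono[OF m] .
    show "C m \<subseteq> C N"
    proof
      fix f assume f: "f \<in> C m"
      then obtain i n where "x ^ i * f \<in> ?P n" using ex sub by blast
      have xp: "x ^ i \<in> S'" "xi ^ i \<in> S'" for i
        by (induction i) (use x is_subring_1[OF assms(4)] is_subring_mult[OF assms(4)] in auto)
      have "x ^ i * f \<in> C m" using lmod_mult[OF l' xp(1) f] .
      then have "x ^ i * f \<in> C N"
        using lead_determines[OF l l inc, of n] eq[OF m] \<open>x ^ i * f \<in> ?P n\<close> by blast
      then have *: "xi ^ i * (x ^ i * f) \<in> C N" by (rule lmod_mult[OF l' xp(2)])
      have "xi ^ i * x ^ i = 1"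
      proof (induction i)
        case (Suc i)
        have "xi ^ Suc i * x ^ Suc i = xi ^ i * (xi * x) * x ^ i"
          unfolding power_Suc2[of xi] power_Suc[of x] by (simp only: mult.assoc)
        then show ?case using Suc x(3) by simp
      qed simp
      then show "f \<in> C N" using * by (simp add: mult.assoc [symmetric])
    qed
  qed
  then show "\<exists>n. \<forall>m\<ge>n. C m = C n" by blast
qed

section \<open>Skew group rings of subgroups\<close>

lemma cf_mon_mult:
  fixes \<mu> \<rho> :: "'a::idom \<Rightarrow> 'a"
  assumes "\<mu> \<in> Aut" shows "cf (mon a \<mu> * x) \<rho> = a * frac_ext \<mu> (cf x (ainv \<mu> \<circ> \<rho>))"
proof (induction x rule: sgr_induct)
  case (mon b \<nu>)
  have eq: "\<rho> = \<mu> \<circ> \<nu> \<longleftrightarrow> ainv \<mu> \<circ> \<rho> = \<nu>"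
    using assms by (metis Aut_comp_inv Aut_inv_comp comp_assoc id_comp)
  have "cf (mon a \<mu> * mon b \<nu>) \<rho> = monomial (a * frac_ext \<mu> b) (\<mu> \<circ> \<nu>) \<rho>"
    using assms mon by (simp add: mon_mult cf_mon)
  also have "\<dots> = a * frac_ext \<mu> (monomial b \<nu> (ainv \<mu> \<circ> \<rho>))"
    unfolding monomial_app eq using assms by (simp add: frac_ext_zero)
  finally show ?case unfolding cf_mon[OF mon(2)] .
qed (use assms in \<open>simp_all add: cf_zero cf_plus frac_ext_zero frac_ext_add distrib_left\<close>)

lemma cf_mult_mon:
  fixes \<nu> \<rho> :: "'a::idom \<Rightarrow> 'a"
  assumes "\<nu> \<in> Aut" shows "cf (x * mon b \<nu>) \<rho> = cf x (\<rho> \<circ> ainv \<nu>) * frac_ext (\<rho> \<circ> ainv \<nu>) b"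
proof (induction x rule: sgr_induct)
  case (mon a \<mu>)
  have eq: "\<rho> = \<mu> \<circ> \<nu> \<longleftrightarrow> \<rho> \<circ> ainv \<nu> = \<mu>"
    using assms by (metis Aut_comp_inv Aut_inv_comp comp_assoc comp_id)
  have "cf (mon a \<mu> * mon b \<nu>) \<rho> = monomial (a * frac_ext \<mu> b) (\<mu> \<circ> \<nu>) \<rho>"
    using assms mon by (simp add: mon_mult cf_mon)
  also have "\<dots> = monomial a \<mu> (\<rho> \<circ> ainv \<nu>) * frac_ext (\<rho> \<circ> ainv \<nu>) b"
    unfolding monomial_app eq using assms by simp
  finally show ?case unfolding cf_mon[OF mon(2)] .
qed (use assms in \<open>simp_all add: cf_zero cf_plus distrib_right\<close>)

abbreviation unit_of :: "('a::idom \<Rightarrow> 'a) \<Rightarrow> 'a sgr" where "unit_of \<equiv> mon 1"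
abbreviation scalar :: "'a::idom fract \<Rightarrow> 'a sgr" where "scalar a \<equiv> mon a id"

lemma mon_0 [simp]: "\<mu> \<in> Aut \<Longrightarrow> mon 0 \<mu> = 0"
  by (rule cf_eqI) (simp add: cf_mon monomial_app cf_zero)

lemma unit_mult: "\<mu> \<in> Aut \<Longrightarrow> \<nu> \<in> Aut \<Longrightarrow> unit_of \<mu> * unit_of \<nu> = unit_of (\<mu> \<circ> \<nu>)"
  by (simp add: mon_mult frac_ext_one)

lemma unit_id [simp]: "unit_of id = 1"
  by (simp add: one_sgr_def)

lemma unit_inv [simp]: "\<mu> \<in> Aut \<Longrightarrow> unit_of \<mu> * unit_of (ainv \<mu>) = 1"
  "\<mu> \<in> Aut \<Longrightarrow> unit_of (ainv \<mu>) * unit_of \<mu> = 1"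
  by (simp_all add: unit_mult)

lemma supported_id: "x \<in> supported {id} \<longleftrightarrow> (\<exists>a. x = scalar a)"
proof
  assume "x \<in> supported {id}"
  then have "x = scalar (cf x id)"
    by (intro cf_eqI) (auto simp: cf_mon monomial_app supported_def)
  then show "\<exists>a. x = scalar a" by blast
qed (auto intro: supported_mon)

lemma supported_subset: "M \<subseteq> N \<Longrightarrow> supported M \<subseteq> supported N"
  by (auto simp: supported_def)

text \<open>In the ring over all automorphisms the action of \<open>g\<close> is inner. Being fixed
  by \<open>g\<close> thus means commuting with \<open>unit_of g\<close>, the form in which
  \<open>fixedM\<close> is phrased.\<close>

lemma cf_conj:
  assumes "g \<in> Aut"
  shows "cf (unit_of g * x * unit_of (ainv g)) = skew_act g (cf x)"
proof
  fix \<rho>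
  have e: "cf x (ainv g \<circ> \<rho> \<circ> g) * frac_ext (ainv g \<circ> \<rho> \<circ> g) 1 = cf x (ainv g \<circ> \<rho> \<circ> g)"
    using supp_Aut[of x "ainv g \<circ> \<rho> \<circ> g"] by (cases "cf x (ainv g \<circ> \<rho> \<circ> g) = 0") (auto simp: frac_ext_one)
  then show "cf (unit_of g * x * unit_of (ainv g)) \<rho> = skew_act g (cf x) \<rho>"
    using assms by (simp add: mult.assoc cf_mon_mult cf_mult_mon skew_act_def e)
qed

lemma is_subring_supported:
  assumes N: "subgroup N ring_aut_group" shows "is_subring (supported N)"
proof -
  have mult: "x * y \<in> supported N" if "x \<in> supported N" "y \<in> supported N" for x y
    using that(1)
  proof (induction x rule: supported_induct)
    case (mon a \<mu>)
    note \<mu> = this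
    show ?case using that(2)
    proof (induction y rule: supported_induct)
      case (mon b \<nu>)
      then show ?case using \<mu> subgroup_comp[OF N] by (simp add: mon_mult supported_mon)
    qed (simp_all add: distrib_left supported_add)
  qed (simp_all add: distrib_right supported_add)
  have "1 \<in> supported N" using supported_mon[OF subgroup_id[OF N], of 1] by simp
  then show ?thesis unfolding is_subring_def
    by (intro conjI ballI) (simp_all add: mult supported_add supported_uminus)
qed

text \<open>A nonzero element of a two-sided ideal with fewest terms, translated so that the identity occurs
  in it, commutes with all scalars, because each commutator has fewer terms.\<close>

lemma supported_simple:
  assumes H: "subgroup H ring_aut_group" and I: "lideal (supported H) I" "rideal (supported H) I"
    and "x \<in> I" "x \<noteq> 0"
  shows "1 \<in> I"
  using assms(4,5)
proof (induction "card {\<mu>. cf x \<mu> \<noteq> 0}" arbitrary: x rule: less_induct)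
  case less
  note H' = subgroup_id[OF H] subgroup_inv[OF H]
  have l: "lmod (supported H) I" and r: "rmod (supported H) I" and IH: "I \<subseteq> supported H"
    using I by (auto simp: lideal_def rideal_def)
  obtain \<mu> where \<mu>: "cf x \<mu> \<noteq> 0" using less.prems(2) cf_eqI[of x 0] by (auto simp: cf_zero)
  then have \<mu>H: "\<mu> \<in> H" "\<mu> \<in> Aut" using less.prems IH by (auto simp: supported_def dest: supp_Aut)
  define y where "y = x * unit_of (ainv \<mu>)"
  have yI: "y \<in> I" unfolding y_def
    by (rule rmod_mult[OF r _ less.prems(1)]) (use \<mu>H H' in \<open>simp add: supported_mon\<close>)
  have cfy: "cf y \<rho> = cf x (\<rho> \<circ> \<mu>)" for \<rho>
    unfolding y_def using supp_Aut[of x "\<rho> \<circ> \<mu>"] \<mu>H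
    by (cases "cf x (\<rho> \<circ> \<mu>) = 0") (auto simp: cf_mult_mon frac_ext_one)
  have "{\<rho>. cf y \<rho> \<noteq> 0} \<subseteq> (\<lambda>\<nu>. \<nu> \<circ> ainv \<mu>) ` {\<nu>. cf x \<nu> \<noteq> 0}"
  proof
    fix \<rho> assume "\<rho> \<in> {\<rho>. cf y \<rho> \<noteq> 0}"
    moreover have "\<rho> = (\<rho> \<circ> \<mu>) \<circ> ainv \<mu>" using \<mu>H by (simp add: comp_assoc)
    ultimately show "\<rho> \<in> (\<lambda>\<nu>. \<nu> \<circ> ainv \<mu>) ` {\<nu>. cf x \<nu> \<noteq> 0}" by (auto simp: cfy)
  qed
  then have card: "card {\<rho>. cf y \<rho> \<noteq> 0} \<le> card {\<nu>. cf x \<nu> \<noteq> 0}"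
    using surj_card_le[OF finite_supp] by blast
  have yid: "cf y id \<noteq> 0" using \<mu> by (simp add: cfy)
  show ?case
  proof (cases "\<forall>a. scalar a * y - y * scalar a = 0")
    case True
    have "\<rho> = id" if \<rho>: "cf y \<rho> \<noteq> 0" for \<rho>
    proof (rule frac_ext_eq_id)
      show "\<rho> \<in> Aut" using \<rho> by (rule supp_Aut)
      fix a
      \<comment> \<open>The two coefficients are \<open>a * cf y \<rho>\<close> and
        \<open>cf y \<rho> * frac_ext \<rho> a\<close>; cancelling in the field shows that
        \<open>\<rho>\<close> acts trivially on \<open>L\<close>.\<close>
      have "cf (scalar a * y) \<rho> = cf (y * scalar a) \<rho>" using True by simp
      then show "frac_ext \<rho> a = a" using \<rho> by (simp add: cf_mon_mult cf_mult_mon inv_id mult.commute)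
    qed
    then have "y \<in> supported {id}" by (auto simp: supported_def)
    then obtain c where c: "y = scalar c" by (auto simp: supported_id)
    then have "c \<noteq> 0" using yid by (auto simp: cf_mon monomial_app)
    then have "scalar (inverse c) * y = 1" using c by (simp add: mon_mult)
    moreover have "scalar (inverse c) * y \<in> I"
      by (rule lmod_mult[OF l _ yI]) (use H' in \<open>simp add: supported_mon\<close>)
    ultimately show ?thesis by simp
  next
    case False
    then obtain a where a: "scalar a * y - y * scalar a \<noteq> 0" (is "?d \<noteq> 0") by blast
    have sc: "scalar a \<in> supported H" using H' by (simp add: supported_mon)
    have dI: "?d \<in> I"
      using lmod_diff[OF is_subring_supported[OF H] l lmod_mult[OF l sc yI] rmod_mult[OF r sc yI]] .
    \<comment> \<open>At \<open>id\<close> both products have the coefficient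
      \<open>a * cf y id\<close>, since \<open>L\<close> is commutative, so the identity drops out
      of the support.\<close>
    have "{\<rho>. cf ?d \<rho> \<noteq> 0} \<subseteq> {\<rho>. cf y \<rho> \<noteq> 0} - {id}"
      by (auto simp: cf_minus cf_mon_mult cf_mult_mon inv_id)
    then have "{\<rho>. cf ?d \<rho> \<noteq> 0} \<subset> {\<rho>. cf y \<rho> \<noteq> 0}" using yid by blast
    then have "card {\<rho>. cf ?d \<rho> \<noteq> 0} < card {\<rho>. cf y \<rho> \<noteq> 0}"
      by (intro psubset_card_mono) simp_all
    then show ?thesis using less.hyps[OF _ dI a] card by simp
  qed
qed

text \<open>The anti-automorphism \<open>a \<mu> \<mapsto> \<mu>\<^sup>-\<^sup>1 a\<close>, available because \<open>L\<close> is commutative, exchanges left and right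
  ideals.\<close>

definition star :: "'a::idom sgr \<Rightarrow> 'a sgr" where
  "star x = (\<Sum>\<mu> | cf x \<mu> \<noteq> 0. unit_of (ainv \<mu>) * scalar (cf x \<mu>))"

lemma star_conv:
  assumes "finite A" "{\<mu>. cf x \<mu> \<noteq> 0} \<subseteq> A"
  shows "star x = (\<Sum>\<mu>\<in>A. unit_of (ainv \<mu>) * scalar (cf x \<mu>))"
  unfolding star_def using assms by (intro sum.mono_neutral_left) auto

lemma star_add: "star (x + y) = star x + star y"
proof -
  let ?A = "{\<mu>. cf x \<mu> \<noteq> 0} \<union> {\<mu>. cf y \<mu> \<noteq> 0}"
  have sc: "scalar (a + b) = scalar a + scalar b" for a b :: "'a fract"
    by (rule cf_eqI) (simp add: cf_mon cf_plus monomial_app)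
  have "{\<mu>. cf (x + y) \<mu> \<noteq> 0} \<subseteq> ?A" by (auto simp: cf_plus)
  then show ?thesis
    by (simp add: star_conv[of ?A] cf_plus sc distrib_left sum.distrib)
qed

lemma star_mon: "\<mu> \<in> Aut \<Longrightarrow> star (mon a \<mu>) = mon (frac_ext (ainv \<mu>) a) (ainv \<mu>)"
  by (subst star_conv[of "{\<mu>}"]) (auto simp: cf_mon monomial_app mon_mult)

lemma star_zero [simp]: "star 0 = 0"
  by (simp add: star_def cf_zero)

lemma star_mult: "star (x * y) = star y * star x"
proof (induction x rule: sgr_induct)
  case (mon a \<mu>)
  note x = this
  show ?case
  proof (induction y rule: sgr_induct)
    case (mon b \<nu>)
    have "frac_ext (ainv \<nu>) (frac_ext (ainv \<mu>) (frac_ext \<mu> b)) = frac_ext (ainv \<nu>) b"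
      using x by (simp add: frac_ext_comp [symmetric])
    then show ?case using x mon
      by (simp add: mon_mult star_mon Aut_inv_comp_distrib frac_ext_mult frac_ext_comp mult.commute)
  qed (simp_all add: star_add distrib_left distrib_right)
qed (simp_all add: star_add distrib_left distrib_right)

lemma star_star [simp]: "star (star x) = x"
  by (induction x rule: sgr_induct) (simp_all add: star_add star_mon frac_ext_comp [symmetric])

lemma star_supported:
  assumes "subgroup N ring_aut_group" "x \<in> supported N" shows "star x \<in> supported N"
  using assms(2)
proof (induction x rule: supported_induct)
  case (mon a \<mu>)
  then show ?case using subgroup_inv[OF assms(1)] by (simp add: star_mon supported_mon)
qed (simp_all add: star_add supported_add)

lemma acc_rideal_supported:
  assumes N: "subgroup N ring_aut_group" and acc: "acc (lideal (supported N))"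
  shows "acc (rideal (supported N))"
proof (rule acc_transfer[OF acc, where F = "\<lambda>I. star ` I"])
  fix I assume I: "rideal (supported N) I"
  then have r: "rmod (supported N) I" and sub: "I \<subseteq> supported N" by (auto simp: rideal_def)
  show "lideal (supported N) (star ` I)"
    unfolding lideal_def lmod_def
  proof (intro conjI ballI)
    show "star ` I \<subseteq> supported N" using sub star_supported[OF N] by blast
    show "0 \<in> star ` I" using rmod_0[OF r] star_zero by (metis imageI)
    show "x + y \<in> star ` I" if "x \<in> star ` I" "y \<in> star ` I" for x y
      using that rmod_add[OF r] by (auto simp: star_add [symmetric])
    show "s * x \<in> star ` I" if "s \<in> supported N" "x \<in> star ` I" for s x
    proof -
      from that(2) obtain z where z: "x = star z" "z \<in> I" by (rule imageE)
      have "s * x = star (z * star s)" by (simp add: star_mult z)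
      then show ?thesis using rmod_mult[OF r star_supported[OF N that(1)] z(2)] by blast
    qed
  qed
next
  fix I J :: "'a sgr set" assume "star ` I = star ` J"
  then show "I = J" by (metis inj_image_eq_iff inj_on_inverseI star_star)
qed blast

section \<open>The fixed ring\<close>

text \<open>Besides the given \<open>M\<close>, the trivial group is put in place of
  \<open>M\<close>, which turns \<open>L * MG\<close> into \<open>L * G\<close>. Trivial
  intersection makes the factorisation of a member of \<open>MG\<close> as
  \<open>\<mu> \<circ> g\<close> unique.\<close>

locale galois_pair =
  fixes G M :: "('a::idom \<Rightarrow> 'a) set"
  assumes G: "subgroup G ring_aut_group" and M: "subgroup M ring_aut_group"
    and fin: "finite G" and inter: "M \<inter> G = {id}"
    and conj: "\<And>g \<mu>. g \<in> G \<Longrightarrow> \<mu> \<in> M \<Longrightarrow> g \<circ> \<mu> \<circ> ainv g \<in> M"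
begin

abbreviation skewM :: "'a sgr set" where "skewM \<equiv> supported M"

definition MG :: "('a \<Rightarrow> 'a) set" where "MG = {\<mu> \<circ> g |\<mu> g. \<mu> \<in> M \<and> g \<in> G}"

definition fixedM :: "'a sgr set" where
  "fixedM = {x \<in> skewM. \<forall>g\<in>G. unit_of g * x = x * unit_of g}"

definition tG :: "'a sgr" where "tG = (\<Sum>g\<in>G. unit_of g)"

definition tr :: "'a sgr \<Rightarrow> 'a sgr" where
  "tr y = (\<Sum>g\<in>G. unit_of g * y * unit_of (ainv g))"

lemmas G_Aut = subgroup_Aut[OF G] and M_Aut = subgroup_Aut[OF M]
lemmas is_subring_M = is_subring_supported[OF M]

section \<open>The group \<open>MG\<close> and multiplication by \<open>tG\<close>\<close>

lemma subgroup_MG: "subgroup MG ring_aut_group"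
  unfolding subgroup_Aut_iff
proof (intro conjI ballI subsetI)
  fix x assume "x \<in> MG"
  then obtain \<mu> g where x: "x = \<mu> \<circ> g" "\<mu> \<in> M" "g \<in> G" by (auto simp: MG_def)
  then show "x \<in> Aut" using G_Aut M_Aut by simp
  have "ainv x = (ainv g \<circ> ainv \<mu> \<circ> ainv (ainv g)) \<circ> ainv g"
    using x G_Aut M_Aut by (simp add: Aut_inv_comp_distrib comp_assoc)
  then show "ainv x \<in> MG"
    using conj[OF subgroup_inv[OF G x(3)] subgroup_inv[OF M x(2)]] subgroup_inv[OF G x(3)]
    unfolding MG_def by blast
  fix y assume "y \<in> MG"
  then obtain \<nu> h where y: "y = \<nu> \<circ> h" "\<nu> \<in> M" "h \<in> G" by (auto simp: MG_def)
  have "g \<circ> \<nu> = (g \<circ> \<nu> \<circ> ainv g) \<circ> g" using x(3) G_Aut by (simp add: comp_assoc)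
  then have "x \<circ> y = (\<mu> \<circ> (g \<circ> \<nu> \<circ> ainv g)) \<circ> (g \<circ> h)"
    using x y by (metis comp_assoc)
  then show "x \<circ> y \<in> MG"
    using subgroup_comp[OF M x(2) conj[OF x(3) y(2)]] subgroup_comp[OF G x(3) y(3)]
    unfolding MG_def by blast
next
  have "id = id \<circ> (id :: 'a \<Rightarrow> 'a)" by simp
  then show "id \<in> MG" using subgroup_id[OF M] subgroup_id[OF G] unfolding MG_def by blast
qed

lemma M_MG: "M \<subseteq> MG"
proof
  fix \<mu> assume "\<mu> \<in> M"
  moreover have "\<mu> = \<mu> \<circ> id" by simp
  ultimately show "\<mu> \<in> MG" using subgroup_id[OF G] unfolding MG_def by blast
qed

lemma G_MG: "G \<subseteq> MG"
proof
  fix g assume "g \<in> G"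
  moreover have "g = id \<circ> g" by simp
  ultimately show "g \<in> MG" using subgroup_id[OF M] unfolding MG_def by blast
qed

lemma skewM_MG: "skewM \<subseteq> supported MG"
  by (rule supported_subset[OF M_MG])

lemma scalar_M: "scalar a \<in> skewM"
  using subgroup_id[OF M] by (simp add: supported_mon)

lemma unit_tG: "h \<in> G \<Longrightarrow> unit_of h * tG = tG"
proof -
  assume h: "h \<in> G"
  have "unit_of h * tG = (\<Sum>g\<in>G. unit_of (h \<circ> g))"
    unfolding tG_def sum_distrib_left using h G_Aut by (intro sum.cong refl) (simp add: unit_mult)
  also have "\<dots> = tG" unfolding tG_def
    by (rule sum.reindex_bij_witness[where i = "\<lambda>g. ainv h \<circ> g" and j = "\<lambda>g. h \<circ> g"])
      (use h G_Aut subgroup_comp[OF G] subgroup_inv[OF G] in \<open>simp_all add: comp_assoc [symmetric]\<close>)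
  finally show ?thesis .
qed

lemma tG_MG: "tG \<in> supported MG"
proof -
  have "sum unit_of F \<in> supported MG" if "F \<subseteq> G" for F
    using finite_subset[OF that fin] that
  proof (induction F rule: finite_induct)
    case (insert g F)
    then show ?case using G_MG G_Aut by (auto intro!: supported_add supported_mon)
  qed simp
  then show ?thesis by (simp add: tG_def)
qed

text \<open>The last factor absorbs units of \<open>G\<close>, so a factor
  \<open>unit_of (ainv g)\<close> can be inserted before it for free, which turns each term of the
  first factor into a conjugate of \<open>y\<close>.\<close>

lemma tG_mult_tG: "tG * y * tG = tr y * tG"
proof -
  have "unit_of g * y * tG = unit_of g * y * unit_of (ainv g) * tG" if "g \<in> G" for g
    using unit_tG[OF subgroup_inv[OF G that]] by (simp add: mult.assoc)
  then show ?thesis unfolding tG_def[THEN arg_cong, of "\<lambda>t. t * y * tG"] tr_def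
    by (simp add: sum_distrib_right)
qed

text \<open>The cosets \<open>\<mu> G\<close> with \<open>\<mu> \<in> M\<close> are disjoint,
  because \<open>M\<close> meets \<open>G\<close> trivially. Hence at \<open>\<mu> \<in> M\<close>
  only the term of \<open>g = id\<close> contributes to the coefficient of
  \<open>y * tG\<close>.\<close>

lemma mult_tG_eq_0: assumes y: "y \<in> skewM" and 0: "y * tG = 0" shows "y = 0"
proof (rule cf_eqI)
  fix \<mu>
  show "cf y \<mu> = cf 0 \<mu>"
  proof (cases "\<mu> \<in> M")
    case True
    have "cf (y * unit_of g) \<mu> = (if g = id then cf y \<mu> else 0)" if g: "g \<in> G" for g
    proof (cases "g = id")
      case True then show ?thesis using supp_Aut[of y \<mu>] by simp
    next
      case False
      have "\<mu> \<circ> ainv g \<notin> M"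
      proof
        assume "\<mu> \<circ> ainv g \<in> M"
        then have "ainv \<mu> \<circ> (\<mu> \<circ> ainv g) \<in> M" using subgroup_comp[OF M] subgroup_inv[OF M True] by blast
        then have "ainv g \<in> M" using M_Aut[OF True] by (simp add: comp_assoc [symmetric])
        then have "ainv g = id" using inter subgroup_inv[OF G g] by blast
        then have "g = id" using Aut_inv_inv[OF G_Aut[OF g]] by (simp add: inv_id)
        with False show False by simp
      qed
      then show ?thesis using False y G_Aut[OF g] by (auto simp: cf_mult_mon supported_def)
    qed
    then have "cf (y * tG) \<mu> = (\<Sum>g\<in>G. if g = id then cf y \<mu> else 0)"
      unfolding tG_def sum_distrib_left cf_sum by (intro sum.cong refl) blast
    also have "\<dots> = cf y \<mu>" using fin subgroup_id[OF G] by simp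
    finally show ?thesis using 0 by simp
  next
    case False then show ?thesis using y by (auto simp: supported_def cf_zero)
  qed
qed

lemma mult_tG_cancel: "x \<in> skewM \<Longrightarrow> y \<in> skewM \<Longrightarrow> x * tG = y * tG \<Longrightarrow> x = y"
  using mult_tG_eq_0[of "x - y"] is_subring_diff[OF is_subring_M, of x y] by (simp add: left_diff_distrib)

text \<open>Every member of \<open>MG\<close> ends in a member of \<open>G\<close>, which
  \<open>tG\<close> swallows. Multiples of \<open>tG\<close> thus need coefficients from
  \<open>L * M\<close> only.\<close>

lemma absorb_tG:
  assumes "b \<in> supported MG" shows "\<exists>b'\<in>skewM. b * tG = b' * tG"
  using assms
proof (induction b rule: supported_induct)
  case zero then show ?case using supported_zero by blast
next
  case (add x y)
  then show ?case by (metis distrib_right supported_add)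
next
  case (mon a \<mu>)
  then obtain \<nu> g where \<mu>: "\<mu> = \<nu> \<circ> g" "\<nu> \<in> M" "g \<in> G" by (auto simp: MG_def)
  then have "mon a \<mu> = mon a \<nu> * unit_of g" using M_Aut G_Aut by (simp add: mon_mult frac_ext_one)
  then have "mon a \<mu> * tG = mon a \<nu> * tG" using unit_tG[OF \<mu>(3)] by (simp add: mult.assoc)
  then show ?case using supported_mon[OF \<mu>(2) M_Aut[OF \<mu>(2)]] by blast
qed

lemma conj_M:
  assumes g: "g \<in> G" and y: "y \<in> skewM" shows "unit_of g * y * unit_of (ainv g) \<in> skewM"
  using y
proof (induction y rule: supported_induct)
  case (mon a \<mu>)
  then show ?case using conj[OF g mon(1)] G_Aut[OF g] M_Aut
    by (simp add: mon_mult frac_ext_one supported_mon)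
qed (simp_all add: distrib_left distrib_right supported_add)

lemma sum_supported: "(\<And>i. i \<in> F \<Longrightarrow> f i \<in> supported N) \<Longrightarrow> sum f F \<in> supported N"
  by (induction F rule: infinite_finite_induct) (simp_all add: supported_add)

section \<open>The trace\<close>

lemma tr_commute:
  assumes h: "h \<in> G" shows "unit_of h * tr y = tr y * unit_of h"
proof -
  have hA: "h \<in> Aut" by (rule G_Aut[OF h])
  have "unit_of h * tr y * unit_of (ainv h) =
      (\<Sum>g\<in>G. unit_of (h \<circ> g) * y * unit_of (ainv (h \<circ> g)))"
    unfolding tr_def sum_distrib_left sum_distrib_right
  proof (intro sum.cong refl)
    fix g assume "g \<in> G"
    then have "g \<in> Aut" by (rule G_Aut)
    then show "unit_of h * (unit_of g * y * unit_of (ainv g)) * unit_of (ainv h) =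
        unit_of (h \<circ> g) * y * unit_of (ainv (h \<circ> g))"
      using hA by (simp add: Aut_inv_comp_distrib unit_mult [symmetric] mult.assoc)
  qed
  also have "\<dots> = tr y" unfolding tr_def
    by (rule sum.reindex_bij_witness[where i = "\<lambda>g. ainv h \<circ> g" and j = "\<lambda>g. h \<circ> g"])
      (use h hA subgroup_comp[OF G] subgroup_inv[OF G] in \<open>simp_all add: comp_assoc [symmetric]\<close>)
  finally have "unit_of h * tr y * unit_of (ainv h) * unit_of h = tr y * unit_of h" by simp
  then show ?thesis using hA by (simp add: mult.assoc)
qed

lemma tr_fixed: "y \<in> skewM \<Longrightarrow> tr y \<in> fixedM"
  unfolding fixedM_def using tr_commute conj_M by (auto simp: tr_def intro: sum_supported)

lemma tr_0 [simp]: "tr 0 = 0"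
  by (simp add: tr_def)

lemma tr_add: "tr (x + y) = tr x + tr y"
  by (simp add: tr_def distrib_left distrib_right sum.distrib)

text \<open>With \<open>tr_mult_right\<close> this makes the trace bilinear over the fixed ring.
  Commutation as hypothesis lets it apply directly to a scalar known to commute with the units of
  \<open>G\<close>.\<close>

lemma tr_mult_left:
  assumes "\<And>g. g \<in> G \<Longrightarrow> unit_of g * k = k * unit_of g" shows "tr (k * y) = k * tr y"
  unfolding tr_def sum_distrib_left
  by (intro sum.cong refl) (simp add: assms mult.assoc [symmetric])

lemma tr_mult_right:
  assumes "\<And>g. g \<in> G \<Longrightarrow> unit_of g * k = k * unit_of g" shows "tr (y * k) = tr y * k"
  unfolding tr_def sum_distrib_right
proof (intro sum.cong refl)
  fix g assume "g \<in> G"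
  then have "unit_of (ainv g) * k = k * unit_of (ainv g)" using assms subgroup_inv[OF G] by blast
  then show "unit_of g * (y * k) * unit_of (ainv g) = unit_of g * y * unit_of (ainv g) * k"
    by (simp add: mult.assoc)
qed

lemma commute_tG: "(\<And>g. g \<in> G \<Longrightarrow> unit_of g * k = k * unit_of g) \<Longrightarrow> tG * k = k * tG"
  unfolding tG_def sum_distrib_left sum_distrib_right by (intro sum.cong refl)

lemma fixedM_commute: "k \<in> fixedM \<Longrightarrow> g \<in> G \<Longrightarrow> unit_of g * k = k * unit_of g"
  and fixedM_M: "k \<in> fixedM \<Longrightarrow> k \<in> skewM"
  by (simp_all add: fixedM_def)

lemma is_subring_fixedM: "is_subring fixedM"
  unfolding is_subring_def
proof (intro conjI ballI)
  show "0 \<in> fixedM" by (simp add: fixedM_def)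
  show "1 \<in> fixedM" using is_subring_1[OF is_subring_M] by (simp add: fixedM_def)
  show "- x \<in> fixedM" if "x \<in> fixedM" for x
    using that is_subring_uminus[OF is_subring_M] by (simp add: fixedM_def)
  show "x + y \<in> fixedM" if "x \<in> fixedM" "y \<in> fixedM" for x y
    using that is_subring_add[OF is_subring_M] by (simp add: fixedM_def distrib_left distrib_right)
  show "x * y \<in> fixedM" if "x \<in> fixedM" "y \<in> fixedM" for x y
    unfolding fixedM_def
  proof (intro CollectI conjI ballI)
    show "x * y \<in> skewM" using that fixedM_M is_subring_mult[OF is_subring_M] by blast
    fix g assume g: "g \<in> G"
    have "unit_of g * (x * y) = x * unit_of g * y"
      using fixedM_commute[OF that(1) g] by (simp add: mult.assoc [symmetric])
    also have "\<dots> = x * y * unit_of g" using fixedM_commute[OF that(2) g] by (simp add: mult.assoc)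
    finally show "unit_of g * (x * y) = x * y * unit_of g" .
  qed
qed

end

text \<open>A scalar of trace one: otherwise every scalar has trace zero, and the elements \<open>w\<close> of \<open>L * G\<close> with
  \<open>w (L * G) t = 0\<close> form a two-sided ideal containing \<open>t\<close>, hence also the identity.\<close>

lemma (in galois_pair) exists_trace_one: "\<exists>c. tr (scalar c) = 1"
proof -
  \<comment> \<open>For the trivial group in place of \<open>M\<close>, \<open>absorb_tG\<close>
    says that every element of \<open>(L * G) t\<close> is a scalar multiple of
    \<open>t\<close>.\<close>
  interpret S: galois_pair G "{id}"
  proof (rule galois_pair.intro)
    show "subgroup {id} ring_aut_group" unfolding subgroup_Aut_iff by (simp add: inv_id)
    show "g \<circ> \<mu> \<circ> ainv g \<in> {id}" if "g \<in> G" "\<mu> \<in> {id}" for g \<mu>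
      using that G_Aut by simp
  qed (use G fin subgroup_id[OF G] in auto)
  have MG: "S.MG = G" by (auto simp: S.MG_def)
  note sub = is_subring_supported[OF G]
  have "\<exists>d. tr (scalar d) \<noteq> 0"
  proof (rule ccontr)
    assume "\<nexists>d. tr (scalar d) \<noteq> 0"
    then have z: "tG * scalar d * tG = 0" for d using tG_mult_tG[of "scalar d"] by simp
    have z': "tG * b * tG = 0" if b: "b \<in> supported G" for b
    proof -
      obtain b' where b': "b' \<in> supported {id}" "b * tG = b' * tG"
        using S.absorb_tG[of b] b unfolding MG by blast
      obtain d where "b' = scalar d" using b'(1) unfolding supported_id by blast
      then have "tG * b * tG = tG * scalar d * tG" using b'(2) by (simp only: mult.assoc)
      then show ?thesis using z[of d] by simp
    qed
    define J where "J = {w \<in> supported G. \<forall>b\<in>supported G. w * b * tG = 0}"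
    have add: "v + w \<in> J" if "v \<in> J" "w \<in> J" for v w
      using that is_subring_add[OF sub] by (simp add: J_def distrib_right)
    have J0: "0 \<in> J" by (simp add: J_def)
    have left: "s * w \<in> J" if "s \<in> supported G" "w \<in> J" for s w
    proof -
      have "s * w * b * tG = s * (w * b * tG)" for b by (simp add: mult.assoc)
      then show ?thesis using that is_subring_mult[OF sub] by (simp add: J_def)
    qed
    have right: "w * s \<in> J" if "s \<in> supported G" "w \<in> J" for s w
    proof -
      have "w * s * b * tG = w * (s * b) * tG" for b by (simp add: mult.assoc)
      then show ?thesis using that is_subring_mult[OF sub] by (simp add: J_def)
    qed
    have "J \<subseteq> supported G" by (auto simp: J_def)
    then have "lideal (supported G) J" "rideal (supported G) J"
      unfolding lideal_def rideal_def lmod_def rmod_def using J0 add left right by simp_all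
    moreover have "tG \<in> J" using z' S.tG_MG unfolding J_def MG by blast
    moreover have "tG \<noteq> 0" using mult_tG_eq_0[of 1] is_subring_1[OF is_subring_M] by auto
    ultimately have "1 \<in> J" by (rule supported_simple[OF G])
    then have "tG = 0" using is_subring_1[OF sub] by (auto simp: J_def)
    then show False using mult_tG_eq_0[of 1] is_subring_1[OF is_subring_M] by auto
  qed
  then obtain d where d: "tr (scalar d) \<noteq> 0" by blast
  have "tr (scalar d) \<in> supported {id}"
    using S.tr_fixed[of "scalar d"] S.scalar_M[of d] by (simp add: S.fixedM_def)
  then obtain s where s: "tr (scalar d) = scalar s" by (auto simp: supported_id)
  have s0: "s \<noteq> 0" using d s by auto
  have inv: "scalar (inverse s) * scalar s = 1" "scalar s * scalar (inverse s) = 1"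
    using s0 by (simp_all add: mon_mult)
  \<comment> \<open>The trace value \<open>s\<close> is invariant, hence so is its inverse, which
    may therefore be moved through the trace to normalise it to 1.\<close>
  have "unit_of g * scalar (inverse s) = scalar (inverse s) * unit_of g" if "g \<in> G" for g
  proof -
    have c: "unit_of g * scalar s = scalar s * unit_of g" using tr_commute[OF that, of "scalar d"] s by simp
    have "scalar (inverse s) * (unit_of g * scalar s) * scalar (inverse s) = scalar (inverse s) * unit_of g"
      using inv by (simp add: mult.assoc)
    moreover have "scalar (inverse s) * (scalar s * unit_of g) * scalar (inverse s) = unit_of g * scalar (inverse s)"
      using inv(1) by (simp only: mult.assoc [symmetric]) simp
    ultimately show ?thesis using c by simp
  qed
  then have "tr (scalar (inverse s) * scalar d) = 1"
    using tr_mult_left[of "scalar (inverse s)" "scalar d"] s inv by simp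
  then show ?thesis by (auto simp: mon_mult)
qed

context galois_pair
begin

text \<open>For \<open>0 \<noteq> x \<in> I\<close> the product \<open>x t\<close> generates \<open>L * MG\<close> as an ideal. Sandwiching the ideal between
  \<open>t c\<close> and \<open>t\<close> turns all its elements into elements of \<open>I t\<close>, and the identity into \<open>t\<close>.\<close>

lemma fixedM_simple:
  assumes I: "lideal fixedM I" "rideal fixedM I" and x: "x \<in> I" "x \<noteq> 0" shows "1 \<in> I"
proof -
  have l: "lmod fixedM I" and r: "rmod fixedM I" and sub: "I \<subseteq> fixedM" using I by (auto simp: lideal_def rideal_def)
  note T = is_subring_supported[OF subgroup_MG]
  obtain c where c: "tr (scalar c) = 1" using exists_trace_one by blast
  have cT: "scalar c \<in> supported MG" using scalar_M skewM_MG by blast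
  \<comment> \<open>The free factors \<open>a\<close> and \<open>b\<close> make \<open>J\<close>
    two-sided. The scalar \<open>c\<close> is placed so that \<open>w = a = b = 1\<close> gives
    \<open>t c t = t\<close>.\<close>
  define J where "J = {w \<in> supported MG. \<forall>a\<in>supported MG. \<forall>b\<in>supported MG.
      \<exists>i\<in>I. tG * scalar c * a * w * b * tG = i * tG}"
  have J0: "0 \<in> J" using lmod_0[OF l] by (auto simp: J_def intro!: bexI[of _ 0])
  have Jadd: "v + w \<in> J" if vw: "v \<in> J" "w \<in> J" for v w
    unfolding J_def
  proof (intro CollectI conjI ballI)
    show "v + w \<in> supported MG" using vw by (auto simp: J_def intro: supported_add)
    fix a b assume "a \<in> supported MG" "b \<in> supported MG"
    then obtain i j where "i \<in> I" "j \<in> I" "tG * scalar c * a * v * b * tG = i * tG"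
      "tG * scalar c * a * w * b * tG = j * tG" using vw unfolding J_def by blast
    then show "\<exists>i\<in>I. tG * scalar c * a * (v + w) * b * tG = i * tG"
      using lmod_add[OF l] by (intro bexI[of _ "i + j"]) (simp_all add: distrib_left distrib_right)
  qed
  have Jl: "s * w \<in> J" if "s \<in> supported MG" "w \<in> J" for s w
    unfolding J_def
  proof (intro CollectI conjI ballI)
    show "s * w \<in> supported MG" using that is_subring_mult[OF T] by (auto simp: J_def)
    fix a b assume "a \<in> supported MG" "b \<in> supported MG"
    moreover then have "a * s \<in> supported MG" using that is_subring_mult[OF T] by blast
    ultimately show "\<exists>i\<in>I. tG * scalar c * a * (s * w) * b * tG = i * tG"
      using that(2) by (auto simp: J_def mult.assoc)
  qed
  have Jr: "w * s \<in> J" if "s \<in> supported MG" and w: "w \<in> J" for s w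
    unfolding J_def
  proof (intro CollectI conjI ballI)
    show "w * s \<in> supported MG" using that is_subring_mult[OF T] by (auto simp: J_def)
    fix a b assume ab: "a \<in> supported MG" "b \<in> supported MG"
    then have "s * b \<in> supported MG" using that is_subring_mult[OF T] by blast
    then obtain i where "i \<in> I" "tG * scalar c * a * w * (s * b) * tG = i * tG"
      using w ab unfolding J_def by blast
    then show "\<exists>i\<in>I. tG * scalar c * a * (w * s) * b * tG = i * tG" by (auto simp: mult.assoc)
  qed
  have "J \<subseteq> supported MG" by (auto simp: J_def)
  then have "lideal (supported MG) J" "rideal (supported MG) J"
    unfolding lideal_def rideal_def lmod_def rmod_def using J0 Jadd Jl Jr by simp_all
  moreover have "x * tG \<in> J"
    unfolding J_def
  proof (intro CollectI conjI ballI)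
    have xK: "x \<in> fixedM" using x sub by blast
    then show "x * tG \<in> supported MG"
      using is_subring_mult[OF T] tG_MG fixedM_M skewM_MG by blast
    fix a b assume "a \<in> supported MG" "b \<in> supported MG"
    then obtain a' b' where ab: "a' \<in> skewM" "a * tG = a' * tG" "b' \<in> skewM" "b * tG = b' * tG"
      using absorb_tG by metis
    \<comment> \<open>Since \<open>x\<close> commutes with \<open>tG\<close>, a copy of
      \<open>tG\<close> can be moved to either side of it, and each factor between two copies
      becomes a trace.\<close>
    have xt: "tG * x = x * tG" using commute_tG[OF fixedM_commute[OF xK]] .
    have "tG * scalar c * a * (x * tG) * b * tG = tG * scalar c * a * (tG * x) * (b * tG)"
      by (simp add: xt mult.assoc)
    also have "\<dots> = tG * scalar c * (a * tG) * x * (b * tG)" by (simp add: mult.assoc)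
    also have "\<dots> = tG * (scalar c * a') * (tG * x) * b' * tG" by (simp add: ab mult.assoc)
    also have "\<dots> = tG * (scalar c * a') * tG * x * b' * tG" by (simp add: mult.assoc)
    also have "\<dots> = tr (scalar c * a') * (tG * x) * b' * tG" by (subst tG_mult_tG) (simp only: mult.assoc)
    also have "\<dots> = tr (scalar c * a') * x * (tG * b' * tG)" by (simp add: xt mult.assoc)
    also have "\<dots> = tr (scalar c * a') * x * tr b' * tG" by (subst tG_mult_tG) (simp only: mult.assoc)
    finally have eq: "tG * scalar c * a * (x * tG) * b * tG = tr (scalar c * a') * x * tr b' * tG" .
    have "tr (scalar c * a') \<in> fixedM" "tr b' \<in> fixedM"
      using tr_fixed ab scalar_M is_subring_mult[OF is_subring_M] by blast+
    then have "tr (scalar c * a') * x * tr b' \<in> I"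
      using lmod_mult[OF l] rmod_mult[OF r] x(1) by blast
    then show "\<exists>i\<in>I. tG * scalar c * a * (x * tG) * b * tG = i * tG" using eq by blast
  qed
  moreover have "x * tG \<noteq> 0" using mult_tG_eq_0[of x] x sub fixedM_M by blast
  ultimately have "1 \<in> J" by (rule supported_simple[OF subgroup_MG])
  then obtain i where i: "i \<in> I" "tG * scalar c * 1 * 1 * 1 * tG = i * tG"
    using is_subring_1[OF T] unfolding J_def by blast
  then have "1 * tG = i * tG" by (simp add: tG_mult_tG c)
  then have "1 = i" using mult_tG_cancel is_subring_1[OF is_subring_M] i sub fixedM_M by blast
  then show ?thesis using i by simp
qed

text \<open>\<open>I\<close> is recovered from its extension, since \<open>tr(c y) = tr(c) y = y\<close> for \<open>y\<close> in the fixed ring.\<close>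

lemma acc_lideal_fixedM: assumes "acc (lideal skewM)" shows "acc (lideal fixedM)"
proof (rule acc_transfer[OF assms, where F = "\<lambda>I. {y \<in> skewM. \<forall>a\<in>skewM. tr (a * y) \<in> I}"])
  fix I assume "lideal fixedM I"
  then have l: "lmod fixedM I" by (simp add: lideal_def)
  \<comment> \<open>This is the largest left ideal of \<open>L * M\<close> that the trace maps into
    \<open>I\<close>.\<close>
  show "lideal skewM {y \<in> skewM. \<forall>a\<in>skewM. tr (a * y) \<in> I}"
    unfolding lideal_def lmod_def
  proof (intro conjI ballI)
    fix r x assume r: "r \<in> skewM" and x: "x \<in> {y \<in> skewM. \<forall>a\<in>skewM. tr (a * y) \<in> I}"
    have "tr (a * (r * x)) \<in> I" if "a \<in> skewM" for a
    proof -
      have "tr ((a * r) * x) \<in> I" using x is_subring_mult[OF is_subring_M that r] by blast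
      then show ?thesis by (simp add: mult.assoc)
    qed
    then show "r * x \<in> {y \<in> skewM. \<forall>a\<in>skewM. tr (a * y) \<in> I}" using x r is_subring_mult[OF is_subring_M] by blast
  qed (use lmod_0[OF l] lmod_add[OF l] is_subring_add[OF is_subring_M] in \<open>auto simp: distrib_left tr_add\<close>)
next
  fix I J assume I: "lideal fixedM I" and J: "lideal fixedM J" and sub: "I \<subseteq> J"
    and eq: "{y \<in> skewM. \<forall>a\<in>skewM. tr (a * y) \<in> I} = {y \<in> skewM. \<forall>a\<in>skewM. tr (a * y) \<in> J}"
  obtain c where c: "tr (scalar c) = 1" using exists_trace_one by blast
  have "y \<in> I" if y: "y \<in> J" for y
  proof -
    have yK: "y \<in> fixedM" using y J by (auto simp: lideal_def)
    note ty = tr_mult_right[OF fixedM_commute[OF yK]]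
    have "tr (a * y) \<in> J" if "a \<in> skewM" for a
      using ty J y tr_fixed[OF that] by (auto simp: lideal_def lmod_def)
    then have "tr (scalar c * y) \<in> I" using eq y fixedM_M[OF yK] scalar_M by blast
    then show ?thesis by (simp add: ty c)
  qed
  with sub show "I = J" by blast
qed blast

text \<open>The mirror image, based on \<open>tr (y * scalar c) = y * tr (scalar c) = y\<close>. The
  right-hand condition is the one that the passage to \<open>U\<close> consumes.\<close>

lemma acc_rideal_fixedM: assumes "acc (rideal skewM)" shows "acc (rideal fixedM)"
proof (rule acc_transfer[OF assms, where F = "\<lambda>I. {y \<in> skewM. \<forall>a\<in>skewM. tr (y * a) \<in> I}"])
  fix I assume "rideal fixedM I"
  then have l: "rmod fixedM I" by (simp add: rideal_def)
  show "rideal skewM {y \<in> skewM. \<forall>a\<in>skewM. tr (y * a) \<in> I}"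
    unfolding rideal_def rmod_def
  proof (intro conjI ballI)
    fix r x assume r: "r \<in> skewM" and x: "x \<in> {y \<in> skewM. \<forall>a\<in>skewM. tr (y * a) \<in> I}"
    have "tr (x * r * a) \<in> I" if "a \<in> skewM" for a
    proof -
      have "tr (x * (r * a)) \<in> I" using x is_subring_mult[OF is_subring_M r that] by blast
      then show ?thesis by (simp add: mult.assoc)
    qed
    then show "x * r \<in> {y \<in> skewM. \<forall>a\<in>skewM. tr (y * a) \<in> I}" using x r is_subring_mult[OF is_subring_M] by blast
  qed (use rmod_0[OF l] rmod_add[OF l] is_subring_add[OF is_subring_M] in \<open>auto simp: distrib_right tr_add\<close>)
next
  fix I J assume I: "rideal fixedM I" and J: "rideal fixedM J" and sub: "I \<subseteq> J"
    and eq: "{y \<in> skewM. \<forall>a\<in>skewM. tr (y * a) \<in> I} = {y \<in> skewM. \<forall>a\<in>skewM. tr (y * a) \<in> J}"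
  obtain c where c: "tr (scalar c) = 1" using exists_trace_one by blast
  have "y \<in> I" if y: "y \<in> J" for y
  proof -
    have yK: "y \<in> fixedM" using y J by (auto simp: rideal_def)
    note ty = tr_mult_left[OF fixedM_commute[OF yK]]
    have "tr (y * a) \<in> J" if "a \<in> skewM" for a
      using ty J y tr_fixed[OF that] by (auto simp: rideal_def rmod_def)
    then have "tr (y * scalar c) \<in> I" using eq y fixedM_M[OF yK] scalar_M by blast
    then show ?thesis by (simp add: ty c)
  qed
  with sub show "I = J" by blast
qed blast

end

section \<open>Orders in a ring of fractions\<close>

text \<open>Members of \<open>D\<close> are units of \<open>K\<close> and commute with one another,
  but not necessarily with \<open>U\<close>. Commutativity provides common denominators;
  \<open>acc\<close> compensates for denominators standing on the right only.\<close>

locale ore_order =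
  fixes K U D :: "'b::ring_1 set"
  assumes K: "is_subring K" and U: "is_subring U" and UK: "U \<subseteq> K" and DU: "D \<subseteq> U" and D1: "1 \<in> D"
    and D_mult: "\<And>d e. d \<in> D \<Longrightarrow> e \<in> D \<Longrightarrow> d * e \<in> D"
    and D_comm: "\<And>d e. d \<in> D \<Longrightarrow> e \<in> D \<Longrightarrow> d * e = e * d"
    and D_inv: "\<And>d. d \<in> D \<Longrightarrow> \<exists>d'\<in>K. d * d' = 1 \<and> d' * d = 1"
    and denom: "\<And>x. x \<in> K \<Longrightarrow> \<exists>d\<in>D. x * d \<in> U"
    and acc: "acc (rideal K)"
begin

text \<open>For a right ideal \<open>I\<close> of \<open>U\<close> this is \<open>I K\<close>: any
  \<open>x\<close> in it equals \<open>x d\<close> times the inverse of \<open>d\<close>. Clearing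
  denominators replaces finite sums of products.\<close>

definition extend :: "'b set \<Rightarrow> 'b set" where
  "extend I = {x \<in> K. \<exists>d\<in>D. x * d \<in> I}"

lemma extend_mono: "I \<subseteq> J \<Longrightarrow> extend I \<subseteq> extend J"
  unfolding extend_def by blast

lemma extend_superset: "rideal U I \<Longrightarrow> I \<subseteq> extend I"
  using D1 UK unfolding extend_def rideal_def by force

lemma rideal_extend: assumes I: "rideal U I" shows "rideal K (extend I)"
  unfolding rideal_def rmod_def
proof (intro conjI ballI)
  have r: "rmod U I" using I by (simp add: rideal_def)
  show "extend I \<subseteq> K" by (auto simp: extend_def)
  show "0 \<in> extend I" using extend_superset[OF I] rmod_0[OF r] by blast
  fix x assume "x \<in> extend I"
  then obtain d where x: "x \<in> K" "d \<in> D" "x * d \<in> I" by (auto simp: extend_def)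
  show "x + y \<in> extend I" if y: "y \<in> extend I" for y
  proof -
    obtain e where e: "y \<in> K" "e \<in> D" "y * e \<in> I" using y by (auto simp: extend_def)
    \<comment> \<open>The common denominator \<open>d * e\<close> works for both summands because
      \<open>d\<close> and \<open>e\<close> commute.\<close>
    have "(x + y) * (d * e) = x * d * e + y * e * d"
      using D_comm[OF x(2) e(2)] by (simp add: distrib_right mult.assoc)
    moreover have "x * d * e \<in> I" "y * e * d \<in> I" using rmod_mult[OF r] x e DU by blast+
    ultimately have "(x + y) * (d * e) \<in> I" using rmod_add[OF r] by simp
    then show ?thesis using D_mult[OF x(2) e(2)] is_subring_add[OF K x(1) e(1)] unfolding extend_def by blast
  qed
  show "x * r \<in> extend I" if r: "r \<in> K" for r
  proof -
    obtain d' where d': "d' \<in> K" "d * d' = 1" using D_inv[OF x(2)] by blast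
    \<comment> \<open>After writing \<open>x * r = (x * d) * (d' * r)\<close>, it remains to clear
      the denominator of the second factor.\<close>
    obtain e where e: "e \<in> D" "d' * r * e \<in> U" using denom[OF is_subring_mult[OF K d'(1) r]] by blast
    have "x * r * e = x * (d * d') * r * e" using d' by simp
    also have "\<dots> = x * d * (d' * r * e)" by (simp only: mult.assoc)
    also have "\<dots> \<in> I" using rmod_mult[OF \<open>rmod U I\<close> e(2) x(3)] .
    finally show ?thesis using e(1) is_subring_mult[OF K x(1) r] unfolding extend_def by blast
  qed
qed

text \<open>An annihilator can be read off from its extension: if \<open>s * (y * d) = 0\<close>
  with \<open>d\<close> a unit of \<open>K\<close>, then \<open>s * y = 0\<close>.\<close>

lemma acc_annihilators: "acc (\<lambda>A. \<exists>S\<subseteq>U. A = {r \<in> U. \<forall>s\<in>S. s * r = 0})"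
proof (rule acc_transfer[OF acc, where F = extend])
  fix I assume "\<exists>S\<subseteq>U. I = {r \<in> U. \<forall>s\<in>S. s * r = 0}"
  then obtain S where S: "S \<subseteq> U" "I = {r \<in> U. \<forall>s\<in>S. s * r = 0}" by blast
  have "rideal U I" unfolding rideal_def rmod_def
  proof (intro conjI ballI)
    show "x * r \<in> I" if "r \<in> U" "x \<in> I" for x r
      using that is_subring_mult[OF U] by (simp add: S mult.assoc [symmetric])
  qed (use is_subring_0[OF U] is_subring_add[OF U] in \<open>auto simp: S distrib_left\<close>)
  then show "rideal K (extend I)" by (rule rideal_extend)
next
  fix I J assume "\<exists>S\<subseteq>U. I = {r \<in> U. \<forall>s\<in>S. s * r = 0}" and J: "\<exists>S\<subseteq>U. J = {r \<in> U. \<forall>s\<in>S. s * r = 0}"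
    and sub: "I \<subseteq> J" and eq: "extend I = extend J"
  then obtain S where S: "S \<subseteq> U" "I = {r \<in> U. \<forall>s\<in>S. s * r = 0}" by blast
  have "y \<in> I" if y: "y \<in> J" for y
  proof -
    have yU: "y \<in> U" using y J by blast
    have "y * 1 \<in> J" using y by simp
    then have "y \<in> extend J" using yU UK D1 unfolding extend_def by blast
    then obtain d where d: "d \<in> D" "y * d \<in> I" using eq unfolding extend_def by blast
    obtain d' where d': "d * d' = 1" using D_inv[OF d(1)] by blast
    have "s * y = 0" if s: "s \<in> S" for s
    proof -
      have "s * y = s * (y * d) * d'" using d' by (simp add: mult.assoc)
      also have "s * (y * d) = 0" using d(2) s S(2) by blast
      finally show ?thesis by simp
    qed
    then show ?thesis using yU S(2) by blast
  qed
  with sub show "I = J" by blast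
qed (rule extend_mono)

text \<open>The extensions of the partial sums \<open>T n\<close> become stationary. A nonzero
  element of the next right ideal then lies in \<open>T N\<close> after multiplication by a
  denominator, which is a nontrivial relation.\<close>

lemma no_infinite_direct_sum:
  assumes I: "\<And>n :: nat. rideal U (I n)" "\<And>n. I n \<noteq> {0}"
  shows "\<exists>n x. (\<forall>i<n. x i \<in> I i) \<and> (\<Sum>i<n. x i) = 0 \<and> (\<exists>i<n. x i \<noteq> 0)"
proof -
  have r: "rmod U (I n)" and IU: "I n \<subseteq> U" for n using I(1) by (auto simp: rideal_def)
  define T where "T n = {\<Sum>i<n. x i |x. \<forall>i<n. x i \<in> I i}" for n
  have sumU: "(\<Sum>i<n. x i) \<in> U" if "\<forall>i<n. x i \<in> I i" for n and x :: "nat \<Rightarrow> 'b"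
    using that IU by (induction n) (auto intro!: is_subring_0[OF U] is_subring_add[OF U])
  have ridT: "rideal U (T n)" for n
    unfolding rideal_def rmod_def
  proof (intro conjI ballI subsetI)
    show "v \<in> U" if "v \<in> T n" for v using that sumU unfolding T_def by blast
    have "\<forall>i<n. (0 :: 'b) \<in> I i" using rmod_0[OF r] by blast
    moreover have "0 = (\<Sum>i<n. 0 :: 'b)" by simp
    ultimately show "0 \<in> T n" unfolding T_def by blast
    show "v + w \<in> T n" if vw: "v \<in> T n" "w \<in> T n" for v w
    proof -
      obtain x y where "v = (\<Sum>i<n. x i)" "w = (\<Sum>i<n. y i)" and xy: "\<forall>i<n. x i \<in> I i" "\<forall>i<n. y i \<in> I i"
        using vw unfolding T_def by blast
      then have "v + w = (\<Sum>i<n. x i + y i)" by (simp add: sum.distrib)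
      moreover have "\<forall>i<n. x i + y i \<in> I i" using xy rmod_add[OF r] by blast
      ultimately show ?thesis unfolding T_def by blast
    qed
    show "v * s \<in> T n" if s: "s \<in> U" and v: "v \<in> T n" for s v
    proof -
      obtain x where "v = (\<Sum>i<n. x i)" and x: "\<forall>i<n. x i \<in> I i" using v unfolding T_def by blast
      then have "v * s = (\<Sum>i<n. x i * s)" by (simp add: sum_distrib_right)
      moreover have "\<forall>i<n. x i * s \<in> I i" using x s rmod_mult[OF r] by blast
      ultimately show ?thesis unfolding T_def by blast
    qed
  qed
  have T_Suc: "v + y \<in> T (Suc n)" if v: "v \<in> T n" and y: "y \<in> I n" for v y n
  proof -
    obtain x where x: "v = (\<Sum>i<n. x i)" "\<forall>i<n. x i \<in> I i" using v unfolding T_def by blast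
    have "v + y = (\<Sum>i<Suc n. (x(n := y)) i)" using x(1) by simp
    moreover have "\<forall>i<Suc n. (x(n := y)) i \<in> I i" using x(2) y by (simp add: less_Suc_eq)
    ultimately show ?thesis unfolding T_def by blast
  qed
  have "T n \<subseteq> T (Suc n)" for n using T_Suc[of _ n 0] rmod_0[OF r] by auto
  then obtain N where N: "\<forall>m\<ge>N. extend (T m) = extend (T N)"
    using accD[OF acc, of "\<lambda>n. extend (T n)", OF rideal_extend[OF ridT] extend_mono] by blast
  obtain y where y: "y \<in> I N" "y \<noteq> 0" using I(2)[of N] rmod_0[OF r, of N] by blast
  have "0 \<in> T N" using ridT[of N] unfolding rideal_def rmod_def by blast
  then have "0 + y \<in> T (Suc N)" using y(1) by (rule T_Suc)
  then have "y \<in> extend (T (Suc N))" using extend_superset[OF ridT[of "Suc N"]] by auto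
  moreover have "extend (T (Suc N)) = extend (T N)" using N by (blast intro: le_SucI)
  ultimately obtain d where d: "d \<in> D" "y * d \<in> T N" by (auto simp: extend_def)
  then obtain x where x: "y * d = (\<Sum>i<N. x i)" "\<forall>i<N. x i \<in> I i" unfolding T_def by blast
  \<comment> \<open>The relation is completed by the last summand \<open>- (y * d)\<close>, nonzero
    because \<open>d\<close> is a unit of \<open>K\<close>.\<close>
  let ?x = "x(N := - (y * d))"
  have "y * d \<in> I N" using rmod_mult[OF r] y d DU by blast
  then have "- (y * d) \<in> I N" by (rule rmod_uminus[OF U r])
  then have "\<forall>i<Suc N. ?x i \<in> I i" using x(2) by (simp add: less_Suc_eq)
  moreover have "(\<Sum>i<Suc N. ?x i) = 0" using x(1) by simp
  moreover have "?x N \<noteq> 0"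
  proof
    assume "?x N = 0"
    then have z: "y * d = 0" by simp
    obtain d' where "d * d' = 1" using D_inv[OF d(1)] by blast
    then have "y = y * d * d'" by (simp add: mult.assoc)
    with z y(2) show False by simp
  qed
  ultimately show ?thesis by blast
qed

text \<open>For an ideal \<open>J\<close> of \<open>U\<close> the chain of the right ideals \<open>s\<^sup>-\<^sup>n J K\<close> becomes stationary, hence
  \<open>s\<^sup>-\<^sup>1 J K \<subseteq> J K\<close>, and \<open>J K\<close> is an ideal of \<open>K\<close>.\<close>

lemma lideal_extend:
  assumes J: "lideal U J" "rideal U J" shows "lideal K (extend J)"
proof -
  have l: "lmod U J" using J by (simp add: lideal_def)
  note rE = rideal_extend[OF J(2)]
  have rE': "rmod K (extend J)" and EK: "extend J \<subseteq> K" using rE by (auto simp: rideal_def)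
  have uE: "u * y \<in> extend J" if u: "u \<in> U" and y: "y \<in> extend J" for u y
  proof -
    obtain d where d: "y \<in> K" "d \<in> D" "y * d \<in> J" using y by (auto simp: extend_def)
    have "u * y * d \<in> J" using lmod_mult[OF l u d(3)] by (simp add: mult.assoc)
    then show ?thesis using d u UK is_subring_mult[OF K] unfolding extend_def by blast
  qed
  have inv: "t * y \<in> extend J" if s: "s \<in> D" and t: "t \<in> K" "s * t = 1" "t * s = 1" and y: "y \<in> extend J" for s t y
  proof -
    have sK: "s ^ n \<in> K" and tK: "t ^ n \<in> K" for n
      using s t DU UK is_subring_1[OF K] is_subring_mult[OF K] by (induction n) auto
    have st: "s ^ n * t ^ n = 1" for n
    proof (induction n)
      case (Suc n)
      have "s ^ Suc n * t ^ Suc n = s ^ n * (s * t) * t ^ n"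
        unfolding power_Suc2[of s] power_Suc[of t] by (simp only: mult.assoc)
      then show ?case using Suc t by simp
    qed simp
    define C where "C n = {x \<in> K. s ^ n * x \<in> extend J}" for n
    have "rideal K (C n)" for n
      unfolding rideal_def rmod_def C_def
      using is_subring_0[OF K] rmod_0[OF rE'] is_subring_add[OF K] rmod_add[OF rE'] is_subring_mult[OF K] rmod_mult[OF rE']
      by (simp add: distrib_left mult.assoc [symmetric] subset_iff)
    moreover have "C n \<subseteq> C (Suc n)" for n
    proof
      fix x assume "x \<in> C n"
      then have "x \<in> K" "s * (s ^ n * x) \<in> extend J" using uE[of s] s DU by (auto simp: C_def)
      then show "x \<in> C (Suc n)" by (simp add: C_def mult.assoc)
    qed
    ultimately obtain N where "\<forall>m\<ge>N. C m = C N" using accD[OF acc, of C] by blast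
    then have N: "C (Suc N) = C N" by (blast intro: le_SucI)
    \<comment> \<open>\<open>t ^ Suc N * y\<close> lies in \<open>C (Suc N)\<close>, hence in
      \<open>C N\<close>; multiplying by only \<open>s ^ N\<close> leaves exactly one factor
      \<open>t\<close>.\<close>
    have "s ^ Suc N * (t ^ Suc N * y) = s ^ Suc N * t ^ Suc N * y" by (simp only: mult.assoc)
    also have "\<dots> = y" by (simp only: st mult_1_left)
    finally have "t ^ Suc N * y \<in> C (Suc N)" using y EK tK[of "Suc N"] is_subring_mult[OF K] by (auto simp: C_def)
    then have "s ^ N * (t ^ Suc N * y) \<in> extend J" unfolding N by (simp add: C_def)
    moreover have "s ^ N * (t ^ Suc N * y) = s ^ N * t ^ N * (t * y)"
      unfolding power_Suc2 by (simp only: mult.assoc)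
    ultimately show ?thesis by (simp add: st)
  qed
  have "r * y \<in> extend J" if r: "r \<in> K" and y: "y \<in> extend J" for r y
  proof -
    obtain d where d: "d \<in> D" "r * d \<in> U" using denom[OF r] by blast
    obtain t where t: "t \<in> K" "d * t = 1" "t * d = 1" using D_inv[OF d(1)] by blast
    have "r * y = r * d * (t * y)" using t(2) by (simp add: mult.assoc) (simp add: mult.assoc [symmetric])
    also have "\<dots> \<in> extend J" using uE[OF d(2) inv[OF d(1) t y]] .
    finally show ?thesis .
  qed
  then show ?thesis using EK rE' unfolding lideal_def lmod_def rmod_def by blast
qed

text \<open>The extension of \<open>J\<close> contains 1, so \<open>J\<close> itself contains a
  denominator, which is a unit of \<open>K\<close> and cannot be killed by a nonzero
  \<open>i\<close>.\<close>

lemma prime_order: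
  assumes simple: "\<And>I x. lideal K I \<Longrightarrow> rideal K I \<Longrightarrow> x \<in> I \<Longrightarrow> x \<noteq> 0 \<Longrightarrow> 1 \<in> I"
    and J: "lideal U J" "rideal U J" and y: "y \<in> J" "y \<noteq> 0"
    and prod: "\<And>j. j \<in> J \<Longrightarrow> i * j = 0"
  shows "i = 0"
proof -
  have "y \<in> extend J" using extend_superset[OF J(2)] y(1) by blast
  then have "1 \<in> extend J" using simple[OF lideal_extend[OF J] rideal_extend[OF J(2)]] y(2) by blast
  then obtain d where d: "d \<in> D" "d \<in> J" by (auto simp: extend_def)
  obtain d' where "d * d' = 1" using D_inv[OF d(1)] by blast
  then have "i = i * d * d'" by (simp add: mult.assoc)
  then show ?thesis using prod[OF d(2)] by simp
qed

end

section \<open>Transfer to ring records\<close>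

text \<open>A bridge between record rings and subrings of a type of class \<open>ring_1\<close>. As
  \<open>\<phi>\<close> is injective on the whole type, preimages of ideals of \<open>R\<close> lie
  in \<open>B\<close> and determine those ideals.\<close>

locale ring_copy =
  fixes \<phi> :: "'b::ring_1 \<Rightarrow> 'c" and R :: "'c ring" and B :: "'b set"
  assumes inj: "inj \<phi>" and carrier: "carrier R = \<phi> ` B" and B: "is_subring B"
    and add: "\<And>x y. \<phi> (x + y) = \<phi> x \<oplus>\<^bsub>R\<^esub> \<phi> y" and mult: "\<And>x y. \<phi> (x * y) = \<phi> x \<otimes>\<^bsub>R\<^esub> \<phi> y"
    and one: "\<phi> 1 = \<one>\<^bsub>R\<^esub>" and zero: "\<phi> 0 = \<zero>\<^bsub>R\<^esub>"
begin

lemma phi_eq [simp]: "\<phi> x = \<phi> y \<longleftrightarrow> x = y"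
  using inj by (rule inj_eq)

lemmas is_subring_props = is_subring_0[OF B] is_subring_1[OF B] is_subring_add[OF B] is_subring_mult[OF B] is_subring_uminus[OF B]

lemma carrierE:
  assumes "x \<in> carrier R" obtains b where "x = \<phi> b" "b \<in> B"
  using assms unfolding carrier by blast

lemma phi_carrier [simp]: "\<phi> b \<in> carrier R \<longleftrightarrow> b \<in> B"
  unfolding carrier by auto

lemmas phi_ops = add [symmetric] mult [symmetric] one [symmetric] zero [symmetric]

lemma ring: "ring R"
proof (rule ringI)
  show "abelian_group R"
  proof (rule abelian_groupI)
    fix x y z assume "x \<in> carrier R" "y \<in> carrier R" "z \<in> carrier R"
    then obtain a b c where "x = \<phi> a" "y = \<phi> b" "z = \<phi> c" by (metis carrierE)
    then show "x \<oplus>\<^bsub>R\<^esub> y \<oplus>\<^bsub>R\<^esub> z = x \<oplus>\<^bsub>R\<^esub> (y \<oplus>\<^bsub>R\<^esub> z)" by (simp add: phi_ops add.assoc)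
  next
    fix x y assume "x \<in> carrier R" "y \<in> carrier R"
    then obtain a b where "x = \<phi> a" "y = \<phi> b" "a \<in> B" "b \<in> B" by (metis carrierE)
    then show "x \<oplus>\<^bsub>R\<^esub> y = y \<oplus>\<^bsub>R\<^esub> x" "x \<oplus>\<^bsub>R\<^esub> y \<in> carrier R"
      by (simp_all add: phi_ops add.commute is_subring_props)
  next
    show "\<zero>\<^bsub>R\<^esub> \<in> carrier R" by (simp add: phi_ops is_subring_props)
    fix x assume "x \<in> carrier R"
    then obtain b where b: "x = \<phi> b" "b \<in> B" by (rule carrierE)
    then show "\<zero>\<^bsub>R\<^esub> \<oplus>\<^bsub>R\<^esub> x = x" by (simp add: phi_ops)
    have "\<phi> (- b) \<oplus>\<^bsub>R\<^esub> x = \<zero>\<^bsub>R\<^esub>" unfolding b(1) phi_ops by simp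
    then show "\<exists>y\<in>carrier R. y \<oplus>\<^bsub>R\<^esub> x = \<zero>\<^bsub>R\<^esub>"
      by (rule bexI) (simp add: is_subring_props b)
  qed
  show "monoid R"
  proof (rule monoidI)
    fix x y z assume "x \<in> carrier R" "y \<in> carrier R" "z \<in> carrier R"
    then obtain a b c where "x = \<phi> a" "y = \<phi> b" "z = \<phi> c" by (metis carrierE)
    then show "x \<otimes>\<^bsub>R\<^esub> y \<otimes>\<^bsub>R\<^esub> z = x \<otimes>\<^bsub>R\<^esub> (y \<otimes>\<^bsub>R\<^esub> z)" by (simp add: phi_ops mult.assoc)
  next
    fix x y assume "x \<in> carrier R" "y \<in> carrier R"
    then obtain a b where "x = \<phi> a" "y = \<phi> b" "a \<in> B" "b \<in> B" by (metis carrierE)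
    then show "x \<otimes>\<^bsub>R\<^esub> y \<in> carrier R" by (simp add: phi_ops is_subring_props)
  next
    show "\<one>\<^bsub>R\<^esub> \<in> carrier R" by (simp add: phi_ops is_subring_props)
    fix x assume "x \<in> carrier R"
    then obtain b where "x = \<phi> b" by (rule carrierE)
    then show "\<one>\<^bsub>R\<^esub> \<otimes>\<^bsub>R\<^esub> x = x" "x \<otimes>\<^bsub>R\<^esub> \<one>\<^bsub>R\<^esub> = x" by (simp_all add: phi_ops)
  qed
next
  fix x y z assume "x \<in> carrier R" "y \<in> carrier R" "z \<in> carrier R"
  then obtain a b c where "x = \<phi> a" "y = \<phi> b" "z = \<phi> c" by (metis carrierE)
  then show "(x \<oplus>\<^bsub>R\<^esub> y) \<otimes>\<^bsub>R\<^esub> z = x \<otimes>\<^bsub>R\<^esub> z \<oplus>\<^bsub>R\<^esub> y \<otimes>\<^bsub>R\<^esub> z"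
    "z \<otimes>\<^bsub>R\<^esub> (x \<oplus>\<^bsub>R\<^esub> y) = z \<otimes>\<^bsub>R\<^esub> x \<oplus>\<^bsub>R\<^esub> z \<otimes>\<^bsub>R\<^esub> y"
    by (simp_all add: phi_ops distrib_left distrib_right)
qed

lemma subgroup_preimage:
  assumes I: "subgroup I (add_monoid R)"
  shows "I = \<phi> ` (\<phi> -` I)" "\<phi> -` I \<subseteq> B" "0 \<in> \<phi> -` I"
    "\<And>x y. x \<in> \<phi> -` I \<Longrightarrow> y \<in> \<phi> -` I \<Longrightarrow> x + y \<in> \<phi> -` I"
proof -
  have sub: "I \<subseteq> \<phi> ` B" using subgroup.subset[OF I] carrier by simp
  then show "I = \<phi> ` (\<phi> -` I)" by blast
  show "\<phi> -` I \<subseteq> B"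
  proof
    fix x assume "x \<in> \<phi> -` I"
    then have "\<phi> x \<in> \<phi> ` B" using sub by blast
    then show "x \<in> B" by auto
  qed
  show "0 \<in> \<phi> -` I" using subgroup.one_closed[OF I] by (simp add: zero)
  show "x + y \<in> \<phi> -` I" if "x \<in> \<phi> -` I" "y \<in> \<phi> -` I" for x y
    using subgroup.m_closed[OF I, of "\<phi> x" "\<phi> y"] that by (simp add: add)
qed

lemma rideal_preimage: assumes "right_ideal I R" shows "rideal B (\<phi> -` I)"
proof -
  have I: "subgroup I (add_monoid R)" and m: "\<And>x r. x \<in> I \<Longrightarrow> r \<in> carrier R \<Longrightarrow> x \<otimes>\<^bsub>R\<^esub> r \<in> I"
    using assms by (auto simp: right_ideal_def)
  have "x * r \<in> \<phi> -` I" if "r \<in> B" "x \<in> \<phi> -` I" for x r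
    using that m[of "\<phi> x" "\<phi> r"] by (simp add: mult carrier)
  then show ?thesis unfolding rideal_def rmod_def using subgroup_preimage[OF I] by simp
qed

lemma lideal_preimage: assumes "left_ideal I R" shows "lideal B (\<phi> -` I)"
proof -
  have I: "subgroup I (add_monoid R)" and m: "\<And>x r. x \<in> I \<Longrightarrow> r \<in> carrier R \<Longrightarrow> r \<otimes>\<^bsub>R\<^esub> x \<in> I"
    using assms by (auto simp: left_ideal_def)
  have "r * x \<in> \<phi> -` I" if "r \<in> B" "x \<in> \<phi> -` I" for x r
    using that m[of "\<phi> x" "\<phi> r"] by (simp add: mult carrier)
  then show ?thesis unfolding lideal_def lmod_def using subgroup_preimage[OF I] by simp
qed

lemma ideal_preimage:
  assumes "ideal I R" shows "lideal B (\<phi> -` I)" "rideal B (\<phi> -` I)" "I = \<phi> ` (\<phi> -` I)"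
proof -
  have I: "subgroup I (add_monoid R)"
    by (rule additive_subgroup.a_subgroup[OF ideal.axioms(1)[OF assms]])
  show "I = \<phi> ` (\<phi> -` I)" using subgroup_preimage(1)[OF I] .
  show "lideal B (\<phi> -` I)"
    using I ideal.I_l_closed[OF assms] by (intro lideal_preimage) (simp add: left_ideal_def)
  show "rideal B (\<phi> -` I)"
    using I ideal.I_r_closed[OF assms] by (intro rideal_preimage) (simp add: right_ideal_def)
qed

lemma image_zero: "\<phi> ` {0} = {\<zero>\<^bsub>R\<^esub>}"
  by (simp add: zero)

lemma carrier_nontrivial: "carrier R \<noteq> {\<zero>\<^bsub>R\<^esub>}"
proof
  assume e: "carrier R = {\<zero>\<^bsub>R\<^esub>}"
  have "\<phi> 1 \<in> carrier R" by (simp add: is_subring_props)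
  then have "\<phi> 1 = \<phi> 0" unfolding e zero by simp
  then show False by simp
qed

lemma simple_ring:
  assumes "\<And>I x. lideal B I \<Longrightarrow> rideal B I \<Longrightarrow> x \<in> I \<Longrightarrow> x \<noteq> 0 \<Longrightarrow> 1 \<in> I"
  shows "simple_ring R"
  unfolding simple_ring_def
proof (intro conjI allI impI ring carrier_nontrivial)
  fix I assume I: "ideal I R"
  note P = ideal_preimage[OF I]
  show "I = {\<zero>\<^bsub>R\<^esub>} \<or> I = carrier R"
  proof (cases "\<phi> -` I = {0}")
    case True then show ?thesis using P(3) image_zero by simp
  next
    case False
    moreover have "0 \<in> \<phi> -` I" using P(1) by (simp add: lideal_def lmod_def)
    ultimately obtain x where "x \<in> \<phi> -` I" "x \<noteq> 0" by blast
    then have "1 \<in> \<phi> -` I" using assms P by blast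
    then have "r * 1 \<in> \<phi> -` I" if "r \<in> B" for r
      using P(1) that unfolding lideal_def lmod_def by blast
    then have "B \<subseteq> \<phi> -` I" by auto
    then have "\<phi> -` I = B" using P(1) by (auto simp: lideal_def)
    then show ?thesis using P(3) carrier by simp
  qed
qed

text \<open>The product ideal contains all products of elements, so it suffices that a nonzero ideal
  has zero left annihilator.\<close>

lemma prime_ring:
  assumes "\<And>J i y. lideal B J \<Longrightarrow> rideal B J \<Longrightarrow> y \<in> J \<Longrightarrow> y \<noteq> 0 \<Longrightarrow> (\<And>j. j \<in> J \<Longrightarrow> i * j = 0) \<Longrightarrow> i = 0"
  shows "prime_ring R"
  unfolding prime_ring_def
proof (intro conjI allI impI ring carrier_nontrivial)
  fix I J assume "ideal I R \<and> ideal J R \<and> I \<cdot>\<^bsub>R\<^esub> J = {\<zero>\<^bsub>R\<^esub>}"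
  then have I: "ideal I R" and J: "ideal J R" and prod: "I \<cdot>\<^bsub>R\<^esub> J = {\<zero>\<^bsub>R\<^esub>}" by auto
  note PI = ideal_preimage[OF I] and PJ = ideal_preimage[OF J]
  have z: "i * j = 0" if "i \<in> \<phi> -` I" "j \<in> \<phi> -` J" for i j
  proof -
    have "\<phi> i \<otimes>\<^bsub>R\<^esub> \<phi> j \<in> I \<cdot>\<^bsub>R\<^esub> J" by (rule ideal_prod.prod) (use that in auto)
    then have "\<phi> (i * j) = \<phi> 0" using prod by (simp add: mult zero)
    then show ?thesis by simp
  qed
  show "I = {\<zero>\<^bsub>R\<^esub>} \<or> J = {\<zero>\<^bsub>R\<^esub>}"
  proof (cases "\<phi> -` J = {0}")
    case True then show ?thesis using PJ(3) image_zero by simp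
  next
    case False
    have 0: "0 \<in> \<phi> -` I" "0 \<in> \<phi> -` J" using PI(1) PJ(1) by (simp_all add: lideal_def lmod_def)
    then obtain y where "y \<in> \<phi> -` J" "y \<noteq> 0" using False by blast
    then have "i = 0" if "i \<in> \<phi> -` I" for i using assms[OF PJ(1,2)] z that by blast
    then have "\<phi> -` I = {0}" using 0 by blast
    then show ?thesis using PI(3) image_zero by simp
  qed
qed

lemma lr_noetherian:
  assumes "acc (lideal B)" "acc (rideal B)" shows "lr_noetherian R"
  unfolding lr_noetherian_def
proof (intro conjI ring)
  show "acc (\<lambda>I. left_ideal I R)"
  proof (rule acc_transfer[OF assms(1), where F = "\<lambda>I. \<phi> -` I"])
    fix I J assume "left_ideal I R" "left_ideal J R" and eq: "\<phi> -` I = \<phi> -` J"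
    then have "I = \<phi> ` (\<phi> -` I)" "J = \<phi> ` (\<phi> -` J)"
      using subgroup_preimage(1) unfolding left_ideal_def by blast+
    then show "I = J" using eq by simp
  qed (use lideal_preimage in auto)
  show "acc (\<lambda>I. right_ideal I R)"
  proof (rule acc_transfer[OF assms(2), where F = "\<lambda>I. \<phi> -` I"])
    fix I J assume "right_ideal I R" "right_ideal J R" and eq: "\<phi> -` I = \<phi> -` J"
    then have "I = \<phi> ` (\<phi> -` I)" "J = \<phi> ` (\<phi> -` J)"
      using subgroup_preimage(1) unfolding right_ideal_def by blast+
    then show "I = J" using eq by simp
  qed (use rideal_preimage in auto)
qed

lemma finsum_image:
  assumes "\<forall>i<n. x i \<in> B" shows "(\<Oplus>\<^bsub>R\<^esub>i\<in>{..<n :: nat}. \<phi> (x i)) = \<phi> (\<Sum>i<n. x i)"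
  using assms
proof (induction n)
  interpret R: ring R by (rule ring)
  case 0 show ?case by (simp add: zero)
next
  interpret R: ring R by (rule ring)
  case (Suc n)
  have "(\<Oplus>\<^bsub>R\<^esub>i\<in>insert n {..<n}. \<phi> (x i)) = \<phi> (x n) \<oplus>\<^bsub>R\<^esub> (\<Oplus>\<^bsub>R\<^esub>i\<in>{..<n}. \<phi> (x i))"
    by (rule R.finsum_insert) (use Suc.prems carrier in auto)
  then show ?case using Suc by (simp add: lessThan_Suc add [symmetric] add.commute)
qed

lemma right_goldie:
  assumes dir: "\<And>I. (\<And>n :: nat. rideal B (I n)) \<Longrightarrow> (\<And>n. I n \<noteq> {0}) \<Longrightarrow>
      \<exists>n x. (\<forall>i<n. x i \<in> I i) \<and> (\<Sum>i<n. x i) = 0 \<and> (\<exists>i<n. x i \<noteq> 0)"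
    and ann: "acc (\<lambda>A. \<exists>S\<subseteq>B. A = {r \<in> B. \<forall>s\<in>S. s * r = 0})"
  shows "right_goldie R"
  unfolding right_goldie_def
proof (intro conjI ring)
  show "finite_right_udim R"
    unfolding finite_right_udim_def
  proof
    assume "\<exists>I :: nat \<Rightarrow> 'c set. (\<forall>n. right_ideal (I n) R \<and> I n \<noteq> {\<zero>\<^bsub>R\<^esub>}) \<and>
      (\<forall>n x. (\<forall>i<n. x i \<in> I i) \<and> (\<Oplus>\<^bsub>R\<^esub>i\<in>{..<n}. x i) = \<zero>\<^bsub>R\<^esub> \<longrightarrow> (\<forall>i<n. x i = \<zero>\<^bsub>R\<^esub>))"
    then obtain I :: "nat \<Rightarrow> 'c set" where I: "\<And>n. right_ideal (I n) R" "\<And>n. I n \<noteq> {\<zero>\<^bsub>R\<^esub>}"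
      and ind: "\<And>n x. (\<forall>i<n. x i \<in> I i) \<Longrightarrow> (\<Oplus>\<^bsub>R\<^esub>i\<in>{..<n}. x i) = \<zero>\<^bsub>R\<^esub> \<Longrightarrow> (\<forall>i<n. x i = \<zero>\<^bsub>R\<^esub>)" by blast
    have r: "rideal B (\<phi> -` I n)" for n by (rule rideal_preimage[OF I(1)])
    have ne: "\<phi> -` I n \<noteq> {0}" for n
    proof
      assume e: "\<phi> -` I n = {0}"
      have "I n = \<phi> ` (\<phi> -` I n)" using subgroup_preimage(1) I(1) unfolding right_ideal_def by blast
      then show False using I(2)[of n] unfolding e image_zero by blast
    qed
    obtain n x where x: "\<forall>i<n. x i \<in> \<phi> -` I i" "(\<Sum>i<n. x i) = 0" "\<exists>i<n. x i \<noteq> 0"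
      using dir[of "\<lambda>n. \<phi> -` I n", OF r ne] by blast
    have "\<forall>i<n. x i \<in> B" using x(1) r by (auto simp: rideal_def)
    then have "(\<Oplus>\<^bsub>R\<^esub>i\<in>{..<n}. \<phi> (x i)) = \<zero>\<^bsub>R\<^esub>" using finsum_image[of n x] x(2) by (simp add: zero)
    then have "\<forall>i<n. \<phi> (x i) = \<phi> 0" using ind[of n "\<lambda>i. \<phi> (x i)"] x(1) by (simp add: zero)
    then show False using x(3) by auto
  qed
  show "acc (\<lambda>A. \<exists>S\<subseteq>carrier R. A = right_annihilator R S)"
  proof (rule acc_transfer[OF ann, where F = "\<lambda>I. \<phi> -` I"])
    fix A assume "\<exists>S\<subseteq>carrier R. A = right_annihilator R S"
    then obtain S where S: "S \<subseteq> carrier R" "A = right_annihilator R S" by blast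
    have SB: "\<phi> -` S \<subseteq> B" and Seq: "S = \<phi> ` (\<phi> -` S)" using S(1) carrier by auto
    have "\<phi> r \<in> A \<longleftrightarrow> r \<in> B \<and> (\<forall>s\<in>\<phi> -` S. s * r = 0)" for r
    proof -
      have "\<phi> r \<in> A \<longleftrightarrow> r \<in> B \<and> (\<forall>s\<in>\<phi> ` (\<phi> -` S). s \<otimes>\<^bsub>R\<^esub> \<phi> r = \<zero>\<^bsub>R\<^esub>)"
        unfolding S(2) right_annihilator_def Seq [symmetric] using carrier by auto
      also have "\<dots> \<longleftrightarrow> r \<in> B \<and> (\<forall>s\<in>\<phi> -` S. \<phi> (s * r) = \<phi> 0)"
        by (simp only: ball_simps mult zero)
      finally show ?thesis by simp
    qed
    then have "\<phi> -` A = {r \<in> B. \<forall>s\<in>\<phi> -` S. s * r = 0}" by auto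
    then show "\<exists>S\<subseteq>B. \<phi> -` A = {r \<in> B. \<forall>s\<in>S. s * r = 0}" using SB by blast
  next
    fix I J assume "\<exists>S\<subseteq>carrier R. I = right_annihilator R S" "\<exists>S\<subseteq>carrier R. J = right_annihilator R S"
      and eq: "\<phi> -` I = \<phi> -` J"
    then have "I \<subseteq> \<phi> ` B" "J \<subseteq> \<phi> ` B" by (auto simp: right_annihilator_def carrier)
    then have "I = \<phi> ` (\<phi> -` I)" "J = \<phi> ` (\<phi> -` J)" by blast+
    then show "I = J" using eq by simp
  qed blast
qed

end

section \<open>Polycyclic-by-finite groups\<close>

lemma conj_supported:
  assumes g: "g \<in> Aut" and c: "\<And>\<nu>. \<nu> \<in> N \<Longrightarrow> g \<circ> \<nu> \<circ> ainv g \<in> N" and y: "y \<in> supported N"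
  shows "unit_of g * y * unit_of (ainv g) \<in> supported N"
  using y
proof (induction y rule: supported_induct)
  case (mon a \<mu>)
  then show ?case using c[OF mon(1)] g
    by (simp add: mon_mult frac_ext_one supported_mon)
qed (simp_all add: distrib_left distrib_right supported_add)

text \<open>The unit of \<open>h k\<close> is invertible and conjugation by it, in both directions,
  preserves \<open>supported N\<close>; the exchanged coefficients are these conjugates.\<close>

lemma normalizing_supported:
  assumes N: "subgroup N ring_aut_group" and h: "\<And>k. h k \<in> Aut"
    and c: "\<And>k \<nu>. \<nu> \<in> N \<Longrightarrow> h k \<circ> \<nu> \<circ> ainv (h k) \<in> N"
    and c': "\<And>k \<nu>. \<nu> \<in> N \<Longrightarrow> ainv (h k) \<circ> \<nu> \<circ> h k \<in> N"
  shows "normalizing (supported N) (\<lambda>k. unit_of (h k))"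
proof
  show "is_subring (supported N)" by (rule is_subring_supported[OF N])
  fix k r assume r: "r \<in> supported N"
  have "unit_of (ainv (h k)) * r * unit_of (ainv (ainv (h k))) \<in> supported N"
    by (rule conj_supported[OF _ _ r]) (use h c' in simp_all)
  moreover have "r * unit_of (h k) = unit_of (h k) * (unit_of (ainv (h k)) * r * unit_of (ainv (ainv (h k))))"
    using h by (simp add: mult.assoc [symmetric])
  ultimately show "\<exists>r'\<in>supported N. r * unit_of (h k) = unit_of (h k) * r'" by blast
  have "unit_of (h k) * r = (unit_of (h k) * r * unit_of (ainv (h k))) * unit_of (h k)"
    using h by (simp add: mult.assoc)
  then show "\<exists>r'\<in>supported N. unit_of (h k) * r = r' * unit_of (h k)"
    using conj_supported[OF h c r] by blast
qed

lemma unit_power: "x \<in> Aut \<Longrightarrow> unit_of x ^ k = unit_of (x ^^ k) \<and> x ^^ k \<in> Aut"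
proof (induction k)
  case 0 then show ?case by (simp add: id_def [symmetric])
next
  case (Suc k)
  then show ?case using unit_mult[of x "x ^^ k"] Aut_comp[of x "x ^^ k"] by (simp add: o_def)
qed

lemma funpow_subgroup:
  assumes "subgroup N ring_aut_group" "x \<in> N" shows "x ^^ k \<in> N"
proof (induction k)
  case 0 then show ?case using subgroup_id[OF assms(1)] by (simp add: id_def)
next
  case (Suc k) then show ?case using subgroup_comp[OF assms Suc] by (simp add: o_def)
qed

section \<open>One step of the subnormal series\<close>

context
  fixes N N' :: "('a::idom \<Rightarrow> 'a) set"
  assumes N: "subgroup N ring_aut_group" and N': "subgroup N' ring_aut_group" and sub: "N \<subseteq> N'"
    and nor: "\<And>g \<nu>. g \<in> N' \<Longrightarrow> \<nu> \<in> N \<Longrightarrow> g \<circ> \<nu> \<circ> ainv g \<in> N"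
    and acc: "acc (lideal (supported N))"
begin

lemma nor': "g \<in> N' \<Longrightarrow> \<nu> \<in> N \<Longrightarrow> ainv g \<circ> \<nu> \<circ> g \<in> N"
  using nor[OF subgroup_inv[OF N'], of g \<nu>] subgroup_Aut[OF N', of g] by simp

text \<open>Moving the coefficient to the right of \<open>h\<close> twists it by the inverse of
  \<open>h\<close>.\<close>

lemma mon_factor:
  assumes "h \<in> Aut" "\<nu> \<in> N" shows "\<exists>s\<in>supported N. mon a (h \<circ> \<nu>) = unit_of h * s"
proof
  show "mon (frac_ext (ainv h) a) \<nu> \<in> supported N" using assms subgroup_Aut[OF N] by (simp add: supported_mon)
  show "mon a (h \<circ> \<nu>) = unit_of h * mon (frac_ext (ainv h) a) \<nu>"
    using assms subgroup_Aut[OF N] by (simp add: mon_mult frac_ext_comp [symmetric])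
qed

lemma acc_supported_finite:
  assumes "finite R" "R \<subseteq> N'" and ex: "\<And>\<rho>. \<rho> \<in> N' \<Longrightarrow> \<exists>r\<in>R. \<exists>\<nu>\<in>N. \<rho> = r \<circ> \<nu>"
  shows "acc (lideal (supported N'))"
proof -
  obtain n and f :: "nat \<Rightarrow> 'a \<Rightarrow> 'a" where f: "R = f ` {i. i < n}"
    using finite_imp_nat_seg_image_inj_on[OF assms(1)] by blast
  \<comment> \<open>The normalizing sequence must lie in \<open>N'\<close> at every index, so the
    identity fills the places from \<open>n\<close> on.\<close>
  define h where "h k = (if k < n then f k else id)" for k
  have hN: "h k \<in> N'" for k using f assms(2) subgroup_id[OF N'] by (auto simp: h_def)
  interpret normalizing "supported N" "\<lambda>k. unit_of (h k)"
    by (rule normalizing_supported[OF N]) (use hN subgroup_Aut[OF N'] nor nor' in blast)+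
  have "supported N' \<subseteq> pspan (supported N) (\<lambda>k. unit_of (h k)) n"
  proof
    fix y assume "y \<in> supported N'"
    then show "y \<in> pspan (supported N) (\<lambda>k. unit_of (h k)) n"
    proof (induction y rule: supported_induct)
      case (mon a \<rho>)
      then obtain r \<nu> where r: "r \<in> R" "\<nu> \<in> N" "\<rho> = r \<circ> \<nu>" using ex by blast
      then obtain k where k: "k < n" "r = h k" using f by (auto simp: h_def)
      obtain s where "s \<in> supported N" "mon a \<rho> = unit_of (h k) * s"
        using mon_factor[of "h k" \<nu> a] subgroup_Aut[OF N' hN] r k by blast
      then show ?case using pspan_gen[OF k(1)] by simp
    qed (use lmod_0[OF pspan_lmod] lmod_add[OF pspan_lmod] in blast)+
  qed
  then show ?thesis using acc_finite_extension[OF acc supported_subset[OF sub]] by blast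
qed

text \<open>Here \<open>x\<close> represents a generator of the quotient. The hypothesis on
  \<open>\<rho>\<close> is phrased with natural exponents: multiplication by a power of
  \<open>x\<close> makes negative exponents disappear, matching the Laurent polynomial
  argument.\<close>

lemma acc_supported_cyclic:
  assumes x: "x \<in> N'" and ex: "\<And>\<rho>. \<rho> \<in> N' \<Longrightarrow> \<exists>m k. \<exists>\<nu>\<in>N. x ^^ m \<circ> \<rho> = x ^^ k \<circ> \<nu>"
  shows "acc (lideal (supported N'))"
proof -
  have xA: "x \<in> Aut" by (rule subgroup_Aut[OF N' x])
  have xk: "x ^^ k \<in> N'" for k by (rule funpow_subgroup[OF N' x])
  note xkA = subgroup_Aut[OF N' xk]
  have u: "(\<lambda>k. unit_of (x ^^ k)) = (\<lambda>k. unit_of x ^ k)" using unit_power[OF xA] by auto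
  have norm: "normalizing (supported N) (\<lambda>k. unit_of x ^ k)"
    unfolding u [symmetric]
    by (rule normalizing_supported[OF N]) (use xk xkA nor nor' in blast)+
  interpret normalizing "supported N" "\<lambda>k. unit_of x ^ k" by (rule norm)
  let ?P = "pspan (supported N) (\<lambda>k. unit_of x ^ k)"
  have shift: "unit_of x ^ j * p \<in> ?P (j + n)" if "p \<in> ?P n" for j n p
  proof (induction j)
    case (Suc j)
    then show ?case using pspan_power_shift[OF norm Suc] by (simp add: mult.assoc)
  qed (use that in simp)
  show ?thesis
  proof (rule acc_cyclic_extension[OF norm acc supported_subset[OF sub] is_subring_supported[OF N']])
    show "unit_of x \<in> supported N'" "unit_of (ainv x) \<in> supported N'" "unit_of (ainv x) * unit_of x = 1"
      using x xA subgroup_inv[OF N' x] by (simp_all add: supported_mon)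
    fix f assume "f \<in> supported N'"
    then show "\<exists>m n. unit_of x ^ m * f \<in> ?P n"
    proof (induction f rule: supported_induct)
      case zero
      have "unit_of x ^ 0 * 0 \<in> ?P 0" by simp
      then show ?case by blast
    next
      case (add f g)
      then obtain i m j n where f: "unit_of x ^ i * f \<in> ?P m" and g: "unit_of x ^ j * g \<in> ?P n" by blast
      \<comment> \<open>Both summands are brought to the exponent \<open>i + j\<close>, at the price
        of larger degree bounds.\<close>
      have "unit_of x ^ j * (unit_of x ^ i * f) \<in> ?P (j + m)" by (rule shift[OF f])
      moreover have "unit_of x ^ i * (unit_of x ^ j * g) \<in> ?P (i + n)" by (rule shift[OF g])
      ultimately have "unit_of x ^ (i + j) * f \<in> ?P (max (j + m) (i + n))"
        "unit_of x ^ (i + j) * g \<in> ?P (max (j + m) (i + n))"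
        using pspan_incl[of "j + m" "max (j + m) (i + n)"] pspan_incl[of "i + n" "max (j + m) (i + n)"]
        by (auto simp: mult.assoc [symmetric] power_add [symmetric] add.commute)
      then have "unit_of x ^ (i + j) * (f + g) \<in> ?P (max (j + m) (i + n))"
        unfolding distrib_left by (rule lmod_add[OF pspan_lmod])
      then show ?case by blast
    next
      case (mon a \<rho>)
      then obtain m k \<nu> where \<nu>: "\<nu> \<in> N" "x ^^ m \<circ> \<rho> = x ^^ k \<circ> \<nu>" using ex by blast
      have "unit_of x ^ m * mon a \<rho> = mon (frac_ext (x ^^ m) a) (x ^^ k \<circ> \<nu>)"
        using unit_power[OF xA, of m] mon(2) \<nu>(2) by (simp add: mon_mult)
      moreover obtain s where "s \<in> supported N" "mon (frac_ext (x ^^ m) a) (x ^^ k \<circ> \<nu>) = unit_of (x ^^ k) * s"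
        using mon_factor[OF xkA \<nu>(1)] by blast
      ultimately have "unit_of x ^ m * mon a \<rho> \<in> ?P (Suc k)"
        using pspan_gen[of k "Suc k" s] unit_power[OF xA, of k] by simp
      then show ?case by blast
    qed
  qed
qed

end

text \<open>This ring is the field \<open>L\<close>, whose left ideals are zero and everything. It
  starts the induction along the series.\<close>

lemma acc_supported_id: "acc (lideal (supported {id}))"
  unfolding acc_def
proof (intro allI impI)
  fix C :: "nat \<Rightarrow> 'a sgr set" assume C: "\<forall>n. lideal (supported {id}) (C n) \<and> C n \<subseteq> C (Suc n)"
  have full: "C n = supported {id}" if x: "x \<in> C n" "x \<noteq> 0" for n x
  proof -
    have l: "lmod (supported {id}) (C n)" and s: "C n \<subseteq> supported {id}" using C by (auto simp: lideal_def)
    have "x \<in> supported {id}" using s x(1) by (rule subsetD)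
    then obtain a where a: "x = scalar a" unfolding supported_id by (rule exE)
    have "a \<noteq> 0" using x(2) unfolding a by auto
    then have "inverse a * a = 1" by (rule left_inverse)
    then have "b * inverse a * a = b" for b by (simp only: mult.assoc mult_1_right)
    then have "scalar (b * inverse a) * x = scalar b" for b
      unfolding a mon_mult[OF Aut_id Aut_id] frac_ext_id id_comp by (rule arg_cong)
    moreover have "scalar (b * inverse a) * x \<in> C n" for b
      by (rule lmod_mult[OF l _ x(1)]) (simp add: supported_mon)
    ultimately have sc: "scalar b \<in> C n" for b by simp
    show ?thesis
    proof
      show "C n \<subseteq> supported {id}" by (rule s)
      show "supported {id} \<subseteq> C n"
      proof
        fix y :: "'a sgr" assume "y \<in> supported {id}"
        then show "y \<in> C n" unfolding supported_id using sc by auto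
      qed
    qed
  qed
  show "\<exists>n. \<forall>m\<ge>n. C m = C n"
  proof (cases "\<exists>n. \<exists>x\<in>C n. x \<noteq> 0")
    case True
    then obtain n x where x: "x \<in> C n" "x \<noteq> 0" by blast
    have "C m = C n" if "m \<ge> n" for m
    proof -
      have "C n \<subseteq> C m" using lift_Suc_mono_le[where f = C] C that by blast
      then show ?thesis using full[of x m] full[of x n] x by blast
    qed
    then show ?thesis by blast
  next
    case False
    moreover have "0 \<in> C n" for n using C by (simp add: lideal_def lmod_def)
    ultimately have "C n = {0}" for n by blast
    then show ?thesis by blast
  qed
qed

lemma acc_supported_step:
  assumes N': "subgroup N' ring_aut_group" and nor: "N \<lhd> ring_aut_group\<lparr>carrier := N'\<rparr>"
    and F: "finite (carrier (ring_aut_group\<lparr>carrier := N'\<rparr> Mod N)) \<or>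
      cyclic_group (ring_aut_group\<lparr>carrier := N'\<rparr> Mod N)"
    and acc: "acc (lideal (supported N))"
  shows "acc (lideal (supported N'))"
proof -
  define K where "K = ring_aut_group\<lparr>carrier := N'\<rparr>"
  have K: "carrier K = N'" "\<And>f g. f \<otimes>\<^bsub>K\<^esub> g = f \<circ> g" "\<one>\<^bsub>K\<^esub> = id" by (simp_all add: K_def)
  have gK: "group K" unfolding K_def by (rule subgroup.subgroup_is_group[OF N' group_ring_aut_group])
  have norK: "N \<lhd> K" using nor by (simp add: K_def)
  have sNK: "subgroup N K" using norK by (rule normal_imp_subgroup)
  have sub: "N \<subseteq> N'" using subgroup.subset[OF sNK] K by simp
  have N: "subgroup N ring_aut_group"
    using group.incl_subgroup[OF group_ring_aut_group N'] sNK by (simp add: K_def)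
  have invK: "inv\<^bsub>K\<^esub> g = ainv g" if "g \<in> N'" for g
    using group.m_inv_consistent[OF group_ring_aut_group N' that] subgroup_Aut[OF N' that]
    by (simp add: K_def)
  have conj: "g \<circ> \<nu> \<circ> ainv g \<in> N" if "g \<in> N'" "\<nu> \<in> N" for g \<nu>
    using normal.inv_op_closed2[OF norK, of g \<nu>] that invK K by simp
  have conj': "ainv g \<circ> \<nu> \<circ> g \<in> N" if "g \<in> N'" "\<nu> \<in> N" for g \<nu>
    by (rule nor'[OF N N' sub _ acc that]) (rule conj)
  have coset: "\<exists>\<nu>\<in>N. \<rho> = \<nu> \<circ> r" if "\<rho> \<in> N'" "N #>\<^bsub>K\<^esub> r = N #>\<^bsub>K\<^esub> \<rho>" for \<rho> r
  proof -
    have "\<rho> \<in> N #>\<^bsub>K\<^esub> r" using group.rcos_self[OF gK _ sNK, of \<rho>] that K by simp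
    then show ?thesis by (auto simp: r_coset_def K)
  qed
  have cF: "carrier (K Mod N) = (\<lambda>r. N #>\<^bsub>K\<^esub> r) ` N'" by (simp add: carrier_FactGroup K)
  from F[folded K_def] show ?thesis
  proof
    assume "finite (carrier (K Mod N))"
    then obtain R where R: "R \<subseteq> N'" "finite R" "(\<lambda>r. N #>\<^bsub>K\<^esub> r) ` N' = (\<lambda>r. N #>\<^bsub>K\<^esub> r) ` R"
      unfolding cF by (metis finite_subset_image order_refl)
    show ?thesis
    proof (rule acc_supported_finite[OF N N' sub conj acc R(2,1)])
      fix \<rho> assume \<rho>: "\<rho> \<in> N'"
      then have "N #>\<^bsub>K\<^esub> \<rho> \<in> (\<lambda>r. N #>\<^bsub>K\<^esub> r) ` R" using R(3) by blast
      then obtain r where r: "r \<in> R" "N #>\<^bsub>K\<^esub> r = N #>\<^bsub>K\<^esub> \<rho>" by auto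
      then obtain \<nu> where \<nu>: "\<nu> \<in> N" "\<rho> = \<nu> \<circ> r" using coset[OF \<rho>] by blast
      have rN: "r \<in> N'" using r R by blast
      \<comment> \<open>The cosets are of the form \<open>N r\<close>, whereas the spans have
        coefficients on the right; normality turns one into the other.\<close>
      have "\<rho> = r \<circ> (ainv r \<circ> \<nu> \<circ> r)"
        using \<nu> subgroup_Aut[OF N' rN] by (simp add: comp_assoc [symmetric])
      then show "\<exists>r\<in>R. \<exists>\<nu>\<in>N. \<rho> = r \<circ> \<nu>" using conj'[OF rN \<nu>(1)] r(1) by blast
    qed
  next
    assume cyc: "cyclic_group (K Mod N)"
    have gF: "group (K Mod N)" by (rule normal.factorgroup_is_group[OF norK])
    obtain c where c: "c \<in> carrier (K Mod N)" "carrier (K Mod N) = range (\<lambda>n::int. c [^]\<^bsub>K Mod N\<^esub> n)"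
      using cyc group.cyclic_group[OF gF] by blast
    obtain x where x: "x \<in> N'" "c = N #>\<^bsub>K\<^esub> x" using c(1) unfolding cF by blast
    have xA: "x \<in> Aut" by (rule subgroup_Aut[OF N' x(1)])
    have xk: "x ^^ k \<in> N'" for k by (rule funpow_subgroup[OF N' x(1)])
    note xkA = subgroup_Aut[OF N' xk]
    have pow: "x [^]\<^bsub>K\<^esub> k = x ^^ k" for k :: nat
    proof (induction k)
      case 0 then show ?case by (simp add: K nat_pow_def id_def)
    next
      case (Suc k)
      then show ?case using K by (simp add: nat_pow_def funpow_Suc_right del: funpow.simps)
    qed
    show ?thesis
    proof (rule acc_supported_cyclic[OF N N' sub conj acc x(1)])
      fix \<rho> assume \<rho>: "\<rho> \<in> N'"
      then have "N #>\<^bsub>K\<^esub> \<rho> \<in> carrier (K Mod N)" unfolding cF by blast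
      then obtain n :: int where "N #>\<^bsub>K\<^esub> \<rho> = c [^]\<^bsub>K Mod N\<^esub> n" using c(2) by auto
      also have "\<dots> = N #>\<^bsub>K\<^esub> (x [^]\<^bsub>K\<^esub> n)"
        using hom_int_pow[OF normal.r_coset_hom_Mod[OF norK] _ gK gF, of x n] x K by simp
      finally obtain \<nu> where \<nu>: "\<nu> \<in> N" "\<rho> = \<nu> \<circ> (x [^]\<^bsub>K\<^esub> n)" using coset[OF \<rho>] by metis
      \<comment> \<open>For negative \<open>n\<close> multiplication by
        \<open>x ^^ nat (- n)\<close> moves \<open>\<rho>\<close> into \<open>N\<close>. Otherwise
        \<open>m = 0\<close>, and the power of \<open>x\<close> is moved to the left by
        normality.\<close>
      show "\<exists>m k. \<exists>\<nu>\<in>N. x ^^ m \<circ> \<rho> = x ^^ k \<circ> \<nu>"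
      proof (cases "n < 0")
        case True
        let ?y = "x ^^ nat (- n)"
        have "x [^]\<^bsub>K\<^esub> n = ainv ?y" using True invK[OF xk] pow by (simp add: int_pow_def2)
        then have "?y \<circ> \<rho> = x ^^ 0 \<circ> (?y \<circ> \<nu> \<circ> ainv ?y)" using \<nu> by (simp add: comp_assoc)
        then show ?thesis using conj[OF xk \<nu>(1)] by blast
      next
        case False
        let ?y = "x ^^ nat n"
        have "x [^]\<^bsub>K\<^esub> n = ?y" using False pow by (simp add: int_pow_def2)
        then have "x ^^ 0 \<circ> \<rho> = ?y \<circ> (ainv ?y \<circ> \<nu> \<circ> ?y)"
          using \<nu> Aut_comp_inv[OF xkA] by (simp add: comp_assoc [symmetric])
        then show ?thesis using conj'[OF xk \<nu>(1)] by blast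
      qed
    qed
  qed
qed

lemma acc_supported_polycyclic:
  assumes M: "subgroup M ring_aut_group" and pc: "polycyclic_by_finite (ring_aut_group\<lparr>carrier := M\<rparr>)"
  shows "acc (lideal (supported M))"
proof -
  obtain n :: nat and N where N0: "N 0 = {id}" and Nn: "N n = M"
    and step: "\<And>i. i < n \<Longrightarrow> N i \<lhd> ring_aut_group\<lparr>carrier := N (Suc i)\<rparr>"
    and F: "\<And>i. i < n \<Longrightarrow> finite (carrier (ring_aut_group\<lparr>carrier := N (Suc i)\<rparr> Mod N i)) \<or>
      cyclic_group (ring_aut_group\<lparr>carrier := N (Suc i)\<rparr> Mod N i)"
    using pc unfolding polycyclic_by_finite_def Let_def by auto
  \<comment> \<open>Each member of the series is given as a subgroup of the next one only, so being
    a group of automorphisms is passed down from \<open>M\<close>, whence the index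
    \<open>n - j\<close>.\<close>
  have subgr: "subgroup (N (n - j)) ring_aut_group" if "j \<le> n" for j
    using that
  proof (induction j)
    case 0 then show ?case using M Nn by simp
  next
    case (Suc j)
    then have S: "subgroup (N (n - j)) ring_aut_group" and e: "Suc (n - Suc j) = n - j" "n - Suc j < n" by auto
    then have "subgroup (N (n - Suc j)) (ring_aut_group\<lparr>carrier := N (n - j)\<rparr>)"
      using normal_imp_subgroup[OF step[of "n - Suc j"]] by simp
    then show ?case by (rule group.incl_subgroup[OF group_ring_aut_group S])
  qed
  have "acc (lideal (supported (N i)))" if "i \<le> n" for i
    using that
  proof (induction i)
    case 0 then show ?case using acc_supported_id N0 by simp
  next
    case (Suc i)
    have "subgroup (N (Suc i)) ring_aut_group" using subgr[of "n - Suc i"] Suc.prems by simp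
    then show ?case using acc_supported_step[OF _ step F] Suc by simp
  qed
  then show ?thesis using Nn by blast
qed

section \<open>Galois rings\<close>

lemma skew_monoid_ring_simps:
  "\<zero>\<^bsub>skew_monoid_ring M\<^esub> = cf 0" "\<one>\<^bsub>skew_monoid_ring M\<^esub> = cf 1"
  "cf x \<oplus>\<^bsub>skew_monoid_ring M\<^esub> cf y = cf (x + y)" "cf x \<otimes>\<^bsub>skew_monoid_ring M\<^esub> cf y = cf (x * y)"
  unfolding cf_times [symmetric] by (simp_all add: skew_monoid_ring_def cf_zero cf_plus one_sgr_def cf_mon del: unit_id)

lemma carrier_skew_monoid_ring:
  assumes "M \<subseteq> Aut" shows "carrier (skew_monoid_ring M) = cf ` supported M"
proof
  show "cf ` supported M \<subseteq> carrier (skew_monoid_ring M)"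
    by (auto simp: skew_monoid_ring_def supported_def)
  show "carrier (skew_monoid_ring M) \<subseteq> cf ` supported M"
  proof
    fix f assume f: "f \<in> carrier (skew_monoid_ring M)"
    then have "f \<in> carrier (skew_monoid_ring Aut)" using assms by (auto simp: skew_monoid_ring_def)
    then have e: "cf (Abs_sgr f) = f" by (rule Abs_sgr_inverse)
    then have "Abs_sgr f \<in> supported M" using f by (auto simp: supported_def skew_monoid_ring_def)
    then show "f \<in> cf ` supported M" using e by (metis imageI)
  qed
qed

lemma inj_cf: "inj cf"
  by (rule injI) (simp add: cf_inject)

lemma ring_copy_skew_monoid_ring:
  assumes "subgroup M ring_aut_group"
  shows "ring_copy cf (skew_monoid_ring M) (supported M)"
proof
  show "carrier (skew_monoid_ring M) = cf ` supported M"
    using assms by (intro carrier_skew_monoid_ring) (simp add: subgroup_Aut_iff)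
qed (simp_all add: inj_cf is_subring_supported[OF assms] skew_monoid_ring_simps)

context galois_pair
begin

lemma skew_act_fixed_iff:
  assumes "g \<in> G" shows "skew_act g (cf x) = cf x \<longleftrightarrow> unit_of g * x = x * unit_of g"
proof -
  have g: "g \<in> Aut" by (rule G_Aut[OF assms])
  have "skew_act g (cf x) = cf x \<longleftrightarrow> unit_of g * x * unit_of (ainv g) = x"
    unfolding cf_conj[OF g, symmetric] by (rule cf_inject)
  also have "\<dots> \<longleftrightarrow> unit_of g * x = x * unit_of g"
  proof
    assume "unit_of g * x * unit_of (ainv g) = x"
    then have "unit_of g * x * unit_of (ainv g) * unit_of g = x * unit_of g" by simp
    then show "unit_of g * x = x * unit_of g" using g by (simp add: mult.assoc)
  next
    assume "unit_of g * x = x * unit_of g"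
    then show "unit_of g * x * unit_of (ainv g) = x" using g by (simp add: mult.assoc)
  qed
  finally show ?thesis .
qed

lemma carrier_skew_fixed_ring: "carrier (skew_fixed_ring G M) = cf ` fixedM"
proof -
  have "carrier (skew_fixed_ring G M) = {f \<in> cf ` skewM. \<forall>g\<in>G. skew_act g f = f}"
    using carrier_skew_monoid_ring[of M] M by (simp add: skew_fixed_ring_def subgroup_Aut_iff)
  also have "\<dots> = cf ` fixedM" unfolding fixedM_def using skew_act_fixed_iff by auto
  finally show ?thesis .
qed

lemma skew_fixed_ring_simps:
  "\<zero>\<^bsub>skew_fixed_ring G M\<^esub> = cf 0" "\<one>\<^bsub>skew_fixed_ring G M\<^esub> = cf 1"
  "cf x \<oplus>\<^bsub>skew_fixed_ring G M\<^esub> cf y = cf (x + y)" "cf x \<otimes>\<^bsub>skew_fixed_ring G M\<^esub> cf y = cf (x * y)"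
  by (simp_all add: skew_fixed_ring_def skew_monoid_ring_simps)

lemma ring_copy_skew_fixed_ring: "ring_copy cf (skew_fixed_ring G M) fixedM"
  by unfold_locales
    (simp_all add: inj_cf is_subring_fixedM skew_fixed_ring_simps carrier_skew_fixed_ring)

lemma scalar_fixedM: "(\<And>g. g \<in> G \<Longrightarrow> frac_ext g a = a) \<Longrightarrow> scalar a \<in> fixedM"
  using scalar_M G_Aut by (simp add: fixedM_def mon_mult)

text \<open>Nonzero elements \<open>b\<close> of \<open>\<Gamma>\<close> serve as denominators:
  \<open>1/b\<close> is fixed by \<open>G\<close>, so \<open>b\<close> is a unit of the fixed ring.
  The equation for \<open>U K\<close> puts the fractions on the right, the side on which
  \<open>ore_order\<close> clears denominators.\<close>

lemma ore_order_galois_ring: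
  assumes gr: "galois_ring G M U" and acc: "acc (rideal fixedM)"
  shows "ore_order fixedM (cf -` U) ((\<lambda>b. scalar (of_dom b)) ` (fixed_points G - {0}))"
    and "ring_copy cf ((skew_fixed_ring G M)\<lparr>carrier := U\<rparr>) (cf -` U)"
proof -
  interpret R: ring_copy cf "skew_fixed_ring G M" fixedM by (rule ring_copy_skew_fixed_ring)
  let ?R = "skew_fixed_ring G M" and ?D = "(\<lambda>b. scalar (of_dom b)) ` (fixed_points G - {0})"
  let ?K = "(\<lambda>a. monomial a id) ` subring_fractions (fixed_points G)"
  have sU: "subring U ?R" and \<Gamma>: "(\<lambda>a. monomial (of_dom a) id) ` fixed_points G \<subseteq> U"
    and UK: "U \<cdot>\<^bsub>?R\<^esub> ?K = carrier ?R"
    using gr unfolding galois_ring_def Let_def by auto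
  have UR: "U \<subseteq> cf ` fixedM"
    using subringE(1)[OF sU] by (simp add: carrier_skew_fixed_ring)
  then have U: "U = cf ` (cf -` U)" by blast
  have Ufix: "cf -` U \<subseteq> fixedM"
  proof
    fix x assume "x \<in> cf -` U"
    then have "cf x \<in> cf ` fixedM" using UR by blast
    then show "x \<in> fixedM" by auto
  qed
  have is_subring_U: "is_subring (cf -` U)"
    unfolding is_subring_def
  proof (intro conjI ballI)
    show "0 \<in> cf -` U" "1 \<in> cf -` U" using subringE(2,3)[OF sU] by (simp_all add: skew_fixed_ring_simps)
    show "x + y \<in> cf -` U" "x * y \<in> cf -` U" if "x \<in> cf -` U" "y \<in> cf -` U" for x y
      using subringE(6,7)[OF sU, of "cf x" "cf y"] that by (simp_all add: skew_fixed_ring_simps)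
    show "- x \<in> cf -` U" if x: "x \<in> cf -` U" for x
    proof -
      interpret S: ring ?R by (rule R.ring)
      have "cf (- x) = \<ominus>\<^bsub>?R\<^esub> cf x"
        by (rule S.minus_equality [symmetric])
          (use Ufix x is_subring_uminus[OF is_subring_fixedM] in \<open>auto simp: skew_fixed_ring_simps carrier_skew_fixed_ring\<close>)
      then show ?thesis using subringE(5)[OF sU, of "cf x"] x by simp
    qed
  qed
  have scU: "scalar (of_dom a) \<in> cf -` U" if "a \<in> fixed_points G" for a
    using \<Gamma> that by (auto simp: cf_mon)
  have mulD: "scalar (of_dom a) * scalar (of_dom b) = scalar (of_dom (a * b))" for a b :: 'a
    by (simp add: mon_mult)
  show "ring_copy cf (?R\<lparr>carrier := U\<rparr>) (cf -` U)"
    by unfold_locales (use U in \<open>simp_all add: inj_cf is_subring_U skew_fixed_ring_simps\<close>)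
  have fpm: "a * b \<in> fixed_points G" if "a \<in> fixed_points G" "b \<in> fixed_points G" for a b
    using that G_Aut by (auto simp: fixed_points_def Aut_mult)
  have fp1: "1 \<in> fixed_points G" using G_Aut by (auto simp: fixed_points_def Aut_one)
  have Dm: "d * e \<in> ?D" if "d \<in> ?D" "e \<in> ?D" for d e
  proof -
    obtain a b where ab: "d = scalar (of_dom a)" "e = scalar (of_dom b)" "a \<in> fixed_points G - {0}" "b \<in> fixed_points G - {0}"
      using \<open>d \<in> ?D\<close> \<open>e \<in> ?D\<close> by blast
    then have "d * e = scalar (of_dom (a * b))" "a * b \<in> fixed_points G - {0}" using fpm mulD by auto
    then show ?thesis by blast
  qed
  have Dc: "d * e = e * d" if "d \<in> ?D" "e \<in> ?D" for d e
    using that by (auto simp: mon_mult mult.commute)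
  \<comment> \<open>Induction over the sums that make up \<open>U K\<close>: a product
    \<open>u (a/b)\<close> is cleared by \<open>b\<close>, a sum by the product of two denominators.
    The induction runs over functions \<open>z\<close>, and \<open>z = cf x\<close> links them to
    elements of the type.\<close>
  have den: "\<exists>d\<in>?D. \<exists>u\<in>cf -` U. z = cf x \<longrightarrow> x * d = u" if "z \<in> U \<cdot>\<^bsub>?R\<^esub> ?K" for z x
    using that
  proof (induction z arbitrary: x rule: ideal_prod.induct)
    case (prod i j)
    then obtain u a b where u: "i = cf u" "u \<in> cf -` U" and ab: "j = monomial (of_dom a / of_dom b) id"
      "a \<in> fixed_points G" "b \<in> fixed_points G" "b \<noteq> 0"
      using U unfolding subring_fractions_def by blast
    have j: "j = cf (scalar (of_dom a / of_dom b))" using ab by (simp add: cf_mon)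
    have b0: "of_dom b \<noteq> 0" using ab by (simp add: Zero_fract_def eq_fract)
    have "of_dom a / of_dom b * of_dom b = of_dom a"
      using nonzero_eq_divide_eq[OF b0, of "of_dom a / of_dom b" "of_dom a"] by blast
    then have "scalar (of_dom a / of_dom b) * scalar (of_dom b) = scalar (of_dom a)"
      unfolding mon_mult[OF Aut_id Aut_id] frac_ext_id id_comp by (rule arg_cong)
    then have "u * scalar (of_dom a / of_dom b) * scalar (of_dom b) = u * scalar (of_dom a)"
      by (simp only: mult.assoc)
    moreover have "u * scalar (of_dom a) \<in> cf -` U" using is_subring_mult[OF is_subring_U u(2) scU[OF ab(2)]] .
    moreover have "i \<otimes>\<^bsub>?R\<^esub> j = cf x \<longrightarrow> x = u * scalar (of_dom a / of_dom b)"
      unfolding u j skew_fixed_ring_simps cf_inject by auto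
    ultimately show ?case using ab by blast
  next
    case (sum s1 s2)
    have "s1 \<in> cf ` fixedM" "s2 \<in> cf ` fixedM"
      using sum.hyps unfolding UK carrier_skew_fixed_ring by auto
    then obtain x1 x2 where x: "s1 = cf x1" "s2 = cf x2" by blast
    obtain d1 where d1: "d1 \<in> ?D" "x1 * d1 \<in> cf -` U" using sum.IH(1)[of x1] x by blast
    obtain d2 where d2: "d2 \<in> ?D" "x2 * d2 \<in> cf -` U" using sum.IH(2)[of x2] x by blast
    have "(x1 + x2) * (d1 * d2) = x1 * d1 * d2 + x2 * d2 * d1"
      using Dc[OF d1(1) d2(1)] by (simp add: distrib_right mult.assoc)
    moreover have "d1 \<in> cf -` U" "d2 \<in> cf -` U" using d1(1) d2(1) scU by auto
    ultimately have "(x1 + x2) * (d1 * d2) \<in> cf -` U"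
      using is_subring_add[OF is_subring_U is_subring_mult[OF is_subring_U d1(2)] is_subring_mult[OF is_subring_U d2(2)]] by metis
    moreover have "s1 \<oplus>\<^bsub>?R\<^esub> s2 = cf x \<longrightarrow> x = x1 + x2"
      unfolding x skew_fixed_ring_simps cf_inject by auto
    ultimately show ?case using Dm[OF d1(1) d2(1)] by blast
  qed
  show "ore_order fixedM (cf -` U) ?D"
  proof (rule ore_order.intro[OF is_subring_fixedM is_subring_U Ufix _ _ Dm Dc _ _ acc])
    show "?D \<subseteq> cf -` U" using scU by blast
    show "1 \<in> ?D"
    proof (rule image_eqI)
      show "1 = scalar (of_dom (1 :: 'a))" unfolding One_fract_def [symmetric] by simp
    qed (use fp1 in simp)
    show "\<exists>d'\<in>fixedM. d * d' = 1 \<and> d' * d = 1" if "d \<in> ?D" for d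
    proof -
      obtain b where b: "d = scalar (of_dom b)" "b \<in> fixed_points G" "b \<noteq> 0" using \<open>d \<in> ?D\<close> by blast
      have "scalar (Fraction_Field.Fract 1 b) \<in> fixedM"
      proof (rule scalar_fixedM)
        fix g assume g: "g \<in> G"
        then have "g b = b" using b(2) by (simp add: fixed_points_def)
        then show "frac_ext g (Fraction_Field.Fract 1 b) = Fraction_Field.Fract 1 b"
          using frac_ext_Fract[OF G_Aut[OF g] b(3), of 1] Aut_one[OF G_Aut[OF g]] by simp
      qed
      moreover have "of_dom b * Fraction_Field.Fract 1 b = 1"
        using b(3) by (simp add: One_fract_def eq_fract)
      then have "d * scalar (Fraction_Field.Fract 1 b) = 1" "scalar (Fraction_Field.Fract 1 b) * d = 1"
        unfolding b(1) mon_mult[OF Aut_id Aut_id] frac_ext_id id_comp by (metis unit_id, metis mult.commute unit_id)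
      ultimately show ?thesis by blast
    qed
    show "\<exists>d\<in>?D. x * d \<in> cf -` U" if "x \<in> fixedM" for x
      using den[of "cf x" x] that unfolding UK carrier_skew_fixed_ring by blast
  qed
qed

end

theorem theorem3p23:
  fixes G M :: "('a::idom \<Rightarrow> 'a) set" and U :: "'a skew set"
  assumes "galois_setting G M"
    and "galois_ring G M U"
    and "subgroup M ring_aut_group" and "M \<noteq> {id}"
  shows "simple_ring (skew_monoid_ring M) \<and>
    ((\<forall>g\<in>G. g \<noteq> id \<longrightarrow> outer_automorphism (skew_monoid_ring M) (skew_act g)) \<and>
       (\<exists>y :: 'a fract. of_nat (card G) * y = 1)
     \<longrightarrow> simple_ring (skew_fixed_ring G M)) \<and>
    ((\<forall>g\<in>G. g \<noteq> id \<longrightarrow> x_outer_automorphism (skew_monoid_ring M) (skew_act g)) \<and>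
       polycyclic_by_finite (ring_aut_group\<lparr>carrier := M\<rparr>)
     \<longrightarrow> prime_ring (skew_fixed_ring G M) \<and> lr_noetherian (skew_fixed_ring G M) \<and>
         prime_ring ((skew_fixed_ring G M)\<lparr>carrier := U\<rparr>) \<and>
         right_goldie ((skew_fixed_ring G M)\<lparr>carrier := U\<rparr>))"
proof -
  have G: "subgroup G ring_aut_group" "finite G"
    and disj: "(M <#>\<^bsub>ring_aut_group\<^esub> set_inv\<^bsub>ring_aut_group\<^esub> M) \<inter> G = {id}"
    and conj: "\<And>g \<mu>. g \<in> G \<Longrightarrow> \<mu> \<in> M \<Longrightarrow> g \<otimes>\<^bsub>ring_aut_group\<^esub> \<mu> \<otimes>\<^bsub>ring_aut_group\<^esub> inv\<^bsub>ring_aut_group\<^esub> g \<in> M"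
    using assms(1) unfolding galois_setting_def by auto
  note M = assms(3)
  interpret galois_pair G M
  proof (rule galois_pair.intro[OF G(1) M G(2)])
    show "M \<inter> G = {id}"
    proof
      show "{id} \<subseteq> M \<inter> G" using subgroup_id[OF M] subgroup_id[OF G(1)] by simp
      show "M \<inter> G \<subseteq> {id}"
      proof
        \<comment> \<open>Since \<open>id \<in> M\<close>, every element of \<open>M\<close> is a
          quotient of two elements of \<open>M\<close>, so the disjointness condition of the setting
          applies to it.\<close>
        fix \<mu> assume \<mu>: "\<mu> \<in> M \<inter> G"
        have "inv\<^bsub>ring_aut_group\<^esub> id \<in> set_inv\<^bsub>ring_aut_group\<^esub> M"
          using subgroup_id[OF M] unfolding SET_INV_def by blast
        moreover have "\<mu> = \<mu> \<otimes>\<^bsub>ring_aut_group\<^esub> inv\<^bsub>ring_aut_group\<^esub> id" by (simp add: inv_id)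
        ultimately have "\<mu> \<in> M <#>\<^bsub>ring_aut_group\<^esub> set_inv\<^bsub>ring_aut_group\<^esub> M"
          using \<mu> unfolding set_mult_def by blast
        then show "\<mu> \<in> {id}" using disj \<mu> by blast
      qed
    qed
    show "g \<circ> \<mu> \<circ> ainv g \<in> M" if "g \<in> G" "\<mu> \<in> M" for g \<mu>
      using conj[OF that] subgroup_Aut[OF G(1) that(1)] by simp
  qed
  interpret S: ring_copy cf "skew_monoid_ring M" skewM by (rule ring_copy_skew_monoid_ring[OF M])
  interpret R: ring_copy cf "skew_fixed_ring G M" fixedM by (rule ring_copy_skew_fixed_ring)
  have simple: "simple_ring (skew_fixed_ring G M)"
    by (rule R.simple_ring) (rule fixedM_simple)
  have prime: "prime_ring (skew_fixed_ring G M)"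
  proof (rule R.prime_ring)
    fix J i y assume "lideal fixedM J" "rideal fixedM J" "y \<in> J" "y \<noteq> 0" and z: "\<And>j. j \<in> J \<Longrightarrow> i * j = 0"
    then have "1 \<in> J" by (intro fixedM_simple)
    then show "i = 0" using z by fastforce
  qed
  have "lr_noetherian (skew_fixed_ring G M) \<and> prime_ring ((skew_fixed_ring G M)\<lparr>carrier := U\<rparr>) \<and>
      right_goldie ((skew_fixed_ring G M)\<lparr>carrier := U\<rparr>)"
    if pc: "polycyclic_by_finite (ring_aut_group\<lparr>carrier := M\<rparr>)"
  proof -
    have l: "acc (lideal skewM)" by (rule acc_supported_polycyclic[OF M pc])
    have r: "acc (rideal fixedM)" by (rule acc_rideal_fixedM[OF acc_rideal_supported[OF M l]])
    interpret O: ore_order fixedM "cf -` U" "(\<lambda>b. scalar (of_dom b)) ` (fixed_points G - {0})"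
      by (rule ore_order_galois_ring(1)[OF assms(2) r])
    interpret V: ring_copy cf "(skew_fixed_ring G M)\<lparr>carrier := U\<rparr>" "cf -` U"
      by (rule ore_order_galois_ring(2)[OF assms(2) r])
    have "prime_ring ((skew_fixed_ring G M)\<lparr>carrier := U\<rparr>)"
    proof (rule V.prime_ring)
      fix J i y assume "lideal (cf -` U) J" "rideal (cf -` U) J" and y: "y \<in> J" "y \<noteq> 0"
        and z: "\<And>j. j \<in> J \<Longrightarrow> i * j = 0"
      then show "i = 0" by (intro O.prime_order[of J y i] fixedM_simple)
    qed
    moreover have "right_goldie ((skew_fixed_ring G M)\<lparr>carrier := U\<rparr>)"
      by (rule V.right_goldie[OF O.no_infinite_direct_sum O.acc_annihilators])
    ultimately show ?thesis using R.lr_noetherian[OF acc_lideal_fixedM[OF l] r] by blast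
  qed
  moreover have "simple_ring (skew_monoid_ring M)"
    by (rule S.simple_ring) (rule supported_simple[OF M])
  ultimately show ?thesis using simple prime by blast
qed

end
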